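(* Suppose $(\alpha,\beta)\in\mathbb{Q}^2$ is such that $\{\alpha\}=\frac aq$, $\{\beta\}=\frac bq$ with $\gcd(a,b,q)=1$. Let $\lambda$ be a probability measure on $\mathbb{R}$, absolutely continuous with respect to Lebesgue measure. Then, for any continuous bounded function $F$ on $\Gamma\backslash G$, $$\lim_{t\to\infty}\int_{\mathbb{R}}F\left(\Gamma\left(I;\begin{pmatrix}\alpha\\ \beta\end{pmatrix}\right)\Psi^u\Phi^t\right)d\lambda(u)=\int_{\Gamma\backslash G}F\,d\mu^{(\alpha,\beta)}_{\Gamma\backslash G}.$$
   Context: $\{u\}$ denotes the fractional part of $u$; $a,b\ge 0$ and $q\ge1$ are integers. Group and lattice. $G=\mathrm{SL}(2,\mathbb{R})\ltimes\mathbb{R}^2$ with law $(M;\xi)(M';\xi')=(MM';\xi+M\xi')$. $\Gamma_\theta<\mathrm{SL}(2,\mathbb{Z})$ is the theta group generated by $\begin{pmatrix}0&-1\\1&0\end{pmatrix}$ and $\begin{pmatrix}1&2\\0&1\end{pmatrix}$, and $\Gamma=\Gamma_\theta\ltimes\mathbb{Z}^2<G$. Put $$\Phi^t=\left(\begin{pmatrix}e^{-t/2}&0\\0&e^{t/2}\end{pmatrix};\begin{pmatrix}0\\0\end{pmatrix}\right),\qquad \Psi^x=\left(\begin{pmatrix}1&x\\0&1\end{pmatrix};\begin{pmatrix}0\\0\end{pmatrix}\right).$$ Coordinates. Via the Iwasawa decomposition $M=\begin{pmatrix}1&x\\0&1\end{pmatrix}\begin{pmatrix}y^{1/2}&0\\0&y^{-1/2}\end{pmatrix}\begin{pmatrix}\cos\phi&-\sin\phi\\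 \sin\phi&\cos\phi\end{pmatrix}$, elements $(M;\xi)\in G$ are identified with $(x+iy,\phi;\xi)\in\mathfrak{H}\times[0,2\pi)\times\mathbb{R}^2$, where $\mathfrak{H}$ is the upper half-plane. A fundamental domain for $\Gamma\backslash G$ is $\mathcal{F}_\Gamma=\mathcal{F}_{\Gamma_\theta}\times[0,\pi)\times[-\frac12,\frac12)^2$, with $\mathcal{F}_{\Gamma_\theta}=\{z\in\mathfrak{H}:|z|>1,\ |z-2|>1,\ 0\le\mathrm{Re}\,z<2\}$. Measure. $\Gamma$ acts on $\mathbb{R}^2/\mathbb{Z}^2$, identified with $[-\frac12,\frac12)^2$, by affine maps $(M;v)\cdot\xi=v+M\xi$ modulo $\mathbb{Z}^2$. $S^{(\alpha,\beta)}\subset[-\frac12,\frac12)^2$ is the (finite) $\Gamma$-orbit of the representative of $(\alpha,\beta)$ modulo $\mathbb{Z}^2$. $\mu^{(\alpha,\beta)}_{\Gamma\backslash G}$ is the probability measure on $\Gamma\backslash G$ given on $\mathcal{F}_\Gamma$ by $$d\mu^{(\alpha,\beta)}_{\Gamma\backslash G}=\frac{1}{\pi^2|S^{(\alpha,\beta)}|}\frac{dx\,dy\,d\phi}{y^2}\times\sum_{p\in S^{(\alpha,\beta)}}\delta_p.$$ *)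

theory Defs
  imports "HOL-Probability.Probability" "HOL-Algebra.Generated_Groups" "HOL-Algebra.Group_Action"
begin

type_synonym aff = "(real^2^2) \<times> (real^2)"

definition mat2 :: "real \<Rightarrow> real \<Rightarrow> real \<Rightarrow> real \<Rightarrow> real^2^2" where
  "mat2 a b c d = vector [vector [a, b], vector [c, d]]"

definition SL2R :: "(real^2^2) monoid" where
  "SL2R = \<lparr>carrier = {M. det M = 1}, mult = (**), one = mat 1\<rparr>"

definition ASL2R :: "aff monoid" where
  "ASL2R = \<lparr>carrier = {M. det M = 1} \<times> UNIV,
            mult = (\<lambda>(M, \<xi>) (M', \<xi>'). (M ** M', \<xi> + M *v \<xi>')),
            one = (mat 1, 0)\<rparr>"

definition Gamma_theta :: "(real^2^2) set" where
  "Gamma_theta = generate SL2R {mat2 0 (-1) 1 0, mat2 1 2 0 1}"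

definition Gamma_lat :: "aff set" where
  "Gamma_lat = Gamma_theta \<times> {v. \<forall>i. v $ i \<in> \<int>}"

definition Phi :: "real \<Rightarrow> aff" where
  "Phi t = (mat2 (exp (- t / 2)) 0 0 (exp (t / 2)), 0)"

definition Psi :: "real \<Rightarrow> aff" where
  "Psi x = (mat2 1 x 0 1, 0)"

text \<open>
  A point of \<open>\<Gamma>\G\<close> is a coset \<open>\<Gamma>g\<close>, so the space is \<open>rcosets\<^bsub>ASL2R\<^esub> Gamma_lat\<close>. It carries the
  quotient of the topology that \<open>G\<close> has as a subspace of \<open>(real^2^2) \<times> (real^2)\<close>.
\<close>

definition quot_top :: "aff set topology" where
  "quot_top = topology (\<lambda>U. U \<subseteq> rcosets\<^bsub>ASL2R\<^esub> Gamma_lat \<and>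
     openin (top_of_set (carrier ASL2R)) {g \<in> carrier ASL2R. Gamma_lat #>\<^bsub>ASL2R\<^esub> g \<in> U})"

lemma openin_quot_top:
  "openin quot_top U \<longleftrightarrow> U \<subseteq> rcosets\<^bsub>ASL2R\<^esub> Gamma_lat \<and>
     openin (top_of_set (carrier ASL2R)) {g \<in> carrier ASL2R. Gamma_lat #>\<^bsub>ASL2R\<^esub> g \<in> U}"
proof -
  let ?P = "\<lambda>g. Gamma_lat #>\<^bsub>ASL2R\<^esub> g"
  let ?T = "top_of_set (carrier ASL2R)"
  have "istopology (\<lambda>U. U \<subseteq> rcosets\<^bsub>ASL2R\<^esub> Gamma_lat \<and> openin ?T {g \<in> carrier ASL2R. ?P g \<in> U})"
    unfolding istopology_def
  proof (intro conjI allI impI)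
    fix S T
    assume S: "S \<subseteq> rcosets\<^bsub>ASL2R\<^esub> Gamma_lat \<and> openin ?T {g \<in> carrier ASL2R. ?P g \<in> S}"
      and T: "T \<subseteq> rcosets\<^bsub>ASL2R\<^esub> Gamma_lat \<and> openin ?T {g \<in> carrier ASL2R. ?P g \<in> T}"
    have "{g \<in> carrier ASL2R. ?P g \<in> S \<inter> T}
        = {g \<in> carrier ASL2R. ?P g \<in> S} \<inter> {g \<in> carrier ASL2R. ?P g \<in> T}" by blast
    with S T show "openin ?T {g \<in> carrier ASL2R. ?P g \<in> S \<inter> T}" by auto
    show "S \<inter> T \<subseteq> rcosets\<^bsub>ASL2R\<^esub> Gamma_lat" using S by blast
  next
    fix \<K>
    assume K: "\<forall>K\<in>\<K>. K \<subseteq> rcosets\<^bsub>ASL2R\<^esub> Gamma_lat \<and> openin ?T {g \<in> carrier ASL2R. ?P g \<in> K}"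
    have "{g \<in> carrier ASL2R. ?P g \<in> \<Union>\<K>} = (\<Union>K\<in>\<K>. {g \<in> carrier ASL2R. ?P g \<in> K})" by blast
    with K show "openin ?T {g \<in> carrier ASL2R. ?P g \<in> \<Union>\<K>}" by auto
    show "\<Union>\<K> \<subseteq> rcosets\<^bsub>ASL2R\<^esub> Gamma_lat" using K by blast
  qed
  then show ?thesis unfolding quot_top_def by simp
qed

definition F_theta :: "complex set" where
  "F_theta = {z. Im z > 0 \<and> cmod z > 1 \<and> cmod (z - 2) > 1 \<and> 0 \<le> Re z \<and> Re z < 2}"

definition iwasawa :: "real \<times> real \<times> real \<Rightarrow> real^2^2" where
  "iwasawa = (\<lambda>(x, y, \<phi>). mat2 1 x 0 1 ** mat2 (sqrt y) 0 0 (1 / sqrt y)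
                 ** mat2 (cos \<phi>) (- sin \<phi>) (sin \<phi>) (cos \<phi>))"

text \<open>The representative in \<open>[-1/2, 1/2)\<^sup>2\<close> of a vector modulo integer vectors.\<close>

definition torus_rep :: "real^2 \<Rightarrow> real^2" where
  "torus_rep \<xi> = (\<chi> i. \<xi> $ i - of_int \<lfloor>\<xi> $ i + 1/2\<rfloor>)"

definition torus_act :: "aff \<Rightarrow> real^2 \<Rightarrow> real^2" where
  "torus_act = (\<lambda>(M, v) \<xi>. torus_rep (v + M *v \<xi>))"

definition torus_orbit :: "real \<Rightarrow> real \<Rightarrow> (real^2) set" where
  "torus_orbit \<alpha> \<beta> =
     orbit (ASL2R\<lparr>carrier := Gamma_lat\<rparr>) torus_act (torus_rep (vector [\<alpha>, \<beta>]))"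

text \<open>
  On the coordinates \<open>(x, y, \<phi>; p)\<close> of the fundamental domain, the measure is
  \<open>dx dy d\<phi> / (\<pi>\<^sup>2 |S| y\<^sup>2)\<close> times the sum of the point masses at the elements \<open>p\<close> of the orbit
  \<open>S\<close>. The latter is the counting measure on \<open>S\<close>. The product is then
  transported to the Borel sets of the coset space by \<open>(x, y, \<phi>; p) \<mapsto> \<Gamma>(M; p)\<close>.
\<close>

definition mu_quot :: "real \<Rightarrow> real \<Rightarrow> aff set measure" where
  "mu_quot \<alpha> \<beta> =
     distr
       (density
          (restrict_space lborel {(x, y, \<phi>). Complex x y \<in> F_theta \<and> \<phi> \<in> {0..<pi}})
          (\<lambda>(x, y, \<phi>). ennreal (1 / (pi\<^sup>2 * real (card (torus_orbit \<alpha> \<beta>)) * y\<^sup>2)))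
        \<Otimes>\<^sub>M count_space (torus_orbit \<alpha> \<beta>))
       (sigma (topspace quot_top) {U. openin quot_top U})
       (\<lambda>(c, p). Gamma_lat #>\<^bsub>ASL2R\<^esub> (iwasawa c, p))"

end

theory Submission
  imports Defs
begin

text \<open>
  Let \<open>\<Lambda>\<close> be the stabiliser of \<open>(\<alpha>, \<beta>)\<close> modulo \<open>\<int>\<^sup>2\<close> in \<open>\<Gamma>\<^sub>\<theta>\<close>. The curve \<open>u \<mapsto> \<Gamma>(I; (\<alpha>, \<beta>)) \<Psi>\<^sup>u \<Phi>\<^sup>t\<close> lies in
  a closed copy of \<open>\<Lambda>\SL(2, \<real>)\<close>, so the claim is the equidistribution of long horocycles there.

  For a right-uniformly continuous \<open>f\<close> of mean zero, the integral over a short piece of horocycle,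
  pushed by the geodesic flow, changes little when the piece is thickened to a box that injects into
  the quotient, and when \<open>f\<close> is replaced by a convex combination \<open>A\<close> of its horocycle translates (for
  large \<open>t\<close>). The thickened integral is at most a constant times the \<open>L\<^sup>1\<close> norm of \<open>A\<close>. By a near-minimal
  choice of the \<open>L\<^sup>2\<close> norm, \<open>A\<close> is almost invariant under the horocycle flow; by the Mautner phenomenon
  it is then almost invariant under all of \<open>SL(2, \<real>)\<close>, hence almost constant, hence small.

  Intervals suffice to treat absolutely continuous measures, and a bounded continuous function is an
  increasing limit of right-uniformly continuous ones, so neither tightness nor mixing is needed.
\<close>

section \<open>Matrices in \<open>SL(2, \<real>)\<close>\<close>

text \<open>Rationality makes the torus orbit of (\<alpha>, \<beta>) finite, so \<Lambda> has finite
  index in the theta group and its quotient has finite volume, \<open>card orb * pi^2 / 2\<close>.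
  The quotient has cusps, and almost invariance controls a function only in L1 norm, which says
  nothing along a curve. This forces the thickening in the two directions transverse to the
  horocycle, which behave differently. The lower unipotent direction is contracted by the flow, so
  its thickness can be a fixed number. The diagonal direction is neutral, so its thickness has to
  come from the modulus of continuity of \<open>f\<close>; it must be fixed before \<open>A\<close>,
  since \<open>A\<close> is chosen in terms of it. Along the horocycle the flow expands: a translate
  by a fixed amount after the flow is an exponentially small shift of the initial piece, which is
  why passing to \<open>A\<close> is free in the limit. Injectivity of the box uses only that the
  matrices in \<Lambda> are integral. Finally, the summand of the limit measure at a point p of the
  orbit is the integral over a translate of the theta domain, by the inverse of an element carrying
  (\<alpha>, \<beta>) to p.\<close>

lemma vec2_eq_iff: "(x :: 'a^2) = y \<longleftrightarrow> x $ 1 = y $ 1 \<and> x $ 2 = y $ 2"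
  by (simp add: vec_eq_iff forall_2)

lemma mat2_nth [simp]:
  "mat2 a b c d $ 1 $ 1 = a" "mat2 a b c d $ 1 $ 2 = b"
  "mat2 a b c d $ 2 $ 1 = c" "mat2 a b c d $ 2 $ 2 = d"
  by (simp_all add: mat2_def vector_2)

lemma mat2_eta: "mat2 (M $ 1 $ 1) (M $ 1 $ 2) (M $ 2 $ 1) (M $ 2 $ 2) = M"
  by (simp add: vec2_eq_iff)

lemma mat2_cases: obtains a b c d where "M = mat2 a b c d"
  by (metis mat2_eta)

lemma mat2_eq_iff [simp]:
  "mat2 a b c d = mat2 a' b' c' d' \<longleftrightarrow> a = a' \<and> b = b' \<and> c = c' \<and> d = d'"
  by (auto simp: vec2_eq_iff)

lemma mat2_mult [simp]:
  "mat2 a b c d ** mat2 a' b' c' d' =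
     mat2 (a * a' + b * c') (a * b' + b * d') (c * a' + d * c') (c * b' + d * d')"
  by (simp add: vec2_eq_iff matrix_matrix_mult_def sum_2)

lemma det_mat2 [simp]: "det (mat2 a b c d) = a * d - b * c"
  by (simp add: det_2)

lemma mat_1_eq_mat2: "(mat 1 :: real^2^2) = mat2 1 0 0 1"
  by (simp add: vec2_eq_iff mat_def)

lemma matrix_mult_eq_mat2:
  fixes A B :: "real^2^2"
  shows "A ** B = mat2 (A$1$1 * B$1$1 + A$1$2 * B$2$1) (A$1$1 * B$1$2 + A$1$2 * B$2$2)
     (A$2$1 * B$1$1 + A$2$2 * B$2$1) (A$2$1 * B$1$2 + A$2$2 * B$2$2)"
  by (simp add: vec2_eq_iff matrix_matrix_mult_def sum_2)

definition adj2 :: "real^2^2 \<Rightarrow> real^2^2" where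
  "adj2 M = mat2 (M$2$2) (- M$1$2) (- M$2$1) (M$1$1)"

lemma adj2_mat2 [simp]: "adj2 (mat2 a b c d) = mat2 d (- b) (- c) a"
  by (simp add: adj2_def)

lemma det_adj2 [simp]: "det (adj2 M) = det M"
  by (cases M rule: mat2_cases) simp

lemma adj2_mult:
  assumes "det M = 1"
  shows "adj2 M ** M = mat 1" "M ** adj2 M = mat 1"
  using assms by (cases M rule: mat2_cases; simp add: mat_1_eq_mat2 algebra_simps)+

lemma adj2_cancel [simp]:
  assumes "det M = 1"
  shows "adj2 M ** (M ** A) = A" "M ** (adj2 M ** A) = A"
    "A ** M ** adj2 M = A" "A ** adj2 M ** M = A"
  using adj2_mult[OF assms]
  by (simp_all add: matrix_mul_assoc) (simp_all add: matrix_mul_assoc[symmetric])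

lemma det_mult_1: "det (A :: real^2^2) = 1 \<Longrightarrow> det B = 1 \<Longrightarrow> det (A ** B) = 1"
  by (simp add: det_mul)

lemma mat2_eq_scaleR: "mat2 a b c d =
    a *\<^sub>R mat2 1 0 0 0 + b *\<^sub>R mat2 0 1 0 0 + c *\<^sub>R mat2 0 0 1 0 + d *\<^sub>R mat2 0 0 0 1"
  by (simp add: vec2_eq_iff)

lemma measurable_mat2 [measurable (raw)]:
  assumes [measurable]: "f \<in> borel_measurable M" "g \<in> borel_measurable M"
    "h \<in> borel_measurable M" "k \<in> borel_measurable M"
  shows "(\<lambda>x. mat2 (f x) (g x) (h x) (k x)) \<in> borel_measurable M"
  by (subst mat2_eq_scaleR) measurable

lemma continuous_on_mat2 [continuous_intros]:
  assumes "continuous_on S f" "continuous_on S g" "continuous_on S h" "continuous_on S k"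
  shows "continuous_on S (\<lambda>x. mat2 (f x) (g x) (h x) (k x))"
  by (subst mat2_eq_scaleR) (intro continuous_intros assms)

lemma tendsto_mat2 [tendsto_intros]:
  assumes "(f \<longlongrightarrow> a) F" "(g \<longlongrightarrow> b) F" "(h \<longlongrightarrow> c) F" "(k \<longlongrightarrow> d) F"
  shows "((\<lambda>x. mat2 (f x) (g x) (h x) (k x)) \<longlongrightarrow> mat2 a b c d) F"
  by (subst (1 2) mat2_eq_scaleR) (intro tendsto_intros assms)

lemma measurable_mat_nth [measurable (raw)]:
  "f \<in> borel_measurable M \<Longrightarrow> (\<lambda>x. (f x :: real^2^2) $ i $ j) \<in> borel_measurable M"
  by (rule measurable_compose[of f M borel "\<lambda>x. x $ i $ j"])
     (auto intro!: borel_measurable_continuous_onI continuous_intros)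

lemma measurable_matrix_mult [measurable (raw)]:
  fixes f g :: "'a \<Rightarrow> real^2^2"
  assumes [measurable]: "f \<in> borel_measurable M" "g \<in> borel_measurable M"
  shows "(\<lambda>x. f x ** g x) \<in> borel_measurable M"
  by (subst matrix_mult_eq_mat2) measurable

lemma continuous_on_matrix_mult [continuous_intros]:
  fixes f g :: "'a::topological_space \<Rightarrow> real^2^2"
  assumes "continuous_on S f" "continuous_on S g"
  shows "continuous_on S (\<lambda>x. f x ** g x)"
  by (subst matrix_mult_eq_mat2) (intro continuous_intros assms)

lemma tendsto_matrix_mult [tendsto_intros]:
  fixes f g :: "'a \<Rightarrow> real^2^2"
  assumes "(f \<longlongrightarrow> a) F" "(g \<longlongrightarrow> b) F"
  shows "((\<lambda>x. f x ** g x) \<longlongrightarrow> a ** b) F"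
  by (subst (1 2) matrix_mult_eq_mat2) (intro tendsto_intros assms)

lemma measurable_adj2 [measurable (raw)]:
  assumes [measurable]: "f \<in> borel_measurable M"
  shows "(\<lambda>x. adj2 (f x)) \<in> borel_measurable M"
  unfolding adj2_def by measurable

lemma measurable_det2 [measurable (raw)]:
  assumes [measurable]: "f \<in> borel_measurable M"
  shows "(\<lambda>x. det (f x :: real^2^2)) \<in> borel_measurable M"
  unfolding det_2 by measurable

lemma closed_SL2: "closed {M :: real^2^2. det M = 1}"
  unfolding det_2 by (intro closed_Collect_eq continuous_intros)

lemma SL2_in_borel [measurable]: "{M :: real^2^2. det M = 1} \<in> sets borel"
  by (intro borel_closed closed_SL2)

abbreviation upr :: "real \<Rightarrow> real^2^2" where "upr x \<equiv> mat2 1 x 0 1"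
abbreviation lwr :: "real \<Rightarrow> real^2^2" where "lwr x \<equiv> mat2 1 0 x 1"
abbreviation dgl :: "real \<Rightarrow> real^2^2" where "dgl r \<equiv> mat2 r 0 0 (1 / r)"

text \<open>The big Bruhat cell. It serves twice: for the invariance of Haar measure, through the
  induction rule below, and for the Mautner argument in \<open>displacement_le\<close>.\<close>

lemma SL2_eq_upr_lwr_upr:
  assumes "a * d - b * c = 1" "c \<noteq> 0"
  shows "mat2 a b c d = upr ((a - 1) / c) ** lwr c ** upr ((d - 1) / c)"
  using assms by (simp add: field_simps)

lemma SL2_unipotent_induct [consumes 1, case_names mult upr lwr]:
  assumes "det M = 1"
    and mult: "\<And>A B. det A = 1 \<Longrightarrow> det B = 1 \<Longrightarrow> P A \<Longrightarrow> P B \<Longrightarrow> P (A ** B)"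
    and upr: "\<And>x. P (upr x)" and lwr: "\<And>x. P (lwr x)"
  shows "P M"
proof -
  have *: "P (mat2 a b c d)" if "a * d - b * c = 1" "c \<noteq> 0" for a b c d
    using SL2_eq_upr_lwr_upr[OF that]
    by (metis det_mat2 det_mult_1 mult upr lwr diff_zero mult_1 mult_zero_left mult_zero_right)
  obtain a b c d where M: "M = mat2 a b c d" by (rule mat2_cases)
  have det: "a * d - b * c = 1" using assms(1) M by simp
  show ?thesis
  proof (cases "c = 0")
    case False then show ?thesis using * det M by blast
  next
    case True
    then have "d \<noteq> 0" using det by auto
    \<comment> \<open>Right multiplication by \<open>lwr 1\<close> moves \<open>M\<close> into the
      big cell: the new lower left entry is \<open>d\<close>, which is nonzero.\<close>
    have "P (mat2 (a + b) b (c + d) d)"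
      using det \<open>d \<noteq> 0\<close> True by (intro *) (auto simp: algebra_simps)
    moreover have "M = mat2 (a + b) b (c + d) d ** lwr (-1)" using M by simp
    moreover have "det (mat2 (a + b) b (c + d) d) = 1" using det by (simp add: algebra_simps)
    ultimately show ?thesis
      using mult[of "mat2 (a + b) b (c + d) d" "lwr (-1)", OF _ _ _ lwr] by (metis det_mat2 diff_zero mult_1 mult_zero_left)
  qed
qed

section \<open>Haar measure\<close>

text \<open>The coordinates \<open>(c, d, u)\<close> describe the matrix with bottom row \<open>(c, d)\<close> and \<open>b = u d\<close>;
  for \<open>d = 0\<close>, a null set, the value is junk.\<close>

definition chart :: "real \<times> real \<times> real \<Rightarrow> real^2^2" where
  "chart = (\<lambda>(c, d, u). mat2 (1 / d + u * c) (u * d) c d)"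

text \<open>Lebesgue measure is the right choice because the bottom row identifies the quotient by
  the upper unipotent group on the left with the punctured plane, on which the group acts linearly
  with determinant 1; \<open>u\<close> is the coordinate along the unipotent group.\<close>

definition haar :: "(real^2^2) measure" where
  "haar = distr lborel borel chart"

lemma measurable_chart [measurable]: "chart \<in> borel_measurable borel"
  unfolding chart_def by (simp add: borel_prod[symmetric] case_prod_beta')

lemma sets_haar [simp, measurable_cong]: "sets haar = sets borel"
  and space_haar [simp]: "space haar = UNIV"
  by (simp_all add: haar_def)

lemma nn_integral_lborel3:
  assumes [measurable]: "f \<in> borel_measurable (borel :: (real \<times> real \<times> real) measure)"
  shows "(\<integral>\<^sup>+z. f z \<partial>lborel) = (\<integral>\<^sup>+c. \<integral>\<^sup>+d. \<integral>\<^sup>+u. f (c, d, u) \<partial>lborel \<partial>lborel \<partial>lborel)"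
proof -
  have [measurable]: "f \<in> borel_measurable (borel \<Otimes>\<^sub>M (borel \<Otimes>\<^sub>M borel))"
    using assms by (simp add: borel_prod)
  have "(\<integral>\<^sup>+z. f z \<partial>lborel) = (\<integral>\<^sup>+z. f z \<partial>(lborel \<Otimes>\<^sub>M (lborel :: (real \<times> real) measure)))"
    by (simp add: lborel_prod)
  also have "\<dots> = (\<integral>\<^sup>+c. \<integral>\<^sup>+z. f (c, z) \<partial>lborel \<partial>lborel)"
    by (rule lborel.nn_integral_fst[symmetric]) (simp add: lborel_prod)
  also have "\<dots> = (\<integral>\<^sup>+c. \<integral>\<^sup>+z. f (c, z) \<partial>(lborel \<Otimes>\<^sub>M lborel) \<partial>lborel)"
    by (simp add: lborel_prod)
  also have "\<dots> = (\<integral>\<^sup>+c. \<integral>\<^sup>+d. \<integral>\<^sup>+u. f (c, d, u) \<partial>lborel \<partial>lborel \<partial>lborel)"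
    by (intro nn_integral_cong lborel.nn_integral_fst[symmetric]) measurable
  finally show ?thesis .
qed

lemma nn_integral_haar:
  assumes [measurable]: "f \<in> borel_measurable borel"
  shows "(\<integral>\<^sup>+M. f M \<partial>haar) = (\<integral>\<^sup>+c. \<integral>\<^sup>+d. \<integral>\<^sup>+u. f (chart (c, d, u)) \<partial>lborel \<partial>lborel \<partial>lborel)"
  unfolding haar_def by (subst nn_integral_distr) (auto intro!: nn_integral_lborel3)


section \<open>One-dimensional substitution rules on unbounded intervals\<close>

lemma nn_integral_lborel_shift:
  assumes [measurable]: "f \<in> borel_measurable borel"
  shows "(\<integral>\<^sup>+x. f (x + t) \<partial>lborel) = (\<integral>\<^sup>+x. f (x :: real) \<partial>lborel)"
  using nn_integral_real_affine[of f 1 t] by (simp add: add.commute)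

text \<open>Monotone convergence along compact intervals extends the substitution rule to increasing
  maps that blow up at the ends of \<open>S\<close>.\<close>

lemma nn_integral_substitution_exhaust:
  fixes f :: "real \<Rightarrow> ennreal" and A B :: "nat \<Rightarrow> real"
  assumes [measurable]: "f \<in> borel_measurable borel" "g \<in> borel_measurable borel" "g' \<in> borel_measurable borel"
    and deriv: "\<And>x. x \<in> S \<Longrightarrow> (g has_real_derivative g' x) (at x)"
    and cont: "continuous_on S g'" and nonneg: "\<And>x. x \<in> S \<Longrightarrow> g' x \<ge> 0"
    and AB: "\<And>n. A n < B n" "decseq A" "incseq B"
    and S: "S = (\<Union>n. {A n..B n})" and T: "T = (\<Union>n. {g (A n)..g (B n)})"
  shows "(\<integral>\<^sup>+x. f x * indicator T x \<partial>lborel) = (\<integral>\<^sup>+x. f (g x) * g' x * indicator S x \<partial>lborel)"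
proof -
  have sub: "{A n..B n} \<subseteq> S" for n using S by auto
  have mono: "g x \<le> g y" if "x \<le> y" "{x..y} \<subseteq> S" for x y
  proof (rule DERIV_nonneg_imp_nondecreasing[OF that(1)])
    fix z assume "x \<le> z" "z \<le> y"
    then have "z \<in> S" using that by auto
    then show "\<exists>w. DERIV g z :> w \<and> w \<ge> 0" using deriv nonneg by blast
  qed
  have AB': "A (Suc n) \<le> A n" "B n \<le> B (Suc n)" "A n < B n" for n
    using AB by (auto simp: decseq_Suc_iff incseq_Suc_iff)
  have I: "incseq (\<lambda>n. {A n..B n})" by (rule incseq_SucI) (use AB' in auto)
  have J: "incseq (\<lambda>n. {g (A n)..g (B n)})"
  proof (rule incseq_SucI)
    fix n
    have "{A (Suc n)..A n} \<subseteq> S" "{B n..B (Suc n)} \<subseteq> S"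
      using sub[of "Suc n"] AB'[of n] by auto
    then have "g (A (Suc n)) \<le> g (A n)" "g (B n) \<le> g (B (Suc n))"
      using mono AB' by auto
    then show "{g (A n)..g (B n)} \<subseteq> {g (A (Suc n))..g (B (Suc n))}" by auto
  qed
  have ind: "(indicator (\<Union>n. X n) x :: ennreal) = (SUP n. indicator (X n) x)" for X :: "nat \<Rightarrow> real set" and x
    by (rule antisym) (auto simp: indicator_def intro!: SUP_upper2 SUP_least)
  have inc: "incseq (\<lambda>n x. h x * indicator (X n) x)" if "incseq X"
    for X :: "nat \<Rightarrow> real set" and h :: "real \<Rightarrow> ennreal"
    using that by (auto simp: incseq_def le_fun_def indicator_def)
  have "(\<integral>\<^sup>+x. f x * indicator T x \<partial>lborel) = (\<integral>\<^sup>+x. (SUP n. f x * indicator {g (A n)..g (B n)} x) \<partial>lborel)"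
    unfolding T ind by (simp add: SUP_mult_left_ennreal)
  also have "\<dots> = (SUP n. \<integral>\<^sup>+x. f x * indicator {g (A n)..g (B n)} x \<partial>lborel)"
    by (intro nn_integral_monotone_convergence_SUP inc J) measurable
  also have "\<dots> = (SUP n. \<integral>\<^sup>+x. f (g x) * g' x * indicator {A n..B n} x \<partial>lborel)"
  proof (intro SUP_cong refl nn_integral_substitution_aux)
    show "continuous_on {A n..B n} g'" for n using cont sub by (rule continuous_on_subset)
  qed (use deriv nonneg AB S in auto)
  also have "\<dots> = (\<integral>\<^sup>+x. (SUP n. f (g x) * g' x * indicator {A n..B n} x) \<partial>lborel)"
    by (intro nn_integral_monotone_convergence_SUP[symmetric] inc I) measurable
  also have "\<dots> = (\<integral>\<^sup>+x. f (g x) * g' x * indicator S x \<partial>lborel)"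
    unfolding S ind by (simp add: SUP_mult_left_ennreal)
  finally show ?thesis .
qed

text \<open>The offset 2 keeps even the first interval nondegenerate, as the substitution rule
  demands \<open>A n < B n\<close>; with offset 1 it would be a point.\<close>

lemma Un_Icc_inverse_Suc: "(\<Union>n. {1 / real (n + 2)..real (n + 2)}) = {0<..}"
proof (intro equalityI subsetI)
  fix x :: real assume "x \<in> {0<..}"
  then have "x > 0" by simp
  obtain n where n: "x \<le> real n" "1 / x \<le> real n"
    using real_arch_simple[of "max x (1 / x)"] by auto
  then have "1 \<le> real n * x" using \<open>x > 0\<close> by (simp add: divide_le_eq)
  then have "1 \<le> x * real (n + 2)" using \<open>x > 0\<close> by (simp add: algebra_simps)
  then have "1 / real (n + 2) \<le> x" by (simp add: divide_le_eq)
  then show "x \<in> (\<Union>n. {1 / real (n + 2)..real (n + 2)})" using n(1) by (auto intro!: exI[of _ n])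
qed (auto intro: less_le_trans[rotated])

lemma nn_integral_minus_inverse_pos:
  fixes f :: "real \<Rightarrow> ennreal"
  assumes [measurable]: "f \<in> borel_measurable borel"
  shows "(\<integral>\<^sup>+x. f (- 1 / x) * ennreal (1 / x\<^sup>2) * indicator {0<..} x \<partial>lborel) =
    (\<integral>\<^sup>+x. f x * indicator {..<0} x \<partial>lborel)"
proof (rule nn_integral_substitution_exhaust[where A = "\<lambda>n. 1 / real (n + 2)" and B = "\<lambda>n. real (n + 2)", symmetric])
  show "((\<lambda>x. - 1 / x) has_real_derivative 1 / x\<^sup>2) (at x)" if "x \<in> {0<..}" for x
    using that by (auto intro!: derivative_eq_intros simp: power2_eq_square)
  show "continuous_on {0<..} (\<lambda>x::real. 1 / x\<^sup>2)" by (intro continuous_intros) auto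
  show "1 / real (n + 2) < real (n + 2)" for n
    using mult_strict_mono[of 1 "real (n + 2)" 1 "real (n + 2)"] by (simp add: divide_less_eq)
  show "decseq (\<lambda>n. 1 / real (n + 2))" by (auto simp: decseq_def frac_le)
  show "incseq (\<lambda>n. real (n + 2))" by (auto simp: incseq_def)
  show "{0<..} = (\<Union>n. {1 / real (n + 2)..real (n + 2)})" using Un_Icc_inverse_Suc by simp
  have "uminus ` {0<..} = (\<Union>n. uminus ` {1 / real (n + 2)..real (n + 2)})"
    unfolding Un_Icc_inverse_Suc[symmetric] by blast
  then show "{..<0} = (\<Union>n. {- 1 / (1 / real (n + 2))..- 1 / real (n + 2)})" by simp
qed auto

text \<open>This is the action of \<open>Smat\<close> on the coordinate \<open>u = b / d\<close>.
  The map is increasing on each half-line and exchanges the two, so they are treated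
  separately.\<close>

lemma nn_integral_minus_inverse:
  fixes f :: "real \<Rightarrow> ennreal"
  assumes [measurable]: "f \<in> borel_measurable borel"
  shows "(\<integral>\<^sup>+x. f (- 1 / x) * ennreal (1 / x\<^sup>2) \<partial>lborel) = (\<integral>\<^sup>+x. f x \<partial>lborel)"
proof -
  have AE: "AE x in lborel. x \<noteq> (0::real)" by (rule AE_lborel_singleton)
  have split: "(\<integral>\<^sup>+x. h x \<partial>lborel) =
      (\<integral>\<^sup>+x. h x * indicator {0<..} x \<partial>lborel) + (\<integral>\<^sup>+x. h x * indicator {..<0} x \<partial>lborel)"
    if [measurable]: "h \<in> borel_measurable borel" for h :: "real \<Rightarrow> ennreal"
    by (subst nn_integral_add[symmetric], measurable)
       (intro nn_integral_cong_AE eventually_mono[OF AE], auto simp: indicator_def)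
  have neg: "(\<integral>\<^sup>+x. h x * indicator {..<0} x \<partial>lborel) = (\<integral>\<^sup>+x. h (- x) * indicator {0<..} x \<partial>lborel)"
    if [measurable]: "h \<in> borel_measurable borel" for h :: "real \<Rightarrow> ennreal"
    by (subst nn_integral_real_affine[where c = "-1" and t = 0])
       (auto simp: indicator_def intro!: nn_integral_cong)
  have "(\<integral>\<^sup>+x. f (- 1 / x) * ennreal (1 / x\<^sup>2) \<partial>lborel) =
     (\<integral>\<^sup>+x. f x * indicator {..<0} x \<partial>lborel) +
     (\<integral>\<^sup>+x. f (- (- 1 / x)) * ennreal (1 / x\<^sup>2) * indicator {0<..} x \<partial>lborel)"
    using nn_integral_minus_inverse_pos[OF assms]
    by (subst split, measurable, subst neg, simp_all)
  also have "\<dots> = (\<integral>\<^sup>+x. f x * indicator {..<0} x \<partial>lborel) + (\<integral>\<^sup>+x. f (- x) * indicator {..<0} x \<partial>lborel)"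
    using nn_integral_minus_inverse_pos[of "\<lambda>x. f (- x)"] by simp
  also have "(\<integral>\<^sup>+x. f (- x) * indicator {..<0} x \<partial>lborel) = (\<integral>\<^sup>+x. f x * indicator {0<..} x \<partial>lborel)"
    by (subst neg) auto
  also have "(\<integral>\<^sup>+x. f x * indicator {..<0} x \<partial>lborel) + \<dots> = (\<integral>\<^sup>+x. f x \<partial>lborel)"
    by (subst (3) split) (auto simp: add.commute)
  finally show ?thesis .
qed

section \<open>Invariance of Haar measure under left and right translations\<close>

lemma measurable_chart_comp [measurable (raw)]:
  assumes [measurable]: "f \<in> borel_measurable M" "g \<in> borel_measurable M" "h \<in> borel_measurable M"
  shows "(\<lambda>x. chart (f x, g x, h x)) \<in> borel_measurable M"
  unfolding chart_def by simp

lemma nn_integral_haar_swap: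
  assumes [measurable]: "f \<in> borel_measurable borel"
  shows "(\<integral>\<^sup>+M. f M \<partial>haar) = (\<integral>\<^sup>+d. \<integral>\<^sup>+c. \<integral>\<^sup>+u. f (chart (c, d, u)) \<partial>lborel \<partial>lborel \<partial>lborel)"
    and "(\<integral>\<^sup>+M. f M \<partial>haar) = (\<integral>\<^sup>+u. \<integral>\<^sup>+d. \<integral>\<^sup>+c. f (chart (c, d, u)) \<partial>lborel \<partial>lborel \<partial>lborel)"
proof -
  show 1: "(\<integral>\<^sup>+M. f M \<partial>haar) = (\<integral>\<^sup>+d. \<integral>\<^sup>+c. \<integral>\<^sup>+u. f (chart (c, d, u)) \<partial>lborel \<partial>lborel \<partial>lborel)"
    by (simp add: nn_integral_haar) (rule lborel_pair.Fubini', measurable)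
  also have "\<dots> = (\<integral>\<^sup>+d. \<integral>\<^sup>+u. \<integral>\<^sup>+c. f (chart (c, d, u)) \<partial>lborel \<partial>lborel \<partial>lborel)"
    by (intro nn_integral_cong lborel_pair.Fubini') measurable
  also have "\<dots> = (\<integral>\<^sup>+u. \<integral>\<^sup>+d. \<integral>\<^sup>+c. f (chart (c, d, u)) \<partial>lborel \<partial>lborel \<partial>lborel)"
    by (rule lborel_pair.Fubini') measurable
  finally show "(\<integral>\<^sup>+M. f M \<partial>haar) = (\<integral>\<^sup>+u. \<integral>\<^sup>+d. \<integral>\<^sup>+c. f (chart (c, d, u)) \<partial>lborel \<partial>lborel \<partial>lborel)" .
qed

lemma haar_left_upr:
  assumes [measurable]: "f \<in> borel_measurable borel"
  shows "(\<integral>\<^sup>+M. f (upr x ** M) \<partial>haar) = (\<integral>\<^sup>+M. f M \<partial>haar)"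
proof -
  have "upr x ** chart (c, d, u) = chart (c, d, u + x)" for c d u
    by (simp add: chart_def algebra_simps)
  then show ?thesis
    by (simp add: nn_integral_haar nn_integral_lborel_shift[where f = "\<lambda>u. f (chart (_, _, u))"])
qed

abbreviation Smat :: "real^2^2" where "Smat \<equiv> mat2 0 (-1) 1 0"

text \<open>The new \<open>u\<close> is \<open>- 1 / u\<close>, with density \<open>1 / u^2\<close>,
  and the new bottom row is the old top row \<open>(1 / d + u * c, u * d)\<close>. The latter
  amounts to two affine substitutions, each contributing the absolute value of \<open>u\<close>, so
  the three factors cancel.\<close>

lemma haar_left_S:
  assumes [measurable]: "f \<in> borel_measurable borel"
  shows "(\<integral>\<^sup>+M. f (Smat ** M) \<partial>haar) = (\<integral>\<^sup>+M. f M \<partial>haar)"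
proof -
  define P where "P = (\<lambda>u. \<integral>\<^sup>+d. \<integral>\<^sup>+c. f (chart (c, d, u)) \<partial>lborel \<partial>lborel)"
  have [measurable]: "P \<in> borel_measurable borel" unfolding P_def by measurable
  have eq: "P (- 1 / u) * ennreal (1 / u\<^sup>2) = (\<integral>\<^sup>+d. \<integral>\<^sup>+c. f (Smat ** chart (c, d, u)) \<partial>lborel \<partial>lborel)"
    if "u \<noteq> 0" for u
  proof -
    have "P (- 1 / u) = \<bar>u\<bar> * (\<integral>\<^sup>+d. \<integral>\<^sup>+c. f (chart (c, u * d, - 1 / u)) \<partial>lborel \<partial>lborel)"
      unfolding P_def using that by (subst nn_integral_real_affine[where c = u and t = 0]) auto
    also have "(\<integral>\<^sup>+d. \<integral>\<^sup>+c. f (chart (c, u * d, - 1 / u)) \<partial>lborel \<partial>lborel) =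
       (\<integral>\<^sup>+d. \<bar>u\<bar> * (\<integral>\<^sup>+c. f (chart (1 / d + u * c, u * d, - 1 / u)) \<partial>lborel) \<partial>lborel)"
      using that by (intro nn_integral_cong nn_integral_real_affine) auto
    also have "\<dots> = (\<integral>\<^sup>+d. \<bar>u\<bar> * (\<integral>\<^sup>+c. f (Smat ** chart (c, d, u)) \<partial>lborel) \<partial>lborel)"
    proof (rule nn_integral_cong_AE, rule eventually_mono[OF AE_lborel_singleton[of 0]])
      fix d :: real assume "d \<noteq> 0"
      then have "chart (1 / d + u * c, u * d, - 1 / u) = Smat ** chart (c, d, u)" for c
        using that by (simp add: chart_def field_simps)
      then show "ennreal \<bar>u\<bar> * (\<integral>\<^sup>+c. f (chart (1 / d + u * c, u * d, - 1 / u)) \<partial>lborel) =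
          ennreal \<bar>u\<bar> * (\<integral>\<^sup>+c. f (Smat ** chart (c, d, u)) \<partial>lborel)" by simp
    qed
    also have "\<dots> = \<bar>u\<bar> * (\<integral>\<^sup>+d. \<integral>\<^sup>+c. f (Smat ** chart (c, d, u)) \<partial>lborel \<partial>lborel)"
      by (rule nn_integral_cmult) measurable
    finally have "P (- 1 / u) * ennreal (1 / u\<^sup>2) = (ennreal \<bar>u\<bar> * (ennreal \<bar>u\<bar> * ennreal (1 / u\<^sup>2))) *
        (\<integral>\<^sup>+d. \<integral>\<^sup>+c. f (Smat ** chart (c, d, u)) \<partial>lborel \<partial>lborel)"
      by (simp add: mult_ac)
    also have "ennreal \<bar>u\<bar> * (ennreal \<bar>u\<bar> * ennreal (1 / u\<^sup>2)) = 1"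
      using that by (simp flip: ennreal_mult add: power2_eq_square abs_mult[symmetric] mult.assoc[symmetric])
    finally show ?thesis by simp
  qed
  have "(\<integral>\<^sup>+M. f M \<partial>haar) = (\<integral>\<^sup>+u. P u \<partial>lborel)"
    by (simp add: nn_integral_haar_swap(2) P_def)
  also have "\<dots> = (\<integral>\<^sup>+u. P (- 1 / u) * ennreal (1 / u\<^sup>2) \<partial>lborel)"
    by (rule nn_integral_minus_inverse[symmetric]) measurable
  also have "\<dots> = (\<integral>\<^sup>+u. \<integral>\<^sup>+d. \<integral>\<^sup>+c. f (Smat ** chart (c, d, u)) \<partial>lborel \<partial>lborel \<partial>lborel)"
    by (intro nn_integral_cong_AE eventually_mono[OF AE_lborel_singleton[of 0]] eq)
  also have "\<dots> = (\<integral>\<^sup>+M. f (Smat ** M) \<partial>haar)"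
    by (subst nn_integral_haar_swap(2)) auto
  finally show ?thesis by simp
qed

lemma haar_left:
  assumes "det g = 1" and "f \<in> borel_measurable borel"
  shows "(\<integral>\<^sup>+M. f (g ** M) \<partial>haar) = (\<integral>\<^sup>+M. f M \<partial>haar)"
  using assms
proof (induction g arbitrary: f rule: SL2_unipotent_induct)
  case (mult A B)
  note [measurable] = mult.prems
  have "(\<integral>\<^sup>+M. f (A ** B ** M) \<partial>haar) = (\<integral>\<^sup>+M. f (A ** (B ** M)) \<partial>haar)"
    by (simp add: matrix_mul_assoc)
  also have "\<dots> = (\<integral>\<^sup>+M. f (A ** M) \<partial>haar)"
    by (rule mult.IH(2)) measurable
  finally show ?case using mult by simp
next
  case (upr x) then show ?case by (rule haar_left_upr)
next
  case (lwr x)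
  note [measurable] = lwr
  \<comment> \<open>\<open>lwr x\<close> is the conjugate of \<open>upr (- x)\<close> by
    \<open>Smat\<close>, and the inverse of \<open>Smat\<close> is its cube.\<close>
  have "(\<integral>\<^sup>+M. f (lwr x ** M) \<partial>haar) =
      (\<integral>\<^sup>+M. f (Smat ** (upr (- x) ** (Smat ** (Smat ** (Smat ** M))))) \<partial>haar)"
    by (simp add: matrix_mul_assoc)
  also have "\<dots> = (\<integral>\<^sup>+M. f (Smat ** (upr (- x) ** (Smat ** (Smat ** M)))) \<partial>haar)"
    by (rule haar_left_S) measurable
  also have "\<dots> = (\<integral>\<^sup>+M. f (Smat ** (upr (- x) ** (Smat ** M))) \<partial>haar)"
    by (rule haar_left_S) measurable
  also have "\<dots> = (\<integral>\<^sup>+M. f (Smat ** (upr (- x) ** M)) \<partial>haar)"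
    by (rule haar_left_S) measurable
  also have "\<dots> = (\<integral>\<^sup>+M. f (Smat ** M) \<partial>haar)"
    by (rule haar_left_upr) measurable
  also have "\<dots> = (\<integral>\<^sup>+M. f M \<partial>haar)"
    by (rule haar_left_S) measurable
  finally show ?case .
qed

text \<open>The bottom row undergoes a shear, and for a fixed row \<open>u\<close> is shifted by the
  constant \<open>x / (d * (d + c * x))\<close>. The two values of \<open>d\<close> where this makes
  no sense are null.\<close>

lemma haar_right_upr:
  assumes [measurable]: "f \<in> borel_measurable borel"
  shows "(\<integral>\<^sup>+M. f (M ** upr x) \<partial>haar) = (\<integral>\<^sup>+M. f M \<partial>haar)"
proof -
  have eq: "(\<integral>\<^sup>+u. f (chart (c, d, u) ** upr x) \<partial>lborel) = (\<integral>\<^sup>+u. f (chart (c, d + c * x, u)) \<partial>lborel)"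
    if "d \<noteq> 0" "d \<noteq> - c * x" for c d
  proof -
    have "d + c * x \<noteq> 0" using that(2) by auto
    then have "chart (c, d, u) ** upr x = chart (c, d + c * x, u + x / (d * (d + c * x)))" for u
      using that(1) by (simp add: chart_def) (simp add: divide_simps, simp add: algebra_simps)
    then show ?thesis
      by (simp add: nn_integral_lborel_shift[where f = "\<lambda>u. f (chart (_, _, u))"])
  qed
  have "(\<integral>\<^sup>+M. f (M ** upr x) \<partial>haar) = (\<integral>\<^sup>+c. \<integral>\<^sup>+d. \<integral>\<^sup>+u. f (chart (c, d + c * x, u)) \<partial>lborel \<partial>lborel \<partial>lborel)"
  proof (subst nn_integral_haar, measurable, rule nn_integral_cong, rule nn_integral_cong_AE)
    fix c
    show "AE d in lborel. (\<integral>\<^sup>+u. f (chart (c, d, u) ** upr x) \<partial>lborel) = (\<integral>\<^sup>+u. f (chart (c, d + c * x, u)) \<partial>lborel)"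
      using AE_lborel_singleton[of "0::real"] AE_lborel_singleton[of "- c * x"] by eventually_elim (rule eq)
  qed
  also have "\<dots> = (\<integral>\<^sup>+c. \<integral>\<^sup>+d. \<integral>\<^sup>+u. f (chart (c, d, u)) \<partial>lborel \<partial>lborel \<partial>lborel)"
    by (intro nn_integral_cong nn_integral_lborel_shift[where f = "\<lambda>d. \<integral>\<^sup>+u. f (chart (_, d, u)) \<partial>lborel"]) measurable
  finally show ?thesis by (simp add: nn_integral_haar)
qed

lemma haar_right_lwr:
  assumes [measurable]: "f \<in> borel_measurable borel"
  shows "(\<integral>\<^sup>+M. f (M ** lwr x) \<partial>haar) = (\<integral>\<^sup>+M. f M \<partial>haar)"
proof -
  have "chart (c, d, u) ** lwr x = chart (c + d * x, d, u)" for c d u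
    by (simp add: chart_def algebra_simps)
  then have "(\<integral>\<^sup>+M. f (M ** lwr x) \<partial>haar) = (\<integral>\<^sup>+d. \<integral>\<^sup>+c. \<integral>\<^sup>+u. f (chart (c + d * x, d, u)) \<partial>lborel \<partial>lborel \<partial>lborel)"
    by (subst nn_integral_haar_swap(1)) auto
  also have "\<dots> = (\<integral>\<^sup>+d. \<integral>\<^sup>+c. \<integral>\<^sup>+u. f (chart (c, d, u)) \<partial>lborel \<partial>lborel \<partial>lborel)"
    by (intro nn_integral_cong nn_integral_lborel_shift[where f = "\<lambda>c. \<integral>\<^sup>+u. f (chart (c, _, u)) \<partial>lborel"]) measurable
  finally show ?thesis by (simp add: nn_integral_haar_swap(1))
qed

lemma haar_right:
  assumes "det g = 1" and "f \<in> borel_measurable borel"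
  shows "(\<integral>\<^sup>+M. f (M ** g) \<partial>haar) = (\<integral>\<^sup>+M. f M \<partial>haar)"
  using assms
proof (induction g arbitrary: f rule: SL2_unipotent_induct)
  case (mult A B)
  note [measurable] = mult.prems
  have "(\<integral>\<^sup>+M. f (M ** (A ** B)) \<partial>haar) = (\<integral>\<^sup>+M. f ((M ** A) ** B) \<partial>haar)"
    by (simp add: matrix_mul_assoc)
  also have "\<dots> = (\<integral>\<^sup>+M. f (M ** B) \<partial>haar)"
    by (rule mult.IH(1)) measurable
  finally show ?case using mult by simp
qed (simp_all add: haar_right_upr haar_right_lwr)

lemma AE_haar_left:
  assumes "AE M in haar. P M" "det g = 1" shows "AE M in haar. P (g ** M)"
proof -
  obtain N where N: "N \<in> null_sets haar" "{M. \<not> P M} \<subseteq> N"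
    using assms(1) by (auto simp: eventually_ae_filter)
  then have [measurable]: "N \<in> sets borel" by auto
  have "emeasure haar {M. g ** M \<in> N} = (\<integral>\<^sup>+M. indicator {M. g ** M \<in> N} M \<partial>haar)"
    by (rule nn_integral_indicator[symmetric]) measurable
  also have "\<dots> = (\<integral>\<^sup>+M. indicator N (g ** M) \<partial>haar)"
    by (simp add: indicator_def)
  also have "\<dots> = 0" using N assms(2) by (subst haar_left) auto
  finally have "{M. g ** M \<in> N} \<in> null_sets haar" by auto
  then show ?thesis by (rule AE_I') (use N in auto)
qed

lemma AE_haar_right:
  assumes "AE M in haar. P M" "det g = 1" shows "AE M in haar. P (M ** g)"
proof -
  obtain N where N: "N \<in> null_sets haar" "{M. \<not> P M} \<subseteq> N"
    using assms(1) by (auto simp: eventually_ae_filter)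
  then have [measurable]: "N \<in> sets borel" by auto
  have "emeasure haar {M. M ** g \<in> N} = (\<integral>\<^sup>+M. indicator {M. M ** g \<in> N} M \<partial>haar)"
    by (rule nn_integral_indicator[symmetric]) measurable
  also have "\<dots> = (\<integral>\<^sup>+M. indicator N (M ** g) \<partial>haar)"
    by (simp add: indicator_def)
  also have "\<dots> = 0" using N assms(2) by (subst haar_right) auto
  finally have "{M. M ** g \<in> N} \<in> null_sets haar" by auto
  then show ?thesis by (rule AE_I') (use N in auto)
qed

text \<open>Fubini in chart coordinates: a null set is detected on the lines in direction
  \<open>u\<close>, and bottom rows with a zero entry may be discarded.\<close>

lemma AE_haar_chartI:
  assumes [measurable]: "Measurable.pred borel P"
    and "\<And>c d. d \<noteq> 0 \<Longrightarrow> c \<noteq> 0 \<Longrightarrow> AE u in lborel. P (chart (c, d, u))"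
  shows "AE M in haar. P M"
proof (rule AE_I')
  have "emeasure haar {M. \<not> P M} = (\<integral>\<^sup>+M. indicator {M. \<not> P M} M \<partial>haar)"
    by (subst nn_integral_indicator) auto
  also have "\<dots> = (\<integral>\<^sup>+c. \<integral>\<^sup>+d. \<integral>\<^sup>+u. indicator {M. \<not> P M} (chart (c, d, u)) \<partial>lborel \<partial>lborel \<partial>(lborel :: real measure))"
    by (rule nn_integral_haar) measurable
  also have "\<dots> = (\<integral>\<^sup>+c. \<integral>\<^sup>+d. 0 \<partial>(lborel :: real measure) \<partial>(lborel :: real measure))"
  proof (rule nn_integral_cong_AE, rule eventually_mono[OF AE_lborel_singleton[of 0]])
    fix c :: real assume "c \<noteq> 0"
    show "(\<integral>\<^sup>+d. \<integral>\<^sup>+u. indicator {M. \<not> P M} (chart (c, d, u)) \<partial>lborel \<partial>lborel) = (\<integral>\<^sup>+d. 0 \<partial>(lborel :: real measure))"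
    proof (rule nn_integral_cong_AE, rule eventually_mono[OF AE_lborel_singleton[of 0]])
      fix d :: real assume "d \<noteq> 0"
      have "(\<integral>\<^sup>+u. indicator {M. \<not> P M} (chart (c, d, u)) \<partial>lborel) = (\<integral>\<^sup>+u. 0 \<partial>(lborel :: real measure))"
        using assms(2)[OF \<open>d \<noteq> 0\<close> \<open>c \<noteq> 0\<close>] by (intro nn_integral_cong_AE) (auto elim!: eventually_mono)
      then show "(\<integral>\<^sup>+u. indicator {M. \<not> P M} (chart (c, d, u)) \<partial>lborel) = 0" by simp
    qed
  qed
  finally show "{M. \<not> P M} \<in> null_sets haar" by auto
qed auto

lemma det_chart: "d \<noteq> 0 \<Longrightarrow> det (chart (c, d, u)) = 1"
  by (simp add: chart_def field_simps)

lemma AE_haar_det: "AE M in haar. det M = 1"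
  by (rule AE_haar_chartI) (auto simp: det_chart)

lemma AE_haar_lower_left: "AE M in haar. M $ 2 $ 1 \<noteq> 0"
  by (rule AE_haar_chartI) (auto simp: chart_def)

interpretation haar: sigma_finite_measure haar
proof
  \<comment> \<open>Boxes in the coordinates \<open>c\<close>, \<open>d\<close> and
    \<open>u = b / d\<close>, of measure at most \<open>(2 * n)^3\<close>. They cover all matrices,
    because the quotient is some real number even for \<open>d = 0\<close>.\<close>
  define A :: "nat \<Rightarrow> (real^2^2) set" where "A n = {M. \<bar>M$2$1\<bar> \<le> real n \<and> \<bar>M$2$2\<bar> \<le> real n \<and> \<bar>M$1$2 / M$2$2\<bar> \<le> real n}" for n
  have [measurable]: "A n \<in> sets borel" for n unfolding A_def by measurable
  have fin: "emeasure haar (A n) \<noteq> \<infinity>" for n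
  proof -
    let ?J = "{- real n..real n}"
    have "emeasure haar (A n) = (\<integral>\<^sup>+c. \<integral>\<^sup>+d. \<integral>\<^sup>+u. indicator (A n) (chart (c, d, u)) \<partial>lborel \<partial>lborel \<partial>lborel)"
      by (subst nn_integral_haar[symmetric]) auto
    also have "\<dots> \<le> (\<integral>\<^sup>+c. indicator ?J c * (\<integral>\<^sup>+d. indicator ?J d * (\<integral>\<^sup>+u. indicator ?J u \<partial>lborel) \<partial>lborel) \<partial>lborel)"
    proof (rule nn_integral_mono)
      fix c
      have "(\<integral>\<^sup>+d. \<integral>\<^sup>+u. indicator (A n) (chart (c, d, u)) \<partial>lborel \<partial>lborel) \<le>
         (\<integral>\<^sup>+d. indicator ?J c * (indicator ?J d * (\<integral>\<^sup>+u. indicator ?J u \<partial>lborel)) \<partial>lborel)"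
      proof (intro nn_integral_mono_AE eventually_mono[OF AE_lborel_singleton[of 0]])
        fix d :: real assume "d \<noteq> 0"
        have "(\<integral>\<^sup>+u. indicator (A n) (chart (c, d, u)) \<partial>lborel) \<le>
            (\<integral>\<^sup>+u. indicator ?J c * indicator ?J d * indicator ?J u \<partial>lborel)"
          using \<open>d \<noteq> 0\<close> by (intro nn_integral_mono) (auto simp: A_def chart_def indicator_def abs_mult)
        then show "(\<integral>\<^sup>+u. indicator (A n) (chart (c, d, u)) \<partial>lborel) \<le>
            indicator ?J c * (indicator ?J d * (\<integral>\<^sup>+u. indicator ?J u \<partial>lborel))"
          by (simp add: nn_integral_cmult mult.assoc)
      qed
      then show "(\<integral>\<^sup>+d. \<integral>\<^sup>+u. indicator (A n) (chart (c, d, u)) \<partial>lborel \<partial>lborel) \<le>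
        indicator ?J c * (\<integral>\<^sup>+d. indicator ?J d * (\<integral>\<^sup>+u. indicator ?J u \<partial>lborel) \<partial>lborel)"
        by (simp add: nn_integral_cmult)
    qed
    also have "\<dots> = ennreal (2 * n) * (ennreal (2 * n) * ennreal (2 * n))"
      by (simp add: nn_integral_multc)
    also have "\<dots> < \<infinity>" by (simp flip: ennreal_mult)
    finally show ?thesis by simp
  qed
  have "M \<in> (\<Union>n. A n)" for M
  proof -
    obtain n where "max \<bar>M$2$1\<bar> (max \<bar>M$2$2\<bar> \<bar>M$1$2 / M$2$2\<bar>) \<le> real n" using real_arch_simple by blast
    then show ?thesis unfolding A_def by auto
  qed
  then have "(\<Union>n. A n) = UNIV" by blast
  then show "\<exists>A. countable A \<and> A \<subseteq> sets haar \<and> \<Union>A = space haar \<and> (\<forall>a\<in>A. emeasure haar a \<noteq> \<infinity>)"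
    using fin by (intro exI[of _ "range A"]) auto
qed

section \<open>Almost invariant functions on a quotient of finite volume\<close>

lemma countable_Ints_mat2: "countable {M :: real^2^2. \<forall>i j. M $ i $ j \<in> \<int>}"
proof -
  have Z: "countable (\<int> :: real set)" unfolding Ints_def by auto
  have "{M :: real^2^2. \<forall>i j. M $ i $ j \<in> \<int>} \<subseteq> (\<lambda>(a, b, c, d). mat2 a b c d) ` (\<int> \<times> \<int> \<times> \<int> \<times> \<int>)"
  proof
    fix M :: "real^2^2" assume "M \<in> {M. \<forall>i j. M $ i $ j \<in> \<int>}"
    then show "M \<in> (\<lambda>(a, b, c, d). mat2 a b c d) ` (\<int> \<times> \<int> \<times> \<int> \<times> \<int>)"
      by (intro image_eqI[of _ _ "(M$1$1, M$1$2, M$2$1, M$2$2)"]) (auto simp: mat2_eta)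
  qed
  then show ?thesis
    by (rule countable_subset) (intro countable_image countable_SIGMA Z)
qed

text \<open>Integrality enters twice: it makes \<open>Lam\<close> countable, so that sums over
  \<open>Lam\<close> commute with integrals, and it makes the box \<open>window\<close> inject. The
  fundamental domain is required only up to a null set, which spares any discussion of its
  boundary.\<close>

locale lattice =
  fixes Lam D :: "(real^2^2) set"
  assumes Lam_det: "A \<in> Lam \<Longrightarrow> det A = 1"
    and Lam_mult: "A \<in> Lam \<Longrightarrow> B \<in> Lam \<Longrightarrow> A ** B \<in> Lam"
    and Lam_adj: "A \<in> Lam \<Longrightarrow> adj2 A \<in> Lam"
    and Lam_int: "A \<in> Lam \<Longrightarrow> A $ i $ j \<in> \<int>"
    and D_borel [measurable]: "D \<in> sets borel"
    and D_det: "M \<in> D \<Longrightarrow> det M = 1"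
    and D_finite: "emeasure haar D \<noteq> \<infinity>"
    and D_fundamental: "AE M in haar. \<exists>!A. A \<in> Lam \<and> A ** M \<in> D"
begin

lemma countable_Lam: "countable Lam"
  using countable_Ints_mat2 by (rule countable_subset[rotated]) (auto intro: Lam_int)

text \<open>The invariant measure of the quotient, realised on the fundamental domain; functions on
  the quotient are the functions satisfying \<open>invar\<close>.\<close>

definition nu :: "(real^2^2) measure" where "nu = density haar (indicator D)"

lemma sets_nu [simp, measurable_cong]: "sets nu = sets borel"
  and space_nu [simp]: "space nu = UNIV"
  by (simp_all add: nu_def)

sublocale nu: finite_measure nu
proof
  have "emeasure nu (space nu) = emeasure haar D"
    by (simp add: nu_def emeasure_density)
  then show "emeasure nu (space nu) \<noteq> \<infinity>" using D_finite by simp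
qed

sublocale pair_sigma_finite nu haar ..

lemma AE_nu_D: "AE M in nu. M \<in> D"
  unfolding nu_def by (subst AE_density) (auto simp: indicator_def)

lemma AE_nu_det: "AE M in nu. det M = 1"
  using AE_nu_D by eventually_elim (rule D_det)

lemma nn_integral_nu:
  "f \<in> borel_measurable borel \<Longrightarrow> (\<integral>\<^sup>+M. f M \<partial>nu) = (\<integral>\<^sup>+M. indicator D M * f M \<partial>haar)"
  unfolding nu_def by (rule nn_integral_density) auto

abbreviation vol :: real where "vol \<equiv> measure nu UNIV"

lemma D_sum_translates: "AE M in haar. (\<integral>\<^sup>+A. indicator D (A ** M) \<partial>count_space Lam) = 1"
  using D_fundamental
proof eventually_elim
  case (elim M)
  then obtain A0 where A0: "A0 \<in> Lam" "A0 ** M \<in> D" "\<And>A. A \<in> Lam \<Longrightarrow> A ** M \<in> D \<Longrightarrow> A = A0"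
    by blast
  have "(\<integral>\<^sup>+A. indicator D (A ** M) \<partial>count_space Lam) = (\<integral>\<^sup>+A. indicator {A0} A \<partial>count_space Lam)"
  proof (rule nn_integral_cong)
    fix A assume "A \<in> space (count_space Lam)"
    then have "A ** M \<in> D \<longleftrightarrow> A = A0" using A0(1,2) A0(3)[of A] by auto
    then show "indicator D (A ** M) = (indicator {A0} A :: ennreal)" by (simp add: indicator_def)
  qed
  also have "\<dots> = 1" using A0(1) by (subst nn_integral_indicator) auto
  finally show ?case .
qed

text \<open>The translates of the indicator of \<open>D\<close> form a partition of unity. Insert
  it, and use left invariance to move each \<open>A\<close> from the indicator to
  \<open>f\<close>.\<close>

lemma unfolding_nn:
  assumes [measurable]: "f \<in> borel_measurable borel"
  shows "(\<integral>\<^sup>+M. f M \<partial>haar) = (\<integral>\<^sup>+M. (\<integral>\<^sup>+A. f (A ** M) \<partial>count_space Lam) \<partial>nu)"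
proof -
  note cl = countable_Lam
  have "(\<integral>\<^sup>+M. f M \<partial>haar) = (\<integral>\<^sup>+M. f M * (\<integral>\<^sup>+A. indicator D (A ** M) \<partial>count_space Lam) \<partial>haar)"
    using D_sum_translates by (intro nn_integral_cong_AE) auto
  also have "\<dots> = (\<integral>\<^sup>+M. (\<integral>\<^sup>+A. f M * indicator D (A ** M) \<partial>count_space Lam) \<partial>haar)"
    by (simp add: nn_integral_cmult)
  also have "\<dots> = (\<integral>\<^sup>+A. (\<integral>\<^sup>+M. f M * indicator D (A ** M) \<partial>haar) \<partial>count_space Lam)"
    by (intro nn_integral_count_space_nn_integral cl) measurable
  also have "\<dots> = (\<integral>\<^sup>+A. (\<integral>\<^sup>+M. f (adj2 A ** M) * indicator D M \<partial>haar) \<partial>count_space Lam)"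
  proof (rule nn_integral_cong)
    fix A assume "A \<in> space (count_space Lam)"
    then have A: "det A = 1" by (auto intro: Lam_det)
    have "(\<integral>\<^sup>+M. f (adj2 A ** M) * indicator D M \<partial>haar) =
        (\<integral>\<^sup>+M. f (adj2 A ** (A ** M)) * indicator D (A ** M) \<partial>haar)"
      by (rule haar_left[OF A, symmetric]) measurable
    then show "(\<integral>\<^sup>+M. f M * indicator D (A ** M) \<partial>haar) = (\<integral>\<^sup>+M. f (adj2 A ** M) * indicator D M \<partial>haar)"
      using A by simp
  qed
  also have "\<dots> = (\<integral>\<^sup>+A. (\<integral>\<^sup>+M. f (A ** M) * indicator D M \<partial>haar) \<partial>count_space Lam)"
  proof (rule nn_integral_bij_count_space)
    have "adj2 (adj2 A) = A" for A by (cases A rule: mat2_cases) simp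
    then show "bij_betw adj2 Lam Lam"
      by (intro bij_betwI[where g = adj2]) (auto intro: Lam_adj)
  qed
  also have "\<dots> = (\<integral>\<^sup>+M. (\<integral>\<^sup>+A. f (A ** M) * indicator D M \<partial>count_space Lam) \<partial>haar)"
    by (intro nn_integral_count_space_nn_integral[symmetric] cl) measurable
  also have "\<dots> = (\<integral>\<^sup>+A. (\<integral>\<^sup>+M. f (A ** M) \<partial>nu) \<partial>count_space Lam)"
    by (subst nn_integral_count_space_nn_integral)
       (auto simp: nn_integral_nu mult.commute cl)
  also have "\<dots> = (\<integral>\<^sup>+M. (\<integral>\<^sup>+A. f (A ** M) \<partial>count_space Lam) \<partial>nu)"
    by (intro nn_integral_count_space_nn_integral[symmetric] cl) measurable
  finally show ?thesis .
qed

section \<open>Invariant functions and the right action on the quotient\<close>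

definition invar :: "(real^2^2 \<Rightarrow> 'b) \<Rightarrow> bool" where
  "invar f \<longleftrightarrow> (\<forall>A\<in>Lam. \<forall>M. det M = 1 \<longrightarrow> f (A ** M) = f M)"

lemma invarD: "invar f \<Longrightarrow> A \<in> Lam \<Longrightarrow> det M = 1 \<Longrightarrow> f (A ** M) = f M"
  by (simp add: invar_def)

lemma invar_compose: "invar f \<Longrightarrow> invar (\<lambda>M. h (f M))"
  by (simp add: invar_def)

lemma invar_compose2: "invar f \<Longrightarrow> invar g \<Longrightarrow> invar (\<lambda>M. h (f M) (g M))"
  by (simp add: invar_def)

lemma invar_right: "invar f \<Longrightarrow> det g = 1 \<Longrightarrow> invar (\<lambda>M. f (M ** g))"
  by (simp add: invar_def matrix_mul_assoc[symmetric] det_mult_1)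

text \<open>The set \<open>D g\<close> is another fundamental domain, and unfolding shows that an
  invariant function has the same integral over both.\<close>

lemma nu_right_nn:
  assumes [measurable]: "f \<in> borel_measurable borel" and f: "invar f" and g: "det g = 1"
  shows "(\<integral>\<^sup>+M. f (M ** g) \<partial>nu) = (\<integral>\<^sup>+M. f M \<partial>nu)"
proof -
  have g': "det (adj2 g) = 1" using g by simp
  have "(\<integral>\<^sup>+M. f (M ** g) \<partial>nu) = (\<integral>\<^sup>+M. indicator D M * f (M ** g) \<partial>haar)"
    by (rule nn_integral_nu) measurable
  also have "\<dots> = (\<integral>\<^sup>+M. indicator D (M ** adj2 g) * f (M ** adj2 g ** g) \<partial>haar)"
    by (rule haar_right[OF g', symmetric]) measurable
  also have "\<dots> = (\<integral>\<^sup>+M. indicator D (M ** adj2 g) * f M \<partial>haar)"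
    using g by simp
  also have "\<dots> = (\<integral>\<^sup>+M. (\<integral>\<^sup>+A. indicator D (A ** M ** adj2 g) * f (A ** M) \<partial>count_space Lam) \<partial>nu)"
    by (rule unfolding_nn) measurable
  also have "\<dots> = (\<integral>\<^sup>+M. f M * (\<integral>\<^sup>+A. indicator D (A ** (M ** adj2 g)) \<partial>count_space Lam) \<partial>nu)"
  proof (rule nn_integral_cong_AE)
    show "AE M in nu. (\<integral>\<^sup>+A. indicator D (A ** M ** adj2 g) * f (A ** M) \<partial>count_space Lam) =
        f M * (\<integral>\<^sup>+A. indicator D (A ** (M ** adj2 g)) \<partial>count_space Lam)"
      using AE_nu_det
    proof eventually_elim
      case (elim M)
      have "(\<integral>\<^sup>+A. indicator D (A ** M ** adj2 g) * f (A ** M) \<partial>count_space Lam) =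
          (\<integral>\<^sup>+A. f M * indicator D (A ** (M ** adj2 g)) \<partial>count_space Lam)"
        using elim by (intro nn_integral_cong) (simp add: invarD[OF f] matrix_mul_assoc mult.commute)
      then show ?case by (simp add: nn_integral_cmult)
    qed
  qed
  also have "\<dots> = (\<integral>\<^sup>+M. f M \<partial>nu)"
  proof (rule nn_integral_cong_AE)
    have "AE M in nu. (\<integral>\<^sup>+A. indicator D (A ** (M ** adj2 g)) \<partial>count_space Lam) = 1"
      unfolding nu_def using AE_haar_right[OF D_sum_translates g']
      by (subst AE_density) (auto elim: eventually_mono)
    then show "AE M in nu. f M * (\<integral>\<^sup>+A. indicator D (A ** (M ** adj2 g)) \<partial>count_space Lam) = f M"
      by eventually_elim simp
  qed
  finally show ?thesis .
qed

lemma integrable_nu_bounded [intro]: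
  assumes "f \<in> borel_measurable borel" "\<And>M. \<bar>f M\<bar> \<le> (B :: real)"
  shows "integrable nu f"
  using assms by (intro nu.integrable_const_bound[where B = B]) auto

lemma nu_right:
  fixes f :: "real^2^2 \<Rightarrow> real"
  assumes [measurable]: "f \<in> borel_measurable borel" and f: "invar f" and g: "det g = 1"
    and B: "\<And>M. \<bar>f M\<bar> \<le> B"
  shows "(\<integral>M. f (M ** g) \<partial>nu) = (\<integral>M. f M \<partial>nu)"
proof -
  have pos: "0 \<le> f M + B" for M using B[of M] by simp
  have int: "integrable nu f" by (rule integrable_nu_bounded[OF assms(1) B])
  have int': "integrable nu (\<lambda>M. f (M ** g))" by (rule integrable_nu_bounded[OF _ B]) measurable
  have "(\<integral>M. f (M ** g) + B \<partial>nu) = enn2real (\<integral>\<^sup>+M. ennreal (f (M ** g) + B) \<partial>nu)"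
    using pos by (intro integral_eq_nn_integral) auto
  also have "(\<integral>\<^sup>+M. ennreal (f (M ** g) + B) \<partial>nu) = (\<integral>\<^sup>+M. ennreal (f M + B) \<partial>nu)"
    by (rule nu_right_nn[where f = "\<lambda>M. ennreal (f M + B)"]) (auto intro: invar_compose f g)
  also have "enn2real \<dots> = (\<integral>M. f M + B \<partial>nu)"
    using pos by (intro integral_eq_nn_integral[symmetric]) auto
  finally show ?thesis using int int' by simp
qed

text \<open>Right perturbations are the ones that make sense on a quotient by a left action. The
  bound has to be uniform in \<open>M\<close> because the quotient need not be compact.\<close>

definition ruc :: "(real^2^2 \<Rightarrow> real) \<Rightarrow> bool" where
  "ruc f \<longleftrightarrow> (\<forall>e>0. \<forall>\<^sub>F h in nhds (mat 1). det h = 1 \<longrightarrow> (\<forall>M. det M = 1 \<longrightarrow> \<bar>f (M ** h) - f M\<bar> < e))"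

definition adm :: "real \<Rightarrow> (real^2^2 \<Rightarrow> real) \<Rightarrow> bool" where
  "adm B f \<longleftrightarrow> f \<in> borel_measurable borel \<and> invar f \<and> (\<forall>M. \<bar>f M\<bar> \<le> B) \<and> ruc f"

lemma admD:
  assumes "adm B f"
  shows "f \<in> borel_measurable borel" "invar f" "\<bar>f M\<bar> \<le> B" "ruc f"
  using assms by (auto simp: adm_def)

text \<open>\<open>M h g\<close> is \<open>M g\<close> times the conjugate of \<open>h\<close> by
  the inverse of \<open>g\<close>, and conjugation by a fixed matrix is continuous at the
  identity.\<close>

lemma ruc_right:
  assumes f: "ruc f" and g: "det g = 1"
  shows "ruc (\<lambda>M. f (M ** g))"
  unfolding ruc_def
proof (intro allI impI)
  fix e :: real assume "e > 0"
  have "((\<lambda>h. adj2 g ** h ** g) \<longlongrightarrow> adj2 g ** mat 1 ** g) (nhds (mat 1))"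
    by (intro tendsto_intros filterlim_ident)
  then have lim: "filterlim (\<lambda>h. adj2 g ** h ** g) (nhds (mat 1)) (nhds (mat 1))"
    using adj2_mult(1)[OF g] by simp
  have "\<forall>\<^sub>F h in nhds (mat 1). det h = 1 \<longrightarrow> (\<forall>M. det M = 1 \<longrightarrow> \<bar>f (M ** h) - f M\<bar> < e)"
    using f \<open>e > 0\<close> by (simp add: ruc_def)
  from eventually_compose_filterlim[OF this lim]
  show "\<forall>\<^sub>F h in nhds (mat 1). det h = 1 \<longrightarrow> (\<forall>M. det M = 1 \<longrightarrow> \<bar>f (M ** h ** g) - f (M ** g)\<bar> < e)"
  proof eventually_elim
    case (elim h)
    show ?case
    proof (intro impI allI)
      fix M :: "real^2^2" assume h: "det h = 1" "det M = 1"
      have "M ** h ** g = M ** g ** (adj2 g ** h ** g)"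
        using g by (simp add: matrix_mul_assoc[symmetric])
      then show "\<bar>f (M ** h ** g) - f (M ** g)\<bar> < e"
        using elim g h by (simp add: det_mult_1)
    qed
  qed
qed

lemma adm_right: "adm B f \<Longrightarrow> det g = 1 \<Longrightarrow> adm B (\<lambda>M. f (M ** g))"
  unfolding adm_def by (auto intro: invar_right ruc_right)

lemma adm_mid:
  assumes "adm B f" "adm B g"
  shows "adm B (\<lambda>M. (f M + g M) / 2)"
proof -
  note fg = admD[OF assms(1)] admD[OF assms(2)]
  note [measurable] = fg(1) fg(5)
  have "ruc (\<lambda>M. (f M + g M) / 2)"
    unfolding ruc_def
  proof (intro allI impI)
    fix e :: real assume "e > 0"
    then have "\<forall>\<^sub>F h in nhds (mat 1). det h = 1 \<longrightarrow> (\<forall>M. det M = 1 \<longrightarrow> \<bar>f (M ** h) - f M\<bar> < e)"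
      "\<forall>\<^sub>F h in nhds (mat 1). det h = 1 \<longrightarrow> (\<forall>M. det M = 1 \<longrightarrow> \<bar>g (M ** h) - g M\<bar> < e)"
      using fg by (simp_all add: ruc_def)
    then show "\<forall>\<^sub>F h in nhds (mat 1). det h = 1 \<longrightarrow> (\<forall>M. det M = 1 \<longrightarrow>
        \<bar>(f (M ** h) + g (M ** h)) / 2 - (f M + g M) / 2\<bar> < e)"
    proof eventually_elim
      case (elim h)
      show ?case
      proof (intro impI allI)
        fix M :: "real^2^2" assume "det h = 1" "det M = 1"
        then have "\<bar>f (M ** h) - f M\<bar> < e" "\<bar>g (M ** h) - g M\<bar> < e" using elim by auto
        then show "\<bar>(f (M ** h) + g (M ** h)) / 2 - (f M + g M) / 2\<bar> < e" by (simp add: field_simps abs_less_iff)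
      qed
    qed
  qed
  moreover have "\<bar>(f M + g M) / 2\<bar> \<le> B" for M using fg(3)[of M] fg(7)[of M] by (simp add: abs_le_iff)
  ultimately show ?thesis
    unfolding adm_def using invar_compose2[OF fg(2) fg(6), of "\<lambda>x y. (x + y) / 2"] by auto
qed

text \<open>Dyadic convex combinations are enough: the parallelogram argument only compares a
  near-minimiser with the midpoint of it and one of its translates, and midpoints keep every
  induction over the hull elementary.\<close>

inductive_set shift_hull :: "(real^2^2 \<Rightarrow> real) \<Rightarrow> (real^2^2 \<Rightarrow> real) set" for f where
  base: "f \<in> shift_hull f"
| shift: "A \<in> shift_hull f \<Longrightarrow> (\<lambda>M. A (M ** upr s)) \<in> shift_hull f"
| mid: "A \<in> shift_hull f \<Longrightarrow> A' \<in> shift_hull f \<Longrightarrow> (\<lambda>M. (A M + A' M) / 2) \<in> shift_hull f"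

lemma hull_adm: "A \<in> shift_hull f \<Longrightarrow> adm B f \<Longrightarrow> adm B A"
  by (induction rule: shift_hull.induct) (auto intro: adm_right adm_mid)

lemma hull_integral: "A \<in> shift_hull f \<Longrightarrow> adm B f \<Longrightarrow> (\<integral>M. A M \<partial>nu) = (\<integral>M. f M \<partial>nu)"
proof (induction rule: shift_hull.induct)
  case (shift A s)
  note A = admD[OF hull_adm[OF shift.hyps shift.prems]]
  show ?case using nu_right[OF A(1,2) _ A(3), of "upr s"] shift by simp
next
  case (mid A A')
  note A = admD[OF hull_adm[OF mid.hyps(1) mid.prems]] admD[OF hull_adm[OF mid.hyps(2) mid.prems]]
  have "integrable nu A" "integrable nu A'" using A by auto
  then show ?case using mid by simp
qed simp

text \<open>The parallelogram law at a near-minimiser of the \<open>L\<^sup>2\<close> norm, as in the mean ergodic theorem.\<close>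

lemma hull_near_invariant:
  assumes f: "adm B f" and "e > 0"
  shows "\<exists>A\<in>shift_hull f. \<forall>s. (\<integral>M. (A (M ** upr s) - A M)\<^sup>2 \<partial>nu) \<le> e"
proof -
  define Q where "Q A = (\<integral>M. (A M)\<^sup>2 \<partial>nu)" for A :: "real^2^2 \<Rightarrow> real"
  have bdd: "bdd_below (Q ` shift_hull f)" by (intro bdd_belowI[of _ 0]) (auto simp: Q_def)
  have ne: "Q ` shift_hull f \<noteq> {}" using shift_hull.base by auto
  \<comment> \<open>With \<open>C\<close> the correlation of \<open>A\<close> and its translate, the
    midpoint has squared norm \<open>(Q A + C) / 2\<close>. It is at least the infimum, so a slack
    of \<open>e / 4\<close> gives \<open>2 * Q A - 2 * C <= e\<close>, the squared distance of the
    two.\<close>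
  obtain A where A: "A \<in> shift_hull f" "Q A < Inf (Q ` shift_hull f) + e / 4"
    using cInf_lessD[OF ne, of "Inf (Q ` shift_hull f) + e / 4"] \<open>e > 0\<close> by auto
  note A' = admD[OF hull_adm[OF A(1) f]]
  note [measurable] = A'(1)
  have "(\<integral>M. (A (M ** upr s) - A M)\<^sup>2 \<partial>nu) \<le> e" for s
  proof -
    have le: "Inf (Q ` shift_hull f) \<le> Q (\<lambda>M. (A (M ** upr s) + A M) / 2)"
      using A by (intro cInf_lower bdd imageI shift_hull.intros)
    have sq: "(x::real)\<^sup>2 \<le> B\<^sup>2" if "\<bar>x\<bar> \<le> B" for x
      using that abs_le_square_iff[of x B] by simp
    have pr: "\<bar>x * y\<bar> \<le> B * B" if "\<bar>x\<bar> \<le> B" "\<bar>y\<bar> \<le> B" for x y :: real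
      using that by (simp add: abs_mult mult_mono')
    have int: "integrable nu (\<lambda>M. (A M)\<^sup>2)" "integrable nu (\<lambda>M. (A (M ** upr s))\<^sup>2)"
      "integrable nu (\<lambda>M. A (M ** upr s) * A M)"
      using sq A'(3) pr by (auto intro!: integrable_nu_bounded[where B = "B\<^sup>2"] simp: power2_eq_square)
    have "invar (\<lambda>M. (A M)\<^sup>2)" using A'(2) by (rule invar_compose)
    then have inv: "(\<integral>M. (A (M ** upr s))\<^sup>2 \<partial>nu) = Q A"
      unfolding Q_def using nu_right[of "\<lambda>M. (A M)\<^sup>2" "upr s" "B\<^sup>2"] sq A'(3) by auto
    define C where "C = (\<integral>M. A (M ** upr s) * A M \<partial>nu)"
    have 1: "(\<integral>M. (A (M ** upr s) - A M)\<^sup>2 \<partial>nu) = 2 * Q A - 2 * C"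
      using int by (simp add: power2_diff inv mult.assoc) (simp add: Q_def C_def)
    have 2: "Q (\<lambda>M. (A (M ** upr s) + A M) / 2) = (2 * Q A + 2 * C) / 4"
      using int unfolding Q_def by (simp add: power_divide power2_sum inv mult.assoc) (simp add: Q_def C_def)
    show ?thesis using le A(2) unfolding 1 2 by (simp add: field_simps)
  qed
  then show ?thesis using A(1) by blast
qed

text \<open>Young's inequality in place of Cauchy-Schwarz: no square roots appear, and the free
  parameter \<open>k\<close> is adjusted to the size of the L2 norm by the caller.\<close>

lemma L1_le_L2:
  assumes [measurable]: "X \<in> borel_measurable borel" and B: "\<And>M. \<bar>X M\<bar> \<le> (B :: real)" and k: "k > 0"
  shows "(\<integral>M. \<bar>X M\<bar> \<partial>nu) \<le> ((\<integral>M. (X M)\<^sup>2 \<partial>nu) / k + k * vol) / 2"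
proof -
  have sq: "\<bar>(X M)\<^sup>2\<bar> \<le> B\<^sup>2" for M using B[of M] abs_le_square_iff[of "X M" B] by simp
  have int: "integrable nu (\<lambda>M. (X M)\<^sup>2)" "integrable nu (\<lambda>M. \<bar>X M\<bar>)"
    using B sq by (auto intro!: integrable_nu_bounded)
  have "(\<integral>M. \<bar>X M\<bar> \<partial>nu) \<le> (\<integral>M. (X M)\<^sup>2 / (2 * k) + k / 2 \<partial>nu)"
  proof (intro integral_mono)
    fix M
    have "0 \<le> (\<bar>X M\<bar> - k)\<^sup>2" by simp
    then have "2 * k * \<bar>X M\<bar> \<le> (X M)\<^sup>2 + k\<^sup>2" by (simp add: power2_diff mult_ac)
    then show "\<bar>X M\<bar> \<le> (X M)\<^sup>2 / (2 * k) + k / 2" using k by (simp add: field_simps power2_eq_square)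
  qed (use int in auto)
  also have "\<dots> = ((\<integral>M. (X M)\<^sup>2 \<partial>nu) / k + k * vol) / 2"
    using int by (simp add: field_simps)
  finally show ?thesis .
qed

section \<open>Displacement, correlation and the Mautner phenomenon\<close>

definition displacement :: "(real^2^2 \<Rightarrow> real) \<Rightarrow> real^2^2 \<Rightarrow> real" where
  "displacement A g = (\<integral>M. \<bar>A (M ** g) - A M\<bar> \<partial>nu)"

text \<open>A diagonal matrix coefficient of the right regular representation. Unlike the
  displacement, it can be compared across both left and right factors of \<open>g\<close>.\<close>

definition correlation :: "(real^2^2 \<Rightarrow> real) \<Rightarrow> real^2^2 \<Rightarrow> real" where
  "correlation A g = (\<integral>M. A (M ** g) * A M \<partial>nu)"

context
  fixes A :: "real^2^2 \<Rightarrow> real" and B :: real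
  assumes A: "adm B A"
begin

private lemma [measurable]: "A \<in> borel_measurable borel" using admD(1)[OF A] .

private lemma bound: "\<bar>A M\<bar> \<le> B" by (rule admD(3)[OF A])

private lemma B_nonneg: "B \<ge> 0" using bound[of 0] by linarith

private lemma diff_bound: "\<bar>A M - A N\<bar> \<le> 2 * B" using bound[of M] bound[of N] by linarith

lemma integrable_displacement: "integrable nu (\<lambda>M. \<bar>A (M ** g) - A M\<bar>)"
  using diff_bound by (intro integrable_nu_bounded[where B = "2 * B"]) auto

lemma integral_displacement_right:
  assumes "det g = 1" "det h = 1"
  shows "(\<integral>M. \<bar>A (M ** g ** h) - A (M ** g)\<bar> \<partial>nu) = displacement A h"
  unfolding displacement_def
  using assms diff_bound
  by (intro nu_right[where f = "\<lambda>M. \<bar>A (M ** h) - A M\<bar>" and B = "2 * B"])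
     (auto intro!: invar_compose2[where h = "\<lambda>x y. \<bar>x - y\<bar>"] invar_right admD(2)[OF A])

text \<open>The triangle inequality through \<open>A (M ** g)\<close>; invariance of
  \<open>nu\<close> turns the first difference into the displacement of \<open>h\<close>.\<close>

lemma displacement_mult:
  assumes "det g = 1" "det h = 1"
  shows "displacement A (g ** h) \<le> displacement A g + displacement A h"
proof -
  have i: "integrable nu (\<lambda>M. \<bar>A (M ** g ** h) - A (M ** g)\<bar>)"
    using diff_bound by (intro integrable_nu_bounded[where B = "2 * B"]) auto
  have "displacement A (g ** h) \<le> (\<integral>M. \<bar>A (M ** g ** h) - A (M ** g)\<bar> + \<bar>A (M ** g) - A M\<bar> \<partial>nu)"
    unfolding displacement_def using i integrable_displacement[of g] integrable_displacement[of "g ** h"]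
    by (intro integral_mono) (auto simp: matrix_mul_assoc)
  also have "\<dots> = displacement A h + displacement A g"
    using i integrable_displacement integral_displacement_right[OF assms] by (simp add: displacement_def)
  finally show ?thesis by simp
qed

lemma correlation_right:
  assumes "det g = 1" "det h = 1"
  shows "\<bar>correlation A (g ** h) - correlation A g\<bar> \<le> B * displacement A h"
proof -
  have pr: "\<bar>A x * A y\<bar> \<le> B * B" for x y
    using bound[of x] bound[of y] by (simp add: abs_mult mult_mono')
  have i: "integrable nu (\<lambda>M. A (M ** g ** h) * A M)" "integrable nu (\<lambda>M. A (M ** g) * A M)"
    "integrable nu (\<lambda>M. \<bar>A (M ** g ** h) - A (M ** g)\<bar>)"
    using pr diff_bound by (auto intro!: integrable_nu_bounded)
  have "\<bar>correlation A (g ** h) - correlation A g\<bar> = \<bar>\<integral>M. A (M ** g ** h) * A M - A (M ** g) * A M \<partial>nu\<bar>"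
    using i by (simp add: correlation_def matrix_mul_assoc)
  also have "\<dots> \<le> (\<integral>M. \<bar>A (M ** g ** h) * A M - A (M ** g) * A M\<bar> \<partial>nu)"
    by (rule integral_abs_bound)
  also have "\<dots> \<le> (\<integral>M. B * \<bar>A (M ** g ** h) - A (M ** g)\<bar> \<partial>nu)"
    using i
  proof (intro integral_mono)
    fix M
    have "\<bar>A (M ** g ** h) * A M - A (M ** g) * A M\<bar> = \<bar>A M\<bar> * \<bar>A (M ** g ** h) - A (M ** g)\<bar>"
      by (simp add: abs_mult[symmetric] algebra_simps)
    also have "\<dots> \<le> B * \<bar>A (M ** g ** h) - A (M ** g)\<bar>"
      using bound by (intro mult_right_mono) auto
    finally show "\<bar>A (M ** g ** h) * A M - A (M ** g) * A M\<bar> \<le> B * \<bar>A (M ** g ** h) - A (M ** g)\<bar>" .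
  qed auto
  also have "\<dots> = B * displacement A h" using integral_displacement_right[OF assms] by simp
  finally show ?thesis .
qed

text \<open>Invariance of \<open>nu\<close> shifts \<open>h\<close> from one factor to the other.
  Together with \<open>correlation_right\<close> this makes the correlation nearly constant on
  double cosets of elements of small displacement.\<close>

lemma correlation_left:
  assumes "det g = 1" "det h = 1"
  shows "\<bar>correlation A (h ** g) - correlation A g\<bar> \<le> B * displacement A h"
proof -
  have pr: "\<bar>A x * A y\<bar> \<le> B * B" for x y
    using bound[of x] bound[of y] by (simp add: abs_mult mult_mono')
  have i: "integrable nu (\<lambda>M. A (M ** h ** g) * A M)" "integrable nu (\<lambda>M. A (M ** h ** g) * A (M ** h))"
    using pr by (auto intro!: integrable_nu_bounded)
  have c: "correlation A g = (\<integral>M. A (M ** h ** g) * A (M ** h) \<partial>nu)"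
    unfolding correlation_def using assms pr
    by (intro nu_right[symmetric, where f = "\<lambda>M. A (M ** g) * A M" and B = "B * B"])
       (auto intro!: invar_compose2[where h = "(*)"] invar_right admD(2)[OF A])
  have "\<bar>correlation A (h ** g) - correlation A g\<bar> = \<bar>\<integral>M. A (M ** h ** g) * A M - A (M ** h ** g) * A (M ** h) \<partial>nu\<bar>"
    using i by (simp add: c) (simp add: correlation_def matrix_mul_assoc)
  also have "\<dots> \<le> (\<integral>M. \<bar>A (M ** h ** g) * A M - A (M ** h ** g) * A (M ** h)\<bar> \<partial>nu)"
    by (rule integral_abs_bound)
  also have "\<dots> \<le> (\<integral>M. B * \<bar>A (M ** h) - A M\<bar> \<partial>nu)"
    using i integrable_displacement
  proof (intro integral_mono)
    fix M
    have "\<bar>A (M ** h ** g) * A M - A (M ** h ** g) * A (M ** h)\<bar> = \<bar>A (M ** h ** g)\<bar> * \<bar>A (M ** h) - A M\<bar>"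
      by (simp add: abs_mult[symmetric] right_diff_distrib abs_minus_commute)
    also have "\<dots> \<le> B * \<bar>A (M ** h) - A M\<bar>"
      using bound by (intro mult_right_mono) auto
    finally show "\<bar>A (M ** h ** g) * A M - A (M ** h ** g) * A (M ** h)\<bar> \<le> B * \<bar>A (M ** h) - A M\<bar>" .
  qed auto
  also have "\<dots> = B * displacement A h" by (simp add: displacement_def)
  finally show ?thesis .
qed

lemma displacement_lwr_tendsto: "((\<lambda>v. displacement A (lwr v)) \<longlongrightarrow> 0) (at 0)"
proof (rule tendstoI)
  fix e :: real assume "e > 0"
  define e' where "e' = e / (vol + 1)"
  have V: "vol + 1 > 0" using measure_nonneg[of nu UNIV] by linarith
  have e': "e' > 0" "e' * vol < e"
    using \<open>e > 0\<close> V by (auto simp: e'_def field_simps)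
  have "((\<lambda>v. lwr v) \<longlongrightarrow> lwr 0) (at 0)" by (intro tendsto_intros)
  then have lim: "filterlim (\<lambda>v. lwr v) (nhds (mat 1)) (at 0)" by (simp add: mat_1_eq_mat2)
  have "\<forall>\<^sub>F h in nhds (mat 1). det h = 1 \<longrightarrow> (\<forall>M. det M = 1 \<longrightarrow> \<bar>A (M ** h) - A M\<bar> < e')"
    using admD(4)[OF A] e' by (simp add: ruc_def)
  from eventually_compose_filterlim[OF this lim]
  show "\<forall>\<^sub>F v in at 0. dist (displacement A (lwr v)) 0 < e"
  proof eventually_elim
    case (elim v)
    have "displacement A (lwr v) \<le> (\<integral>M. e' \<partial>nu)"
      unfolding displacement_def
    proof (rule integral_mono_AE[OF integrable_displacement])
      show "AE M in nu. \<bar>A (M ** lwr v) - A M\<bar> \<le> e'"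
        using AE_nu_det by eventually_elim (use elim in force)
    qed auto
    moreover have "displacement A (lwr v) \<ge> 0" by (simp add: displacement_def)
    ultimately show ?case using e' by (simp add: dist_real_def mult.commute)
  qed
qed

context
  fixes \<delta> :: real
  assumes \<delta>: "\<And>s. displacement A (upr s) \<le> \<delta>"
begin

text \<open>The Mautner phenomenon: up to an arbitrarily small unipotent factor, a diagonal matrix lies
  in the double coset of \<open>lwr e\<close>, with \<open>e\<close> small, modulo the upper unipotent group.\<close>

lemma correlation_dgl:
  assumes "l > 0"
  shows "\<bar>correlation A (dgl l) - correlation A (mat 1)\<bar> \<le> 2 * B * \<delta>"
proof -
  have "((\<lambda>e. displacement A (lwr (l * e))) \<longlongrightarrow> 0) (at 0)"
  proof (rule filterlim_compose[OF displacement_lwr_tendsto])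
    show "filterlim ((*) l) (at 0) (at 0)"
      using assms by (auto simp: filterlim_at intro!: tendsto_eq_intros eventually_at_topological eventually_mono[OF eventually_neq_at_within[of 0]])
  qed
  then have lim: "((\<lambda>e. 2 * B * \<delta> + B * (displacement A (lwr e) + displacement A (lwr (l * e)))) \<longlongrightarrow> 2 * B * \<delta> + B * (0 + 0)) (at 0)"
    by (intro tendsto_intros displacement_lwr_tendsto)
  have "\<bar>correlation A (dgl l) - correlation A (mat 1)\<bar> \<le> 2 * B * \<delta> + B * (displacement A (lwr e) + displacement A (lwr (l * e)))"
    if "e \<noteq> 0" for e
  proof -
    \<comment> \<open>Chosen so that \<open>upr x ** lwr e\<close> has upper left entry
      \<open>l\<close>; the factor \<open>upr (- x / l)\<close> then clears the upper right entry.
      As \<open>e\<close> tends to 0, \<open>x\<close> may grow without bound, which is harmless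
      because \<delta> bounds the displacement of every \<open>upr s\<close>.\<close>
    define x where "x = (l - 1) / e"
    have eq: "upr x ** (lwr e ** upr (- x / l)) = dgl l ** lwr (l * e)"
      using that assms by (simp add: x_def field_simps)
    have B: "B * displacement A (upr s) \<le> B * \<delta>" for s using \<delta> B_nonneg by (intro mult_left_mono)
    have "\<bar>correlation A (lwr e) - correlation A (mat 1)\<bar> \<le> B * displacement A (lwr e)"
      using correlation_right[of "mat 1" "lwr e"] by simp
    moreover have "\<bar>correlation A (lwr e ** upr (- x / l)) - correlation A (lwr e)\<bar> \<le> B * \<delta>"
      using correlation_right[of "lwr e" "upr (- x / l)"] B[of "- x / l"] by simp
    moreover have "\<bar>correlation A (upr x ** (lwr e ** upr (- x / l))) - correlation A (lwr e ** upr (- x / l))\<bar> \<le> B * \<delta>"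
      using correlation_left[of "lwr e ** upr (- x / l)" "upr x"] B[of x] by (simp add: det_mul)
    moreover have "\<bar>correlation A (dgl l ** lwr (l * e)) - correlation A (dgl l)\<bar> \<le> B * displacement A (lwr (l * e))"
      using correlation_right[of "dgl l" "lwr (l * e)"] assms by simp
    ultimately show ?thesis unfolding eq by (simp add: algebra_simps)
  qed
  then have "\<forall>\<^sub>F e in at 0. \<bar>correlation A (dgl l) - correlation A (mat 1)\<bar> \<le> 2 * B * \<delta> + B * (displacement A (lwr e) + displacement A (lwr (l * e)))"
    by (auto simp: eventually_at_filter)
  from tendsto_lowerbound[OF lim this] show ?thesis by simp
qed

text \<open>Translation preserves the L2 norm, so the squared L2 distance is twice the drop of the
  correlation, at most \<open>4 * B * \<delta>\<close>; \<open>L1_le_L2\<close> returns to the L1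
  norm. The bound does not depend on \<open>l\<close>, which \<open>displacement_lwr\<close>
  exploits.\<close>

lemma displacement_dgl:
  assumes "l > 0" "k > 0"
  shows "displacement A (dgl l) \<le> (4 * B * \<delta> / k + k * vol) / 2"
proof -
  have sq: "(A x)\<^sup>2 \<le> B\<^sup>2" for x using bound[of x] abs_le_square_iff[of "A x" B] by simp
  have pr: "\<bar>A x * A y\<bar> \<le> B\<^sup>2" for x y
    using bound[of x] bound[of y] by (simp add: abs_mult mult_mono' power2_eq_square)
  have int: "integrable nu (\<lambda>M. (A M)\<^sup>2)" "integrable nu (\<lambda>M. (A (M ** dgl l))\<^sup>2)"
      "integrable nu (\<lambda>M. A (M ** dgl l) * A M)"
    using sq pr by (auto intro!: integrable_nu_bounded[where B = "B\<^sup>2"])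
  have "invar (\<lambda>M. (A M)\<^sup>2)" using admD(2)[OF A] by (rule invar_compose)
  then have "(\<integral>M. (A (M ** dgl l))\<^sup>2 \<partial>nu) = (\<integral>M. (A M)\<^sup>2 \<partial>nu)"
    using nu_right[of "\<lambda>M. (A M)\<^sup>2" "dgl l" "B\<^sup>2"] sq assms by auto
  moreover have "correlation A (mat 1) = (\<integral>M. (A M)\<^sup>2 \<partial>nu)" by (simp add: correlation_def power2_eq_square)
  ultimately have "(\<integral>M. (A (M ** dgl l) - A M)\<^sup>2 \<partial>nu) = 2 * correlation A (mat 1) - 2 * correlation A (dgl l)"
    using int by (simp add: power2_diff mult.assoc) (simp add: correlation_def)
  then have "(\<integral>M. (A (M ** dgl l) - A M)\<^sup>2 \<partial>nu) \<le> 4 * B * \<delta>"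
    using correlation_dgl[OF assms(1)] by linarith
  then have "(\<integral>M. (A (M ** dgl l) - A M)\<^sup>2 \<partial>nu) / k \<le> 4 * B * \<delta> / k"
    using assms by (intro divide_right_mono) auto
  from divide_right_mono[OF add_right_mono[OF this, of "k * vol"], of 2]
  have "((\<integral>M. (A (M ** dgl l) - A M)\<^sup>2 \<partial>nu) / k + k * vol) / 2 \<le> (4 * B * \<delta> / k + k * vol) / 2"
    by simp
  moreover have "displacement A (dgl l) \<le> ((\<integral>M. (A (M ** dgl l) - A M)\<^sup>2 \<partial>nu) / k + k * vol) / 2"
    unfolding displacement_def using assms diff_bound by (intro L1_le_L2[where B = "2 * B"]) auto
  ultimately show ?thesis by (rule order_trans[rotated])
qed

text \<open>Conjugation by \<open>dgl l\<close> shrinks \<open>v\<close> to \<open>l^2 * v\<close>,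
  whose displacement vanishes as \<open>l\<close> tends to 0, while the two diagonal factors cost a
  bounded amount for every \<open>l\<close>. The case \<open>v = 0\<close> stands apart because
  \<open>displacement_lwr_tendsto\<close> is a limit over nonzero values.\<close>

lemma displacement_lwr:
  assumes "k > 0"
  shows "displacement A (lwr v) \<le> 4 * B * \<delta> / k + k * vol"
proof (cases "v = 0")
  case True
  then have "lwr v = mat 1" by (simp add: mat_1_eq_mat2)
  moreover have "\<delta> \<ge> 0" using \<delta>[of 0] by (auto simp: displacement_def intro: order_trans[rotated])
  ultimately show ?thesis using B_nonneg assms by (simp add: displacement_def)
next
  case False
  have "((\<lambda>l. displacement A (lwr (l\<^sup>2 * v))) \<longlongrightarrow> 0) (at_right 0)"
  proof (rule filterlim_compose[OF displacement_lwr_tendsto])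
    have "((\<lambda>l. l\<^sup>2 * v) \<longlongrightarrow> 0) (at_right 0)" by (auto intro!: tendsto_eq_intros)
    moreover have "\<forall>\<^sub>F l in at_right 0. l\<^sup>2 * v \<noteq> 0"
      using eventually_at_right_less[of "0::real"] by eventually_elim (use False in auto)
    ultimately show "filterlim (\<lambda>l. l\<^sup>2 * v) (at 0) (at_right 0)" by (auto simp: filterlim_at)
  qed
  then have lim: "((\<lambda>l. 4 * B * \<delta> / k + k * vol + displacement A (lwr (l\<^sup>2 * v))) \<longlongrightarrow> 4 * B * \<delta> / k + k * vol + 0) (at_right 0)"
    by (intro tendsto_intros)
  have "\<forall>\<^sub>F l in at_right 0. displacement A (lwr v) \<le> 4 * B * \<delta> / k + k * vol + displacement A (lwr (l\<^sup>2 * v))"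
    using eventually_at_right_less[of "0::real"]
  proof eventually_elim
    case (elim l)
    then have eq: "lwr v = dgl l ** (lwr (l\<^sup>2 * v) ** dgl (1 / l))"
      by (simp add: power2_eq_square)
    have "displacement A (lwr v) \<le> displacement A (dgl l) + (displacement A (lwr (l\<^sup>2 * v)) + displacement A (dgl (1 / l)))"
      unfolding eq using elim
      by (intro order_trans[OF displacement_mult] add_left_mono displacement_mult) (auto simp: det_mul)
    then show ?case
      using displacement_dgl[of l k] displacement_dgl[of "1 / l" k] elim assms by simp
  qed
  from tendsto_lowerbound[OF lim this] show ?thesis by simp
qed

lemma displacement_le:
  assumes "k > 0" "det g = 1" "g $ 2 $ 1 \<noteq> 0"
  shows "displacement A g \<le> 2 * \<delta> + (4 * B * \<delta> / k + k * vol)"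
proof -
  obtain a b c d where g: "g = mat2 a b c d" by (rule mat2_cases)
  then have eq: "g = upr ((a - 1) / c) ** lwr c ** upr ((d - 1) / c)"
    using SL2_eq_upr_lwr_upr[of a d b c] assms by simp
  have "displacement A g \<le> displacement A (upr ((a - 1) / c)) + displacement A (lwr c) + displacement A (upr ((d - 1) / c))"
    unfolding eq by (intro order_trans[OF displacement_mult] add_right_mono displacement_mult) (auto simp: det_mul)
  then show ?thesis
    using \<delta>[of "(a - 1) / c"] \<delta>[of "(d - 1) / c"] displacement_lwr[OF assms(1), of c] by linarith
qed

end

end

lemma hull_almost_invariant:
  assumes f: "adm B f" and "e > 0"
  shows "\<exists>A\<in>shift_hull f. \<forall>g. det g = 1 \<longrightarrow> g $ 2 $ 1 \<noteq> 0 \<longrightarrow> displacement A g \<le> e"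
proof -
  have B: "B \<ge> 0" using admD(3)[OF f, of 0] by linarith
  define V where "V = vol"
  have V: "V \<ge> 0" by (simp add: V_def)
  \<comment> \<open>\<open>displacement_le\<close> gives the bound
    \<open>2 * \<delta> + 4 * B * \<delta> / k + k * vol\<close>: \<open>k\<close> makes the last
    term at most \<open>e / 4\<close>, and then \<delta> does the same for the other two. With
    \<open>k'\<close> an L2 bound of \<open>\<delta> * k'\<close> becomes a displacement of at most
    \<delta>. The summands \<open>+ 1\<close> cover the case that \<open>vol\<close> or
    \<open>B\<close> is zero.\<close>
  define k where "k = e / (4 * (V + 1))"
  define \<delta> where "\<delta> = min (e / 8) (e * k / (16 * (B + 1)))"
  define k' where "k' = \<delta> / (V + 1)"
  have k: "k > 0" "k * V \<le> e / 4" using V \<open>e > 0\<close> by (auto simp: k_def field_simps)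
  have \<delta>: "\<delta> > 0" "\<delta> \<le> e / 8" using k \<open>e > 0\<close> B unfolding \<delta>_def by (simp, linarith)
  have "4 * B * \<delta> \<le> 4 * B * (e * k / (16 * (B + 1)))" using B by (intro mult_left_mono) (auto simp: \<delta>_def)
  also have "\<dots> \<le> e * k / 4" using B k \<open>e > 0\<close> by (simp add: field_simps)
  finally have \<delta>2: "4 * B * \<delta> / k \<le> e / 4" using k by (simp add: field_simps)
  have k': "k' > 0" "k' * V \<le> \<delta>" using V \<delta> by (auto simp: k'_def field_simps)
  obtain A where A: "A \<in> shift_hull f" "\<And>s. (\<integral>M. (A (M ** upr s) - A M)\<^sup>2 \<partial>nu) \<le> \<delta> * k'"
    using hull_near_invariant[OF f, of "\<delta> * k'"] \<delta> k' by auto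
  note adm = hull_adm[OF A(1) f]
  note [measurable] = admD(1)[OF adm]
  have "displacement A (upr s) \<le> \<delta>" for s
  proof -
    have "displacement A (upr s) \<le> ((\<integral>M. (A (M ** upr s) - A M)\<^sup>2 \<partial>nu) / k' + k' * vol) / 2"
      unfolding displacement_def
    proof (rule L1_le_L2[where B = "2 * B"])
      fix M show "\<bar>A (M ** upr s) - A M\<bar> \<le> 2 * B"
        using admD(3)[OF adm, of M] admD(3)[OF adm, of "M ** upr s"] by linarith
    qed (use k' in auto)
    moreover have "(\<integral>M. (A (M ** upr s) - A M)\<^sup>2 \<partial>nu) / k' \<le> \<delta>"
      using A(2)[of s] k' by (simp add: divide_le_eq)
    ultimately show ?thesis using k' by (simp add: V_def)
  qed
  then have "displacement A g \<le> 2 * \<delta> + (4 * B * \<delta> / k + k * vol)" if "det g = 1" "g $ 2 $ 1 \<noteq> 0" for g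
    using displacement_le[OF adm _ k(1) that] by blast
  then have "displacement A g \<le> e" if "det g = 1" "g $ 2 $ 1 \<noteq> 0" for g
    using that \<delta> \<delta>2 k by (fastforce simp: V_def)
  then show ?thesis using A(1) by blast
qed

text \<open>An almost invariant function is almost constant: integrate \<open>|A m - A (m g)|\<close> over \<open>g\<close> against a
  strictly positive integrable weight and substitute \<open>m' = m g\<close>.\<close>

lemma hull_small:
  assumes f: "adm B f" and mean: "(\<integral>M. f M \<partial>nu) = 0" and "e > 0"
  shows "\<exists>A\<in>shift_hull f. (\<integral>M. \<bar>A M\<bar> \<partial>nu) \<le> e"
proof (cases "vol = 0")
  case True
  have "(\<integral>M. \<bar>f M\<bar> \<partial>nu) \<le> (\<integral>M. B \<partial>nu)"
    using admD[OF f] by (intro integral_mono) auto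
  then show ?thesis using True \<open>e > 0\<close> by (intro bexI[of _ f] shift_hull.base) auto
next
  case False
  then have V: "vol > 0" using measure_nonneg[of nu UNIV] by linarith
  have B: "B \<ge> 0" using admD(3)[OF f, of 0] by linarith
  obtain w :: "real^2^2 \<Rightarrow> real" where w[measurable]: "w \<in> borel_measurable haar"
    and w': "\<And>x. w x > 0" "\<And>x. w x \<le> 1" "integrable haar w"
    using haar.obtain_positive_integrable_function by metis
  have [measurable]: "w \<in> borel_measurable borel" using w by simp
  define W where "W = (\<integral>x. w x \<partial>haar)"
  have W: "W \<ge> 0" unfolding W_def using w' by (intro integral_nonneg_AE) (auto intro: less_imp_le)
  interpret nn: finite_measure "nu \<Otimes>\<^sub>M nu" by (intro finite_measure_pair_measure) unfold_locales
  \<comment> \<open>The weight has no positive lower bound, so the pairs where it is small are set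
    aside and estimated by the trivial bound \<open>2 * B\<close>. The sets \<open>E n\<close>
    involve only \<open>w\<close>, hence \<open>n\<close> can be fixed before \<open>A\<close> is
    chosen.\<close>
  define E where "E n = {z. w (adj2 (fst z) ** snd z) < 1 / real (Suc n)}" for n
  have E_sets [measurable]: "E n \<in> sets (nu \<Otimes>\<^sub>M nu)" for n
  proof -
    have "E n = {z \<in> space (nu \<Otimes>\<^sub>M nu). w (adj2 (fst z) ** snd z) < 1 / real (Suc n)}"
      by (simp add: E_def space_pair_measure)
    also have "\<dots> \<in> sets (nu \<Otimes>\<^sub>M nu)" by measurable
    finally show ?thesis .
  qed
  have "1 / real (Suc (Suc n)) \<le> 1 / real (Suc n)" for n by (intro frac_le) auto
  then have "decseq E"
    unfolding decseq_Suc_iff E_def by (blast intro: less_le_trans)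
  then have "(\<lambda>n. measure (nu \<Otimes>\<^sub>M nu) (E n)) \<longlonglongrightarrow> measure (nu \<Otimes>\<^sub>M nu) (\<Inter>n. E n)"
    using E_sets by (intro nn.finite_Lim_measure_decseq) auto
  moreover have "(\<Inter>n. E n) = {}"
  proof -
    have "\<exists>n. z \<notin> E n" for z
    proof -
      obtain n where "inverse (real (Suc n)) < w (adj2 (fst z) ** snd z)"
        using reals_Archimedean[OF w'(1)] by blast
      then have "z \<notin> E n" by (simp add: E_def inverse_eq_divide)
      then show ?thesis ..
    qed
    then show ?thesis by blast
  qed
  ultimately have "(\<lambda>n. 2 * B * measure (nu \<Otimes>\<^sub>M nu) (E n)) \<longlonglongrightarrow> 2 * B * 0"
    by (intro tendsto_intros) simp
  then have "\<forall>\<^sub>F n in sequentially. 2 * B * measure (nu \<Otimes>\<^sub>M nu) (E n) < e * vol / 2"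
    by (rule order_tendstoD) (use V \<open>e > 0\<close> in simp)
  then obtain n where n: "2 * B * measure (nu \<Otimes>\<^sub>M nu) (E n) \<le> e * vol / 2"
    by (meson eventually_happens' less_imp_le sequentially_bot)
  \<comment> \<open>Half of \<open>e * vol\<close> is allotted to the complement of
    \<open>E n\<close>, where dividing by the weight costs a factor \<open>Suc n\<close>; the
    \<open>+ 1\<close> covers \<open>W = 0\<close>.\<close>
  define \<delta> where "\<delta> = e * vol / (2 * real (Suc n) * (W + 1))"
  have "N > 0 \<Longrightarrow> v > 0 \<Longrightarrow> e * v / (2 * N * (W + 1)) > 0 \<and>
      N * (W * (e * v / (2 * N * (W + 1)))) \<le> e * v / 2" for N v :: real
    using W \<open>e > 0\<close> by (auto simp: divide_simps intro!: mult_left_mono)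
  from this[OF _ V, of "real (Suc n)"]
  have \<delta>: "\<delta> > 0" "real (Suc n) * (W * \<delta>) \<le> e * vol / 2"
    unfolding \<delta>_def by auto
  obtain A where A: "A \<in> shift_hull f" "\<And>g. det g = 1 \<Longrightarrow> g $ 2 $ 1 \<noteq> 0 \<Longrightarrow> displacement A g \<le> \<delta>"
    using hull_almost_invariant[OF f \<delta>(1)] by blast
  note adm = hull_adm[OF A(1) f]
  note [measurable] = admD(1)[OF adm]
  have dB: "\<bar>A M - A N\<bar> \<le> 2 * B" for M N using admD(3)[OF adm, of M] admD(3)[OF adm, of N] by linarith
  have mean_A: "(\<integral>M. A M \<partial>nu) = 0" using hull_integral[OF A(1) f] mean by simp
  have int_A: "integrable nu A" "integrable nu (\<lambda>M. \<bar>A M\<bar>)"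
    using admD(3)[OF adm] by (auto intro!: integrable_nu_bounded)
  have "(\<integral>\<^sup>+m. (\<integral>\<^sup>+m'. ennreal (w (adj2 m ** m')) * ennreal \<bar>A m - A m'\<bar> \<partial>nu) \<partial>nu) \<le>
      (\<integral>\<^sup>+m. (\<integral>\<^sup>+g. ennreal (w g) * ennreal \<bar>A (m ** g) - A m\<bar> \<partial>haar) \<partial>nu)"
  proof (rule nn_integral_mono_AE)
    show "AE m in nu. (\<integral>\<^sup>+m'. ennreal (w (adj2 m ** m')) * ennreal \<bar>A m - A m'\<bar> \<partial>nu) \<le>
      (\<integral>\<^sup>+g. ennreal (w g) * ennreal \<bar>A (m ** g) - A m\<bar> \<partial>haar)"
      using AE_nu_det
    proof eventually_elim
      case (elim m)
      have "(\<integral>\<^sup>+m'. ennreal (w (adj2 m ** m')) * ennreal \<bar>A m - A m'\<bar> \<partial>nu) \<le>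
        (\<integral>\<^sup>+m'. ennreal (w (adj2 m ** m')) * ennreal \<bar>A m - A m'\<bar> \<partial>haar)"
        by (subst nn_integral_nu) (auto intro!: nn_integral_mono simp: indicator_def)
      also have "\<dots> = (\<integral>\<^sup>+g. ennreal (w (adj2 m ** (m ** g))) * ennreal \<bar>A m - A (m ** g)\<bar> \<partial>haar)"
        by (rule haar_left[OF elim, symmetric]) measurable
      finally show ?case using elim by (simp add: abs_minus_commute)
    qed
  qed
  also have "\<dots> = (\<integral>\<^sup>+g. (\<integral>\<^sup>+m. ennreal (w g) * ennreal \<bar>A (m ** g) - A m\<bar> \<partial>nu) \<partial>haar)"
    by (rule Fubini'[symmetric]) measurable
  \<comment> \<open>For fixed \<open>g\<close> the inner integral is \<open>w g\<close> times the
    displacement of \<open>g\<close>. The matrices with lower left entry 0, for which no bound is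
    available, are null.\<close>
  also have "\<dots> \<le> (\<integral>\<^sup>+g. ennreal (w g * \<delta>) \<partial>haar)"
  proof (rule nn_integral_mono_AE)
    show "AE g in haar. (\<integral>\<^sup>+m. ennreal (w g) * ennreal \<bar>A (m ** g) - A m\<bar> \<partial>nu) \<le> ennreal (w g * \<delta>)"
      using AE_haar_det AE_haar_lower_left
    proof eventually_elim
      case (elim g)
      have "(\<integral>\<^sup>+m. ennreal (w g) * ennreal \<bar>A (m ** g) - A m\<bar> \<partial>nu) = ennreal (w g) * ennreal (displacement A g)"
        unfolding displacement_def by (simp add: nn_integral_cmult nn_integral_eq_integral integrable_displacement[OF adm])
      then show ?case using A(2)[OF elim] w'(1)[of g] \<delta>(1)
        by (auto simp: ennreal_mult intro!: mult_left_mono ennreal_leI)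
    qed
  qed
  also have "\<dots> = ennreal (W * \<delta>)"
    unfolding W_def using w' \<delta>(1) by (subst nn_integral_eq_integral) (auto intro!: AE_I2 mult_nonneg_nonneg less_imp_le)
  finally have Y: "(\<integral>\<^sup>+m. (\<integral>\<^sup>+m'. ennreal (w (adj2 m ** m')) * ennreal \<bar>A m - A m'\<bar> \<partial>nu) \<partial>nu)
      \<le> ennreal (W * \<delta>)" .
  have "ennreal (vol * (\<integral>M. \<bar>A M\<bar> \<partial>nu)) = (\<integral>\<^sup>+m. ennreal (vol * \<bar>A m\<bar>) \<partial>nu)"
    using int_A by (subst nn_integral_eq_integral) auto
  \<comment> \<open>As \<open>A\<close> has mean zero, \<open>vol * A m\<close> is the integral of
    \<open>A m - A m'\<close> over \<open>m'\<close>.\<close>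
  also have "\<dots> \<le> (\<integral>\<^sup>+m. (\<integral>\<^sup>+m'. ennreal \<bar>A m - A m'\<bar> \<partial>nu) \<partial>nu)"
  proof (rule nn_integral_mono)
    fix m
    have i: "integrable nu (\<lambda>m'. \<bar>A m - A m'\<bar>)"
      using dB by (intro integrable_nu_bounded[where B = "2 * B"]) auto
    have "vol * \<bar>A m\<bar> = \<bar>\<integral>m'. A m - A m' \<partial>nu\<bar>"
      using int_A mean_A by (simp add: abs_mult)
    also have "\<dots> \<le> (\<integral>m'. \<bar>A m - A m'\<bar> \<partial>nu)" by (rule integral_abs_bound)
    finally show "ennreal (vol * \<bar>A m\<bar>) \<le> (\<integral>\<^sup>+m'. ennreal \<bar>A m - A m'\<bar> \<partial>nu)"
      using i by (subst nn_integral_eq_integral) auto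
  qed
  also have "\<dots> \<le> (\<integral>\<^sup>+m. (\<integral>\<^sup>+m'. ennreal (2 * B) * indicator (E n) (m, m') +
      ennreal (Suc n) * (ennreal (w (adj2 m ** m')) * ennreal \<bar>A m - A m'\<bar>) \<partial>nu) \<partial>nu)"
  proof (intro nn_integral_mono)
    fix m m'
    show "ennreal \<bar>A m - A m'\<bar> \<le> ennreal (2 * B) * indicator (E n) (m, m') +
      ennreal (Suc n) * (ennreal (w (adj2 m ** m')) * ennreal \<bar>A m - A m'\<bar>)"
    proof (cases "(m, m') \<in> E n")
      case True
      then show ?thesis using dB by (auto intro!: add_increasing2 ennreal_leI)
    next
      case False
      then have "1 \<le> real (Suc n) * w (adj2 m ** m')" by (simp add: E_def field_simps)
      then have "1 * \<bar>A m - A m'\<bar> \<le> (real (Suc n) * w (adj2 m ** m')) * \<bar>A m - A m'\<bar>"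
        by (intro mult_right_mono) auto
      then show ?thesis
        using False w'(1)[of "adj2 m ** m'"]
        by (simp add: ennreal_mult[symmetric] mult.assoc ennreal_leI del: of_nat_Suc)
    qed
  qed
  also have "\<dots> = ennreal (2 * B) * emeasure (nu \<Otimes>\<^sub>M nu) (E n) +
      ennreal (Suc n) * (\<integral>\<^sup>+m. (\<integral>\<^sup>+m'. ennreal (w (adj2 m ** m')) * ennreal \<bar>A m - A m'\<bar> \<partial>nu) \<partial>nu)"
    by (simp add: nn_integral_add nn_integral_cmult nu.nn_integral_fst nn_integral_indicator[OF E_sets])
  also have "\<dots> \<le> ennreal (2 * B) * emeasure (nu \<Otimes>\<^sub>M nu) (E n) + ennreal (Suc n) * ennreal (W * \<delta>)"
    by (intro add_left_mono mult_left_mono Y) auto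
  also have "\<dots> =
      ennreal (2 * B * measure (nu \<Otimes>\<^sub>M nu) (E n) + real (Suc n) * (W * \<delta>))"
    using B W \<delta>(1) by (simp add: nn.emeasure_eq_measure ennreal_mult ennreal_plus del: of_nat_Suc)
  also have "\<dots> \<le> ennreal (e * vol)" using n \<delta>(2) by (intro ennreal_leI) linarith
  finally have "vol * (\<integral>M. \<bar>A M\<bar> \<partial>nu) \<le> e * vol"
    using V \<open>e > 0\<close> by (simp add: ennreal_le_iff)
  then have "(\<integral>M. \<bar>A M\<bar> \<partial>nu) \<le> e" using V by (simp add: mult.commute)
  then show ?thesis using A(1) by blast
qed

end

section \<open>Horocycle pieces\<close>

definition geo :: "real \<Rightarrow> real^2^2" where
  "geo t = mat2 (exp (- t / 2)) 0 0 (exp (t / 2))"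

abbreviation low :: "real \<Rightarrow> real \<Rightarrow> real^2^2" where
  "low c d \<equiv> mat2 (1 / d) 0 c d"

lemma exp_half_mult [simp]: "exp (t / 2) * exp (t / 2) = exp (t :: real)" "exp (- (t / 2)) * exp (t / 2) = 1"
  "exp (t / 2) * exp (- (t / 2)) = 1" "exp (- (t / 2)) * exp (- (t / 2)) = exp (- t)"
proof -
  have "exp (t / 2) * exp (- (t / 2)) = exp (t / 2 + - (t / 2))" by (rule exp_add[symmetric])
  then show "exp (t / 2) * exp (- (t / 2)) = 1" "exp (- (t / 2)) * exp (t / 2) = 1"
    by (simp_all add: mult.commute)
  have "exp (t / 2) * exp (t / 2) = exp (t / 2 + t / 2)"
    "exp (- (t / 2)) * exp (- (t / 2)) = exp (- (t / 2) + - (t / 2))" by (rule exp_add[symmetric])+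
  then show "exp (t / 2) * exp (t / 2) = exp t" "exp (- (t / 2)) * exp (- (t / 2)) = exp (- t)"
    by simp_all
qed

lemma det_geo [simp]: "det (geo t) = 1"
  by (simp add: geo_def)

lemma chart_eq: "chart (c, d, u) = upr u ** low c d"
  by (simp add: chart_def)

lemma low_geo_lwr: "d \<noteq> 0 \<Longrightarrow> low c d ** geo t = low 0 d ** geo t ** lwr (c / d * exp (- t))"
  by (simp add: geo_def mult_ac) (simp flip: exp_add)

text \<open>The flow expands the horocycle direction: a step \<open>s\<close> after the flow is a
  step of order \<open>exp (- t)\<close> before it, hence a mere shift of the variable of
  integration.\<close>

lemma low_geo_upr: "d \<noteq> 0 \<Longrightarrow> low 0 d ** geo t ** upr s = upr (s * exp (- t) / d\<^sup>2) ** (low 0 d ** geo t)"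
  by (simp add: geo_def power2_eq_square mult_ac) (simp flip: exp_add)

lemma low_geo_commute: "low 0 d ** geo t = geo t ** low 0 d"
  by (simp add: geo_def)

lemma integrable_window:
  fixes X :: "real \<Rightarrow> real"
  assumes "X \<in> borel_measurable borel" and "\<And>u. \<bar>X u\<bar> \<le> B"
  shows "integrable lborel (\<lambda>u. indicator {a..<b} u * X u)"
  using integrableI_bounded_set_indicator[of "{a..<b}" lborel X B] assms
  by (cases "a \<le> b") auto

lemma integral_window_diff_le:
  fixes X Y :: "real \<Rightarrow> real"
  assumes [measurable]: "X \<in> borel_measurable borel" "Y \<in> borel_measurable borel"
    and B: "\<And>u. \<bar>X u\<bar> \<le> B" "\<And>u. \<bar>Y u\<bar> \<le> B" and e: "\<And>u. \<bar>X u - Y u\<bar> \<le> e"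
    and pq: "p \<le> q" "q \<le> p + 1"
  shows "\<bar>(\<integral>u. indicator {p..<q} u * X u \<partial>lborel) - (\<integral>u. indicator {p..<q} u * Y u \<partial>lborel)\<bar> \<le> e"
proof -
  have e0: "e \<ge> 0" using e[of 0] by linarith
  have "\<bar>(\<integral>u. indicator {p..<q} u * X u \<partial>lborel) - (\<integral>u. indicator {p..<q} u * Y u \<partial>lborel)\<bar> =
      \<bar>\<integral>u. indicator {p..<q} u * (X u - Y u) \<partial>lborel\<bar>"
    using integrable_window[OF assms(1) B(1)] integrable_window[OF assms(2) B(2)] by (simp add: right_diff_distrib)
  also have "\<dots> \<le> (\<integral>u. \<bar>indicator {p..<q} u * (X u - Y u)\<bar> \<partial>lborel)"
    by (rule integral_abs_bound)
  also have "\<dots> \<le> (\<integral>u. indicator {p..<q} u * e \<partial>lborel)"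
  proof (rule integral_mono)
    show "integrable lborel (\<lambda>u. \<bar>indicator {p..<q} u * (X u - Y u)\<bar>)"
      by (intro integrable_abs integrable_window[where B = e] e) measurable
    show "integrable lborel (\<lambda>u. indicator {p..<q} u * e)" using pq by simp
    show "\<bar>indicator {p..<q} u * (X u - Y u)\<bar> \<le> indicator {p..<q} u * e" for u
      using e[of u] by (simp add: indicator_def)
  qed
  also have "\<dots> = (q - p) * e" using pq by simp
  also have "\<dots> \<le> e" using pq e0 mult_right_mono[of "q - p" 1 e] by simp
  finally show ?thesis .
qed

text \<open>The window and its translate differ only between an endpoint and its translate, on
  intervals of length at most the absolute value of \<open>s\<close>.\<close>

lemma integral_window_shift_le:
  fixes X :: "real \<Rightarrow> real"
  assumes [measurable]: "X \<in> borel_measurable borel"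
    and B: "\<And>u. \<bar>X u\<bar> \<le> B" and pq: "p \<le> q"
  shows "\<bar>(\<integral>u. indicator {p..<q} u * X (u + s) \<partial>lborel) - (\<integral>u. indicator {p..<q} u * X u \<partial>lborel)\<bar> \<le> 2 * B * \<bar>s\<bar>"
proof -
  have B0: "B \<ge> 0" using B[of 0] by linarith
  define J where "J r = {min r (r + s)..max r (r + s)}" for r
  have J: "measure lborel (J r) = \<bar>s\<bar>" "emeasure lborel (J r) < \<infinity>" for r
    by (auto simp: J_def min_def max_def)
  have [measurable]: "J r \<in> sets borel" for r by (simp add: J_def)
  note int = integrable_window[OF assms(1) B]
  have "(\<integral>u. indicator {p + s..<q + s} u * X u \<partial>lborel) =
      (\<integral>u. indicator {p + s..<q + s} (s + 1 * u) * X (s + 1 * u) \<partial>lborel)"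
    using lborel_integral_real_affine[of 1 "\<lambda>u. indicator {p + s..<q + s} u * X u" s] by simp
  also have "\<dots> = (\<integral>u. indicator {p..<q} u * X (u + s) \<partial>lborel)"
    by (intro Bochner_Integration.integral_cong) (auto simp: indicator_def add.commute)
  finally have "\<bar>(\<integral>u. indicator {p..<q} u * X (u + s) \<partial>lborel) - (\<integral>u. indicator {p..<q} u * X u \<partial>lborel)\<bar> =
      \<bar>\<integral>u. indicator {p + s..<q + s} u * X u - indicator {p..<q} u * X u \<partial>lborel\<bar>"
    using int by simp
  also have "\<dots> \<le> (\<integral>u. \<bar>indicator {p + s..<q + s} u * X u - indicator {p..<q} u * X u\<bar> \<partial>lborel)"
    by (rule integral_abs_bound)
  also have "\<dots> \<le> (\<integral>u. B * indicator (J p) u + B * indicator (J q) u \<partial>lborel)"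
  proof (rule integral_mono)
    show "integrable lborel (\<lambda>u. \<bar>indicator {p + s..<q + s} u * X u - indicator {p..<q} u * X u\<bar>)"
      using int by auto
    show "integrable lborel (\<lambda>u. B * indicator (J p) u + B * indicator (J q) u)" using J by auto
    fix u
    have "\<bar>indicator {p + s..<q + s} u * X u - indicator {p..<q} u * X u\<bar> =
        \<bar>indicator {p + s..<q + s} u - indicator {p..<q} u\<bar> * \<bar>X u\<bar>"
      by (simp add: abs_mult[symmetric] left_diff_distrib)
    also have "\<dots> \<le> (indicator (J p) u + indicator (J q) u) * B"
      using B[of u] by (intro mult_mono) (auto simp: indicator_def J_def)
    finally show "\<bar>indicator {p + s..<q + s} u * X u - indicator {p..<q} u * X u\<bar> \<le> B * indicator (J p) u + B * indicator (J q) u"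
      by (simp add: algebra_simps)
  qed
  also have "\<dots> = 2 * B * \<bar>s\<bar>" using J by simp
  finally show ?thesis .
qed

context lattice
begin

text \<open>Windows of length at most 1, half-open, contain no two points that differ by a nonzero
  integer; \<open>window_inj\<close> needs this, as \<Lambda> may contain integer
  translations.\<close>

context
  fixes p q :: real
  assumes pq: "p \<le> q" "q \<le> p + 1"
begin

text \<open>The integral of interest is the one with \<open>c = 0\<close> and \<open>d = 1\<close>;
  the other values of \<open>c\<close> and \<open>d\<close> give the neighbouring pieces that fill
  the box.\<close>

definition horo :: "(real^2^2 \<Rightarrow> real) \<Rightarrow> real \<Rightarrow> real \<Rightarrow> real \<Rightarrow> real" where
  "horo A c d t = (\<integral>u. indicator {p..<q} u * A (upr u ** (low c d ** geo t)) \<partial>lborel)"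

lemma ruc_lwr:
  assumes "ruc A" "e > 0"
  shows "\<exists>r>0. \<forall>x M. \<bar>x\<bar> < r \<longrightarrow> det M = 1 \<longrightarrow> \<bar>A (M ** lwr x) - A M\<bar> < e"
proof -
  have "((\<lambda>v. lwr v) \<longlongrightarrow> lwr 0) (nhds 0)" by (intro tendsto_intros filterlim_ident)
  then have lim: "filterlim (\<lambda>v. lwr v) (nhds (mat 1)) (nhds 0)" by (simp add: mat_1_eq_mat2)
  have "\<forall>\<^sub>F h in nhds (mat 1). det h = 1 \<longrightarrow> (\<forall>M. det M = 1 \<longrightarrow> \<bar>A (M ** h) - A M\<bar> < e)"
    using assms by (simp add: ruc_def)
  from eventually_compose_filterlim[OF this lim]
  obtain r where "r > 0" "\<And>x. dist x 0 < r \<Longrightarrow> det (lwr x) = 1 \<longrightarrow> (\<forall>M. det M = 1 \<longrightarrow> \<bar>A (M ** lwr x) - A M\<bar> < e)"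
    unfolding eventually_nhds_metric by blast
  then show ?thesis by (intro exI[of _ r]) (auto simp: dist_real_def)
qed

lemma ruc_low:
  assumes "ruc A" "e > 0"
  shows "\<exists>r>0. \<forall>d M. \<bar>d - 1\<bar> < r \<longrightarrow> d \<noteq> 0 \<longrightarrow> det M = 1 \<longrightarrow> \<bar>A (M ** low 0 d) - A M\<bar> < e"
proof -
  have "((\<lambda>d. low 0 d) \<longlongrightarrow> low 0 1) (nhds 1)" by (intro tendsto_intros filterlim_ident) auto
  then have lim: "filterlim (\<lambda>d. low 0 d) (nhds (mat 1)) (nhds 1)" by (simp add: mat_1_eq_mat2)
  have "\<forall>\<^sub>F h in nhds (mat 1). det h = 1 \<longrightarrow> (\<forall>M. det M = 1 \<longrightarrow> \<bar>A (M ** h) - A M\<bar> < e)"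
    using assms by (simp add: ruc_def)
  from eventually_compose_filterlim[OF this lim]
  obtain r where "r > 0" "\<And>d. dist d 1 < r \<Longrightarrow> det (low 0 d) = 1 \<longrightarrow> (\<forall>M. det M = 1 \<longrightarrow> \<bar>A (M ** low 0 d) - A M\<bar> < e)"
    unfolding eventually_nhds_metric by blast
  then show ?thesis by (intro exI[of _ r]) (auto simp: dist_real_def)
qed

lemma horo_low:
  assumes A: "adm B A" and "e > 0"
  shows "\<forall>\<^sub>F t in at_top. \<forall>c\<in>{0..1/2}. \<forall>d\<in>{1..3/2}. \<bar>horo A c d t - horo A 0 d t\<bar> \<le> e"
proof -
  note [measurable] = admD(1)[OF A]
  obtain r where r: "r > 0" "\<And>x M. \<bar>x\<bar> < r \<Longrightarrow> det M = 1 \<Longrightarrow> \<bar>A (M ** lwr x) - A M\<bar> < e"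
    using ruc_lwr[OF admD(4)[OF A] \<open>e > 0\<close>] by blast
  have "((\<lambda>t. exp (- t)) \<longlongrightarrow> (0::real)) at_top"
    by (rule filterlim_compose[OF exp_at_bot filterlim_uminus_at_bot_at_top])
  then have "\<forall>\<^sub>F t in at_top. exp (- t) < r" by (rule order_tendstoD) fact
  then show ?thesis
  proof (eventually_elim, intro ballI)
    fix t c d :: real assume t: "exp (- t) < r" and cd: "c \<in> {0..1/2}" "d \<in> {1..3/2}"
    have "c / d \<le> 1" using cd by (simp add: divide_le_eq)
    then have "\<bar>c / d * exp (- t)\<bar> \<le> exp (- t)" using cd mult_right_mono[of "c / d" 1 "exp (- t)"] by simp
    then have small: "\<bar>c / d * exp (- t)\<bar> < r" using t by linarith
    show "\<bar>horo A c d t - horo A 0 d t\<bar> \<le> e"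
      unfolding horo_def
    proof (rule integral_window_diff_le[OF _ _ admD(3)[OF A] admD(3)[OF A] _ pq])
      fix u
      have "det (upr u ** (low 0 d ** geo t)) = 1" using cd by (simp add: det_mul del: mat2_mult)
      from r(2)[OF small this]
      show "\<bar>A (upr u ** (low c d ** geo t)) - A (upr u ** (low 0 d ** geo t))\<bar> \<le> e"
        using cd by (subst low_geo_lwr) (auto simp: matrix_mul_assoc[symmetric] simp del: mat2_mult)
    qed measurable
  qed
qed

lemma horo_shift:
  assumes A: "adm B A" and d: "d \<ge> 1"
  shows "\<bar>horo (\<lambda>M. A (M ** upr s)) 0 d t - horo A 0 d t\<bar> \<le> 2 * B * (\<bar>s\<bar> * exp (- t))"
proof -
  note [measurable] = admD(1)[OF A]
  have B: "B \<ge> 0" using admD(3)[OF A, of 0] by linarith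
  define s' where "s' = s * exp (- t) / d\<^sup>2"
  have "1 \<le> d\<^sup>2" using d by simp
  then have "\<bar>s'\<bar> \<le> \<bar>s\<bar> * exp (- t)"
    using mult_left_mono[of 1 "d\<^sup>2" "\<bar>s\<bar> * exp (- t)"] d
    by (simp add: s'_def abs_mult divide_le_eq)
  then have le: "2 * B * \<bar>s'\<bar> \<le> 2 * B * (\<bar>s\<bar> * exp (- t))" using B by (intro mult_left_mono) auto
  have eq: "upr u ** (low 0 d ** geo t) ** upr s = upr (u + s') ** (low 0 d ** geo t)" for u
  proof -
    have "upr u ** (low 0 d ** geo t) ** upr s = upr u ** (upr s' ** (low 0 d ** geo t))"
      using d low_geo_upr[of d t s] by (simp add: matrix_mul_assoc[symmetric] s'_def del: mat2_mult)
    also have "\<dots> = upr (u + s') ** (low 0 d ** geo t)"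
      by (simp add: matrix_mul_assoc algebra_simps)
    finally show ?thesis .
  qed
  show ?thesis
    unfolding horo_def eq
    by (rule order_trans[OF integral_window_shift_le le]) (use pq admD(3)[OF A] in auto)
qed

text \<open>For a translate the comparison passes through \<open>c = 0\<close>, where the flow turns
  the translation exactly into a shift along the window. The time from which the bound holds depends
  on \<open>A\<close> but not on \<open>c\<close> and \<open>d\<close>.\<close>

lemma horo_hull:
  assumes "A \<in> shift_hull f" and f: "adm B f" and "e > 0"
  shows "\<forall>\<^sub>F t in at_top. \<forall>c\<in>{0..1/2}. \<forall>d\<in>{1..3/2}. \<bar>horo A c d t - horo f c d t\<bar> \<le> e"
  using assms(1,3)
proof (induction arbitrary: e rule: shift_hull.induct)
  case base
  then show ?case by simp
next
  case (shift A s)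
  have A: "adm B A" and As: "adm B (\<lambda>M. A (M ** upr s))"
    using hull_adm[OF shift.hyps f] adm_right[of B A "upr s"] by auto
  \<comment> \<open>Four errors are added: dropping \<open>c\<close> for the translate, undoing the
    translation, restoring \<open>c\<close> for \<open>A\<close>, and the induction
    hypothesis.\<close>
  have e: "e / 4 > 0" using shift.prems by simp
  have "((\<lambda>t. exp (- t)) \<longlongrightarrow> (0::real)) at_top"
    by (rule filterlim_compose[OF exp_at_bot filterlim_uminus_at_bot_at_top])
  then have "((\<lambda>t. 2 * B * (\<bar>s\<bar> * exp (- t))) \<longlongrightarrow> 2 * B * (\<bar>s\<bar> * 0)) at_top"
    by (intro tendsto_intros)
  then have "\<forall>\<^sub>F t in at_top. 2 * B * (\<bar>s\<bar> * exp (- t)) < e / 4"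
    by (rule order_tendstoD) (use e in simp)
  with horo_low[OF A e] horo_low[OF As e] shift.IH[OF e]
  show ?case
  proof eventually_elim
    case (elim t)
    show ?case
    proof (intro ballI)
      fix c d :: real assume cd: "c \<in> {0..1/2}" "d \<in> {1..3/2}"
      show "\<bar>horo (\<lambda>M. A (M ** upr s)) c d t - horo f c d t\<bar> \<le> e"
      using elim(1)[rule_format, OF cd] elim(2)[rule_format, OF cd]
        elim(3)[rule_format, OF cd] elim(4) horo_shift[OF A, of d s t] cd(2)
      by (simp only: atLeastAtMost_iff) argo
    qed
  qed
next
  case (mid A A')
  have A: "adm B A" "adm B A'" using hull_adm[OF _ f] mid.hyps by auto
  note [measurable] = admD(1)[OF A(1)] admD(1)[OF A(2)]
  have int: "integrable lborel (\<lambda>u. indicator {p..<q} u * Z (upr u ** (low c d ** geo t)))"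
    if Z: "adm B Z" for Z c d t
  proof -
    note [measurable] = admD(1)[OF Z]
    show ?thesis
      by (rule integrable_window[where B = B]) (use admD(3)[OF Z] in auto)
  qed
  have eq: "horo (\<lambda>M. (A M + A' M) / 2) c d t = (horo A c d t + horo A' c d t) / 2" for c d t
  proof -
    have "horo (\<lambda>M. (A M + A' M) / 2) c d t = (\<integral>u. (indicator {p..<q} u * A (upr u ** (low c d ** geo t)) +
        indicator {p..<q} u * A' (upr u ** (low c d ** geo t))) / 2 \<partial>lborel)"
      unfolding horo_def by (intro Bochner_Integration.integral_cong refl) (simp add: field_simps del: mat2_mult)
    also have "\<dots> = (horo A c d t + horo A' c d t) / 2"
      unfolding horo_def using int[OF A(1)] int[OF A(2)]
      by (subst Bochner_Integration.integral_divide_zero, subst Bochner_Integration.integral_add) (simp_all del: mat2_mult)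
    finally show ?thesis .
  qed
  show ?case
    using mid.IH(1)[OF mid.prems] mid.IH(2)[OF mid.prems]
  proof eventually_elim
    case (elim t)
    show ?case
    proof (intro ballI)
      fix c d :: real assume cd: "c \<in> {0..1/2}" "d \<in> {1..3/2}"
      show "\<bar>horo (\<lambda>M. (A M + A' M) / 2) c d t - horo f c d t\<bar> \<le> e"
        using elim(1)[rule_format, OF cd] elim(2)[rule_format, OF cd]
        unfolding eq abs_le_iff by argo
    qed
  qed
qed

text \<open>Diagonal matrices commute with the flow and are not contracted by it, so only uniform
  continuity of \<open>f\<close> allows \<open>d\<close> to vary, and only in a range \<eta>
  depending on \<open>f\<close> and \<open>e\<close>.\<close>

lemma horo_dgl:
  assumes f: "adm B f" and "e > 0"
  shows "\<exists>\<eta>>0. \<eta> \<le> 1 / 2 \<and>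
    (\<forall>\<^sub>F t in at_top. \<forall>c\<in>{0..1/2}. \<forall>d\<in>{1..1 + \<eta>}. \<bar>horo f c d t - horo f 0 1 t\<bar> \<le> e)"
proof -
  note [measurable] = admD(1)[OF f]
  obtain r where r: "r > 0" "\<And>d M. \<bar>d - 1\<bar> < r \<Longrightarrow> d \<noteq> 0 \<Longrightarrow> det M = 1 \<Longrightarrow> \<bar>f (M ** low 0 d) - f M\<bar> < e / 2"
    using ruc_low[OF admD(4)[OF f] half_gt_zero[OF \<open>e > 0\<close>]] by blast
  define \<eta> where "\<eta> = min (r / 2) (1 / 2)"
  have \<eta>: "\<eta> > 0" "\<eta> \<le> 1 / 2" "\<eta> < r" using r(1) by (auto simp: \<eta>_def)
  have "\<forall>\<^sub>F t in at_top. \<forall>c\<in>{0..1/2}. \<forall>d\<in>{1..3/2}. \<bar>horo f c d t - horo f 0 d t\<bar> \<le> e / 2"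
    using horo_low[OF f, of "e / 2"] \<open>e > 0\<close> by simp
  then have "\<forall>\<^sub>F t in at_top. \<forall>c\<in>{0..1/2}. \<forall>d\<in>{1..1 + \<eta>}. \<bar>horo f c d t - horo f 0 1 t\<bar> \<le> e"
  proof (eventually_elim, intro ballI)
    fix t c d :: real
    assume elim: "\<forall>c\<in>{0..1/2}. \<forall>d\<in>{1..3/2}. \<bar>horo f c d t - horo f 0 d t\<bar> \<le> e / 2"
      "c \<in> {0..1/2}" "d \<in> {1..1 + \<eta>}"
    have "\<bar>horo f 0 d t - horo f 0 1 t\<bar> \<le> e / 2"
      unfolding horo_def
    proof (rule integral_window_diff_le[OF _ _ admD(3)[OF f] admD(3)[OF f] _ pq])
      fix u
      have det: "det (upr u ** geo t) = 1" by (simp add: det_mul del: mat2_mult)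
      have "low 0 1 = mat 1" by (simp add: mat_1_eq_mat2)
      then have eq: "upr u ** (low 0 1 ** geo t) = upr u ** geo t" by simp
      have eq2: "upr u ** (low 0 d ** geo t) = upr u ** geo t ** low 0 d"
        by (simp add: low_geo_commute matrix_mul_assoc[symmetric] del: mat2_mult)
      have "\<bar>d - 1\<bar> < r" "d \<noteq> 0" using elim(3) \<eta>(3) by auto
      from r(2)[OF this det]
      show "\<bar>f (upr u ** (low 0 d ** geo t)) - f (upr u ** (low 0 1 ** geo t))\<bar> \<le> e / 2"
        unfolding eq eq2 by linarith
    qed measurable
    moreover have "\<bar>horo f c d t - horo f 0 d t\<bar> \<le> e / 2" using elim \<eta> by simp
    ultimately show "\<bar>horo f c d t - horo f 0 1 t\<bar> \<le> e" by linarith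
  qed
  then show ?thesis using \<eta> by blast
qed

text \<open>The numbers are dictated by \<open>window_inj\<close>: for two points of the box the
  products \<open>c' * d\<close> and \<open>d' * c\<close> lie between 0 and 3/4, and the quotient
  \<open>d' / d\<close> is below 2.\<close>

definition window :: "(real^2^2) set" where
  "window = {M. det M = 1 \<and> 0 \<le> M$2$1 \<and> M$2$1 \<le> 1/2 \<and> 1 \<le> M$2$2 \<and> M$2$2 \<le> 3/2 \<and>
     p \<le> M$1$2 / M$2$2 \<and> M$1$2 / M$2$2 < q}"

lemma window_borel [measurable]: "window \<in> sets borel"
  unfolding window_def by measurable

lemma chart_in_window:
  "\<lbrakk>c \<in> {0..1/2}; d \<in> {1..3/2}; u \<in> {p..<q}\<rbrakk> \<Longrightarrow> chart (c, d, u) \<in> window"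
  using det_chart[of d c u] by (simp add: window_def chart_def)

text \<open>The entries of \<open>A\<close> are integers. The lower left one,
  \<open>c' * d - d' * c\<close>, is less than 1 in absolute value, so it vanishes. Then the bottom
  rows are proportional by the lower right entry, an integer strictly between 0 and 2. With equal
  bottom rows the upper right entry is the difference of two points of the window, again less than
  1.\<close>

lemma window_inj:
  assumes A: "A \<in> Lam" and M: "M \<in> window" and AM: "A ** M \<in> window"
  shows "A = mat 1"
proof -
  obtain a b c d where Meq: "M = mat2 a b c d" by (rule mat2_cases)
  obtain a' b' c' d' where M'eq: "A ** M = mat2 a' b' c' d'" by (rule mat2_cases)
  have w: "a * d - b * c = 1" "0 \<le> c" "c \<le> 1/2" "1 \<le> d" "d \<le> 3/2" "p \<le> b / d" "b / d < q"
    using M by (simp_all add: window_def Meq)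
  have w': "a' * d' - b' * c' = 1" "0 \<le> c'" "c' \<le> 1/2" "1 \<le> d'" "d' \<le> 3/2" "p \<le> b' / d'" "b' / d' < q"
    using AM by (simp_all add: window_def M'eq)
  have "det M = 1" using w(1) by (simp add: Meq)
  then have "A = (A ** M) ** adj2 M" by simp
  then have Aeq: "A = mat2 (a' * d - b' * c) (b' * a - a' * b) (c' * d - d' * c) (d' * a - c' * b)"
    unfolding M'eq by (simp add: Meq mult.commute)
  have int0: "x = 0" if "x \<in> \<int>" "\<bar>x\<bar> < 1" for x :: real using that by (metis Ints_nonzero_abs_less1)
  have Z: "a' * d - b' * c \<in> \<int>" "b' * a - a' * b \<in> \<int>" "c' * d - d' * c \<in> \<int>" "d' * a - c' * b \<in> \<int>"
    using Lam_int[OF A, of 1 1] Lam_int[OF A, of 1 2] Lam_int[OF A, of 2 1] Lam_int[OF A, of 2 2]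
    by (simp_all add: Aeq)
  have "0 \<le> c' * d" "c' * d \<le> 1/2 * (3/2)" "0 \<le> d' * c" "d' * c \<le> 3/2 * (1/2)"
    using w w' by (auto intro!: mult_mono mult_nonneg_nonneg simp del: times_divide_eq_left times_divide_eq_right)
  then have "\<bar>c' * d - d' * c\<bar> < 1" by linarith
  from int0[OF Z(3) this] have cd: "c' * d = d' * c" by simp
  have dA: "d * (d' * a - c' * b) = d'"
  proof -
    have "d * (d' * a - c' * b) = d' * (a * d) - b * (c' * d)" by (simp add: algebra_simps)
    also have "\<dots> = d' * (a * d - b * c)" by (simp add: cd algebra_simps)
    finally show ?thesis using w(1) by simp
  qed
  define k where "k = d' * a - c' * b"
  have k: "d * k = d'" using dA by (simp add: k_def)
  have "k < 2"
  proof (rule ccontr)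
    assume "\<not> k < 2"
    then have "1 * 2 \<le> d * k" using w by (intro mult_mono) auto
    then show False using k w' by simp
  qed
  moreover have "k > 0" using k w w' by (metis less_le_trans less_numeral_extra(1) zero_less_mult_pos)
  ultimately have "k - 1 = 0" using Z(4) by (intro int0) (auto simp: k_def[symmetric])
  then have eq: "d' = d" "c' = c" using k cd w by auto
  have "d * (b' * a - a' * b) = b' * (a * d - b * c) - b * (a' * d' - b' * c')"
    unfolding eq by (simp add: algebra_simps)
  also have "\<dots> = b' - b" using w w' by simp
  finally have "b' * a - a' * b = b' / d - b / d" using w by (simp add: field_simps)
  moreover have "\<bar>b' / d - b / d\<bar> < 1" using w(6,7) w'(6,7) pq unfolding eq by linarith
  ultimately have "b' * a - a' * b = 0" using int0[OF Z(2)] by simp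
  moreover have "a' * d - b' * c = 1" using w' eq by simp
  moreover have "d' * a - c' * b = 1" using w eq by (simp add: mult.commute)
  ultimately show ?thesis using cd by (simp add: Aeq mat_1_eq_mat2)
qed

lemma window_integral_le:
  assumes [measurable]: "f \<in> borel_measurable borel" and f: "invar f"
  shows "(\<integral>\<^sup>+M. indicator window M * f M \<partial>haar) \<le> (\<integral>\<^sup>+M. f M \<partial>nu)"
proof -
  have "(\<integral>\<^sup>+M. indicator window M * f M \<partial>haar) =
      (\<integral>\<^sup>+M. (\<integral>\<^sup>+A. indicator window (A ** M) * f (A ** M) \<partial>count_space Lam) \<partial>nu)"
    by (rule unfolding_nn) measurable
  also have "\<dots> \<le> (\<integral>\<^sup>+M. f M \<partial>nu)"
  proof (rule nn_integral_mono_AE)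
    show "AE M in nu. (\<integral>\<^sup>+A. indicator window (A ** M) * f (A ** M) \<partial>count_space Lam) \<le> f M"
      using AE_nu_det
    proof eventually_elim
      case (elim M)
      define X where "X = {A \<in> Lam. A ** M \<in> window}"
      have X: "A = A'" if "A \<in> X" "A' \<in> X" for A A'
      proof -
        \<comment> \<open>This element of \<open>Lam\<close> carries \<open>A ** M\<close> to
          \<open>A' ** M\<close>, both in the box.\<close>
        have "A' ** adj2 A = mat 1"
          using that Lam_det
          by (intro window_inj[of _ "A ** M"]) (auto simp: X_def Lam_mult Lam_adj matrix_mul_assoc)
        then have "A' ** adj2 A ** A = mat 1 ** A" by simp
        then show ?thesis using that Lam_det by (simp add: X_def)
      qed
      have "(\<integral>\<^sup>+A. indicator window (A ** M) * f (A ** M) \<partial>count_space Lam) =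
          (\<integral>\<^sup>+A. f M * indicator X A \<partial>count_space Lam)"
        using elim by (intro nn_integral_cong) (auto simp: invarD[OF f] X_def indicator_def)
      also have "\<dots> = f M * emeasure (count_space Lam) X"
        by (subst nn_integral_cmult) (auto simp: X_def)
      also have "\<dots> \<le> f M * 1"
      proof (rule mult_left_mono)
        have "X \<subseteq> Lam" by (auto simp: X_def)
        moreover have "X = {} \<or> (\<exists>A. X = {A})" using X by blast
        ultimately show "emeasure (count_space Lam) X \<le> 1" by auto
      qed auto
      finally show ?case by simp
    qed
  qed
  finally show ?thesis .
qed

text \<open>The box \<open>window\<close> meets every \<open>Lam\<close>-orbit at most once, so unfolding bounds the integral over it.\<close>

lemma horo_average_le:
  assumes A: "adm B A" and \<eta>: "0 < \<eta>" "\<eta> \<le> 1 / 2"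
    and h: "\<And>c d. c \<in> {0..1/2} \<Longrightarrow> d \<in> {1..1 + \<eta>} \<Longrightarrow> h \<le> \<bar>horo A c d t\<bar>"
  shows "\<eta> / 2 * h \<le> (\<integral>M. \<bar>A M\<bar> \<partial>nu)"
proof (cases "h \<le> 0")
  case True
  then have "\<eta> / 2 * h \<le> 0" using \<eta> by (simp add: mult_nonneg_nonpos)
  also have "0 \<le> (\<integral>M. \<bar>A M\<bar> \<partial>nu)" by simp
  finally show ?thesis .
next
  case False
  note [measurable] = admD(1)[OF A]
  have int: "integrable lborel (\<lambda>u. indicator {p..<q} u * A (upr u ** (low c d ** geo t)))" for c d
    by (rule integrable_window[where B = B]) (use admD(3)[OF A] in auto)
  have intA: "integrable nu (\<lambda>M. \<bar>A M\<bar>)" using admD(3)[OF A] by (auto intro!: integrable_nu_bounded)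
  \<comment> \<open>The factor \<open>\<eta> / 2\<close> is the area of the rectangle of pairs
    \<open>(c, d)\<close> over which the lower bound \<open>h\<close> is averaged.\<close>
  have "ennreal (\<eta> / 2 * h) =
      (\<integral>\<^sup>+(c::real). \<integral>\<^sup>+d. indicator {0..1/2} c * (indicator {1..1 + \<eta>} d * ennreal h) \<partial>lborel \<partial>lborel)"
  proof -
    have "(\<integral>\<^sup>+(c::real). \<integral>\<^sup>+d. indicator {0..1/2} c * (indicator {1..1 + \<eta>} d * ennreal h) \<partial>lborel \<partial>lborel) =
        ennreal (1 / 2) * (ennreal \<eta> * ennreal h)"
      using \<eta> by (simp add: nn_integral_cmult nn_integral_multc)
    also have "\<dots> = ennreal (\<eta> / 2 * h)" using \<eta> False by (simp add: ennreal_mult[symmetric] del: ennreal_half)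
    finally show ?thesis by simp
  qed
  also have "\<dots> \<le> (\<integral>\<^sup>+c. \<integral>\<^sup>+d. (\<integral>\<^sup>+u. indicator window (chart (c, d, u)) * ennreal \<bar>A (chart (c, d, u) ** geo t)\<bar> \<partial>lborel) \<partial>lborel \<partial>lborel)"
  proof (intro nn_integral_mono)
    fix c d :: real
    show "indicator {0..1/2} c * (indicator {1..1 + \<eta>} d * ennreal h) \<le>
      (\<integral>\<^sup>+u. indicator window (chart (c, d, u)) * ennreal \<bar>A (chart (c, d, u) ** geo t)\<bar> \<partial>lborel)"
    proof (cases "c \<in> {0..1/2} \<and> d \<in> {1..1 + \<eta>}")
      case True
      then have cd: "c \<in> {0..1/2}" "d \<in> {1..1 + \<eta>}" "d \<in> {1..3/2}" using \<eta> by auto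
      have "ennreal h \<le> ennreal \<bar>horo A c d t\<bar>" using h cd by (intro ennreal_leI) auto
      also have "\<dots> \<le> ennreal (\<integral>u. \<bar>indicator {p..<q} u * A (upr u ** (low c d ** geo t))\<bar> \<partial>lborel)"
        unfolding horo_def by (intro ennreal_leI integral_abs_bound)
      also have "\<dots> = (\<integral>\<^sup>+u. ennreal \<bar>indicator {p..<q} u * A (upr u ** (low c d ** geo t))\<bar> \<partial>lborel)"
        using int by (intro nn_integral_eq_integral[symmetric]) auto
      also have "\<dots> \<le> (\<integral>\<^sup>+u. indicator window (chart (c, d, u)) * ennreal \<bar>A (chart (c, d, u) ** geo t)\<bar> \<partial>lborel)"
      proof (rule nn_integral_mono)
        fix u
        show "ennreal \<bar>indicator {p..<q} u * A (upr u ** (low c d ** geo t))\<bar> \<le>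
          indicator window (chart (c, d, u)) * ennreal \<bar>A (chart (c, d, u) ** geo t)\<bar>"
          using chart_in_window[OF cd(1,3), of u]
          by (cases "u \<in> {p..<q}") (auto simp: chart_eq matrix_mul_assoc simp del: mat2_mult)
      qed
      finally show ?thesis using cd by simp
    next
      case False
      then show ?thesis by (auto simp: indicator_def)
    qed
  qed
  also have "\<dots> = (\<integral>\<^sup>+M. indicator window M * ennreal \<bar>A (M ** geo t)\<bar> \<partial>haar)"
    by (rule nn_integral_haar[symmetric]) measurable
  also have "\<dots> \<le> (\<integral>\<^sup>+M. ennreal \<bar>A (M ** geo t)\<bar> \<partial>nu)"
    by (rule window_integral_le) (auto intro!: invar_compose[where h = "\<lambda>x. ennreal \<bar>x\<bar>"] invar_right admD(2)[OF A])
  \<comment> \<open>Invariance of \<open>nu\<close> removes the flow, so the final bound does not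
    depend on \<open>t\<close>.\<close>
  also have "\<dots> = (\<integral>\<^sup>+M. ennreal \<bar>A M\<bar> \<partial>nu)"
    by (rule nu_right_nn) (auto intro!: invar_compose[where h = "\<lambda>x. ennreal \<bar>x\<bar>"] admD(2)[OF A])
  also have "\<dots> = ennreal (\<integral>M. \<bar>A M\<bar> \<partial>nu)"
    using intA by (intro nn_integral_eq_integral) auto
  finally show ?thesis by simp
qed

lemma horo_tendsto_0:
  assumes f: "adm B f" and mean: "(\<integral>M. f M \<partial>nu) = 0"
  shows "((\<lambda>t. \<integral>u. indicator {p..<q} u * f (upr u ** geo t) \<partial>lborel) \<longlongrightarrow> 0) at_top"
proof -
  have "((\<lambda>t. horo f 0 1 t) \<longlongrightarrow> 0) at_top"
  proof (rule tendstoI)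
    fix e :: real assume "e > 0"
    then have e4: "e / 4 > 0" by simp
    obtain \<eta> where \<eta>: "\<eta> > 0" "\<eta> \<le> 1 / 2"
      and ev: "\<forall>\<^sub>F t in at_top. \<forall>c\<in>{0..1/2}. \<forall>d\<in>{1..1 + \<eta>}. \<bar>horo f c d t - horo f 0 1 t\<bar> \<le> e / 4"
      using horo_dgl[OF f e4] by blast
    \<comment> \<open>The order of choices matters: the box comes from \<open>f\<close>, then
      \<open>A\<close> from the size of the box, and only then is \<open>t\<close> taken large. The
      bound \<open>\<eta> * e / 16\<close>, divided by \<open>\<eta> / 2\<close>, leaves
      \<open>e / 8\<close> beyond the two comparison errors \<open>e / 4\<close>.\<close>
    obtain A where A: "A \<in> shift_hull f" "(\<integral>M. \<bar>A M\<bar> \<partial>nu) \<le> \<eta> * e / 16"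
      using hull_small[OF f mean, of "\<eta> * e / 16"] \<eta> \<open>e > 0\<close> by auto
    note adm = hull_adm[OF A(1) f]
    show "\<forall>\<^sub>F t in at_top. dist (horo f 0 1 t) 0 < e"
      using ev horo_hull[OF A(1) f e4]
    proof eventually_elim
      case (elim t)
      have "\<bar>horo f 0 1 t\<bar> - e / 2 \<le> \<bar>horo A c d t\<bar>" if "c \<in> {0..1/2}" "d \<in> {1..1 + \<eta>}" for c d
      proof -
        have "d \<in> {1..3/2}" using that \<eta> by auto
        then have "\<bar>horo A c d t - horo f c d t\<bar> \<le> e / 4" "\<bar>horo f c d t - horo f 0 1 t\<bar> \<le> e / 4"
          using elim that by blast+
        then show ?thesis by linarith
      qed
      from horo_average_le[OF adm \<eta> this]
      have "\<eta> / 2 * (\<bar>horo f 0 1 t\<bar> - e / 2) \<le> \<eta> * e / 16" using A(2) by linarith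
      then have "\<eta> * (\<bar>horo f 0 1 t\<bar> - e / 2) \<le> \<eta> * (e / 8)" by simp
      then have "\<bar>horo f 0 1 t\<bar> - e / 2 \<le> e / 8" using \<eta>(1) by (simp only: mult_le_cancel_left_pos)
      then show ?case using \<open>e > 0\<close> by (simp add: dist_real_def)
    qed
  qed
  moreover have "low 0 1 = mat 1" by (simp add: mat_1_eq_mat2)
  ultimately show ?thesis by (simp add: horo_def)
qed

end

end

section \<open>Absolutely continuous measures and bounded continuous functions\<close>

text \<open>Since \<open>X\<close> is bounded, an L1 error in the weight costs at most
  \<open>B\<close> times as much, uniformly in \<open>t\<close>. The good weights are therefore
  closed under linear combinations and dominated limits, and a Dynkin argument leads from windows to
  Borel sets and on to all integrable functions.\<close>

lemma integral_mult_tendsto_0: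
  fixes X :: "real \<Rightarrow> real \<Rightarrow> real"
  assumes meas: "\<And>t. X t \<in> borel_measurable borel" and B: "\<And>t u. \<bar>X t u\<bar> \<le> B"
    and window: "\<And>p q. p \<le> q \<Longrightarrow> q \<le> p + 1 \<Longrightarrow>
      ((\<lambda>t. \<integral>u. indicator {p..<q} u * X t u \<partial>lborel) \<longlongrightarrow> 0) at_top"
    and h: "integrable lborel h"
  shows "((\<lambda>t. \<integral>u. h u * X t u \<partial>lborel) \<longlongrightarrow> 0) at_top"
proof -
  have B0: "B \<ge> 0" using B[of 0 0] by linarith
  define Q where "Q h \<longleftrightarrow> integrable lborel h \<and> ((\<lambda>t. \<integral>u. h u * X t u \<partial>lborel) \<longlongrightarrow> 0) at_top" for h
  have int: "integrable lborel (\<lambda>u. h u * X t u)" if "integrable lborel h" for h t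
  proof (rule Bochner_Integration.integrable_bound)
    show "integrable lborel (\<lambda>u. B * h u)" using that by simp
    show "(\<lambda>u. h u * X t u) \<in> borel_measurable lborel" using that meas[of t] by measurable
    show "AE u in lborel. norm (h u * X t u) \<le> norm (B * h u)"
    proof (rule AE_I2)
      fix u
      show "norm (h u * X t u) \<le> norm (B * h u)"
        using mult_right_mono[OF B[of t u], of "\<bar>h u\<bar>"] B0 by (simp add: abs_mult mult.commute)
    qed
  qed
  have Q_add: "Q (\<lambda>u. h u + k u)" if "Q h" "Q k" for h k
  proof -
    have i: "integrable lborel h" "integrable lborel k" using that by (auto simp: Q_def)
    have "((\<lambda>t. (\<integral>u. h u * X t u \<partial>lborel) + (\<integral>u. k u * X t u \<partial>lborel)) \<longlongrightarrow> 0 + 0) at_top"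
      using that unfolding Q_def by (intro tendsto_add) auto
    then show ?thesis using i int[OF i(1)] int[OF i(2)] by (simp add: Q_def distrib_right)
  qed
  have Q_cmult: "Q (\<lambda>u. c * h u)" if "Q h" for h c
  proof -
    have "((\<lambda>t. c * (\<integral>u. h u * X t u \<partial>lborel)) \<longlongrightarrow> c * 0) at_top"
      using that unfolding Q_def by (intro tendsto_mult) auto
    then show ?thesis using that by (simp add: Q_def mult.assoc)
  qed
  have Q_lim: "Q h" if s: "\<And>n. Q (s n)" and conv: "\<And>u. (\<lambda>n. s n u) \<longlonglongrightarrow> h u"
      and g: "integrable lborel g" and dom: "\<And>n u. \<bar>s n u\<bar> \<le> g u" and h: "integrable lborel h"
    for s :: "nat \<Rightarrow> real \<Rightarrow> real" and h g
  proof -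
    have hg: "\<bar>h u\<bar> \<le> g u" for u
      by (rule tendsto_upperbound[OF tendsto_rabs[OF conv]]) (auto simp: dom)
    have ints: "integrable lborel (s n)" for n using s by (simp add: Q_def)
    have L1: "(\<lambda>n. \<integral>u. \<bar>s n u - h u\<bar> \<partial>lborel) \<longlonglongrightarrow> (\<integral>u. 0 \<partial>(lborel::real measure))"
    proof (rule integral_dominated_convergence[where w = "\<lambda>u. 2 * g u"])
      show "AE u in lborel. (\<lambda>n. \<bar>s n u - h u\<bar>) \<longlonglongrightarrow> 0"
        by (intro AE_I2 tendsto_rabs_zero LIM_zero conv)
      show "AE u in lborel. norm \<bar>s n u - h u\<bar> \<le> 2 * g u" for n
      proof (intro AE_I2)
        fix u show "norm \<bar>s n u - h u\<bar> \<le> 2 * g u" using dom[of n u] hg[of u] by simp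
      qed
    qed (use g h ints in auto)
    have "((\<lambda>t. \<integral>u. h u * X t u \<partial>lborel) \<longlongrightarrow> 0) at_top"
    proof (rule tendstoI)
      fix e :: real assume "e > 0"
      have "(\<lambda>n. B * (\<integral>u. \<bar>s n u - h u\<bar> \<partial>lborel)) \<longlonglongrightarrow> B * 0"
        using L1 by (intro tendsto_intros) simp
      then have "\<forall>\<^sub>F n in sequentially. B * (\<integral>u. \<bar>s n u - h u\<bar> \<partial>lborel) < e / 2"
        by (rule order_tendstoD) (use \<open>e > 0\<close> in simp)
      then obtain n where n: "B * (\<integral>u. \<bar>s n u - h u\<bar> \<partial>lborel) < e / 2"
        by (meson eventually_happens' sequentially_bot)
      have "((\<lambda>t. \<integral>u. s n u * X t u \<partial>lborel) \<longlongrightarrow> 0) at_top" using s by (simp add: Q_def)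
      then have "\<forall>\<^sub>F t in at_top. dist (\<integral>u. s n u * X t u \<partial>lborel) 0 < e / 2"
        by (rule tendstoD) (use \<open>e > 0\<close> in simp)
      then show "\<forall>\<^sub>F t in at_top. dist (\<integral>u. h u * X t u \<partial>lborel) 0 < e"
      proof eventually_elim
        case (elim t)
        have "\<bar>(\<integral>u. s n u * X t u \<partial>lborel) - (\<integral>u. h u * X t u \<partial>lborel)\<bar> =
            \<bar>\<integral>u. (s n u - h u) * X t u \<partial>lborel\<bar>"
          using int[OF h] int[OF ints] by (simp add: left_diff_distrib)
        also have "\<dots> \<le> (\<integral>u. \<bar>(s n u - h u) * X t u\<bar> \<partial>lborel)" by (rule integral_abs_bound)
        also have "\<dots> \<le> (\<integral>u. B * \<bar>s n u - h u\<bar> \<partial>lborel)"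
        proof (rule integral_mono)
          show "integrable lborel (\<lambda>u. \<bar>(s n u - h u) * X t u\<bar>)"
            using h ints by (intro integrable_abs int) auto
          show "integrable lborel (\<lambda>u. B * \<bar>s n u - h u\<bar>)" using h ints by auto
          show "\<bar>(s n u - h u) * X t u\<bar> \<le> B * \<bar>s n u - h u\<bar>" for u
            using mult_right_mono[OF B[of t u], of "\<bar>s n u - h u\<bar>"] by (simp add: abs_mult mult.commute)
        qed
        also have "\<dots> < e / 2" using n by simp
        finally have "\<bar>(\<integral>u. s n u * X t u \<partial>lborel) - (\<integral>u. h u * X t u \<partial>lborel)\<bar> < e / 2" .
        moreover have "\<bar>\<integral>u. s n u * X t u \<partial>lborel\<bar> < e / 2" using elim by (simp add: dist_real_def)
        ultimately have "\<bar>\<integral>u. h u * X t u \<partial>lborel\<bar> < e / 2 + e / 2" by (simp only: abs_less_iff) argo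
        then show ?case by (simp add: dist_real_def)
      qed
    qed
    then show ?thesis using h by (simp add: Q_def)
  qed
  have ivl: "Q (indicator {p..<q})" if "p \<le> q" "q \<le> p + real n" for p q n
    using that
  proof (induction n arbitrary: p)
    case 0
    then have "{p..<q} = {}" by auto
    then show ?case by (simp add: Q_def)
  next
    case (Suc n)
    define r where "r = min q (p + 1)"
    have r: "p \<le> r" "r \<le> p + 1" "r \<le> q" "q \<le> r + real n" using Suc.prems by (auto simp: r_def)
    have "Q (indicator {p..<r})" using window[OF r(1,2)] r(1) by (auto simp: Q_def)
    then have "Q (\<lambda>u. indicator {p..<r} u + indicator {r..<q} u)" using Suc.IH[of r] r by (intro Q_add) auto
    moreover have "(\<lambda>u. indicator {p..<r} u + indicator {r..<q} u) = (indicator {p..<q} :: real \<Rightarrow> real)"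
      using r by (auto simp: fun_eq_iff indicator_def)
    ultimately show ?case by simp
  qed
  \<comment> \<open>Cutting off at \<open>n\<close> keeps complements of finite measure, so that
    they are good weights as differences.\<close>
  have bor: "Q (indicator (E \<inter> {- real n..<real n}))" if "E \<in> sets borel" for E n
  proof -
    let ?J = "{- real n..<real n}"
    have J: "Q (indicator ?J)" using ivl[of "- real n" "real n" "2 * n"] by simp
    have E: "E \<in> sigma_sets UNIV (range lessThan)" using that by (subst (asm) borel_Iio) auto
    have "{..<a} \<inter> {..<b} = {..<min a b}" for a b :: real by auto
    then have "Int_stable (range (lessThan :: real \<Rightarrow> _))"
      by (auto simp: Int_stable_def)
    moreover have "range (lessThan :: real \<Rightarrow> _) \<subseteq> Pow UNIV" by simp
    ultimately show ?thesis using E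
    proof (induction rule: sigma_sets_induct_disjoint)
      case (basic A)
      then obtain a where A: "A = {..<a}" by auto
      show ?case
      proof (cases "a \<le> - real n")
        case True
        then have "A \<inter> ?J = {}" using A by auto
        then show ?thesis by (simp add: Q_def)
      next
        case False
        then have "A \<inter> ?J = {- real n..<min a (real n)}" using A by auto
        moreover have "Q (indicator {- real n..<min a (real n)})"
          using False by (intro ivl[of _ _ "2 * n"]) auto
        ultimately show ?thesis by simp
      qed
    next
      case empty then show ?case by (simp add: Q_def)
    next
      case (compl A)
      have "Q (\<lambda>u. indicator ?J u + (- 1) * indicator (A \<inter> ?J) u)" using compl J by (intro Q_add Q_cmult)
      moreover have "(\<lambda>u. indicator ?J u + (- 1) * indicator (A \<inter> ?J) u) = (indicator ((UNIV - A) \<inter> ?J) :: real \<Rightarrow> real)"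
        by (auto simp: fun_eq_iff indicator_def)
      ultimately show ?case by simp
    next
      case (union A)
      define S where "S k = (\<Union>i<k. A i)" for k :: nat
      have disj: "A i \<inter> A j = {}" if "i \<noteq> j" for i j using union(1) that by (auto simp: disjoint_family_on_def)
      have QS: "Q (indicator (S k \<inter> ?J))" for k
      proof (induction k)
        case 0 then show ?case by (simp add: Q_def S_def)
      next
        case (Suc k)
        have "A k \<inter> A i = {}" if "i < k" for i using disj[of k i] that by simp
        then have "A k \<inter> S k = {}" unfolding S_def by blast
        then have "(\<lambda>u. indicator (S k \<inter> ?J) u + indicator (A k \<inter> ?J) u) = (indicator (S (Suc k) \<inter> ?J) :: real \<Rightarrow> real)"
          by (auto simp: fun_eq_iff indicator_def S_def lessThan_Suc)
        then show ?case using Q_add[OF Suc union(3)[of k]] by simp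
      qed
      have conv: "(\<lambda>k. indicator (S k \<inter> ?J) u :: real) \<longlonglongrightarrow> indicator (\<Union>(range A) \<inter> ?J) u" for u
      proof -
        have "incseq (\<lambda>k. S k \<inter> ?J)" by (rule incseq_SucI) (auto simp: S_def lessThan_Suc)
        moreover have "(\<Union>k. S k \<inter> ?J) = \<Union>(range A) \<inter> ?J" by (auto simp: S_def)
        ultimately show ?thesis using LIMSEQ_indicator_incseq[of "\<lambda>k. S k \<inter> ?J" u] by simp
      qed
      have intU: "integrable lborel (indicator (\<Union>(range A) \<inter> ?J) :: real \<Rightarrow> real)"
      proof -
        have "\<Union>(range A) \<in> sets borel"
          using union(2) by (subst borel_Iio) (auto intro: sigma_sets.Union)
        then have "emeasure lborel (\<Union>(range A) \<inter> ?J) \<le> emeasure lborel ?J" by (intro emeasure_mono) auto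
        also have "\<dots> < \<infinity>" by simp
        finally show ?thesis using \<open>\<Union>(range A) \<in> sets borel\<close> by (intro integrable_real_indicator) auto
      qed
      show ?case
        by (rule Q_lim[OF QS conv _ _ intU, where g = "indicator ?J"]) (auto simp: indicator_def)
    qed
  qed
  from h have "Q h"
  proof (induction rule: integrable_induct)
    case (base A c)
    have A: "A \<in> sets borel" "integrable lborel (indicator A :: real \<Rightarrow> real)" using base by auto
    have "(\<lambda>n. indicator (A \<inter> {- real n..<real n}) u :: real) \<longlonglongrightarrow> indicator A u" for u
    proof -
      have "incseq (\<lambda>n. A \<inter> {- real n..<real n})" by (rule incseq_SucI) auto
      moreover have "(\<Union>n. A \<inter> {- real n..<real n}) = A"
      proof -
        have "\<exists>n. x \<in> {- real n..<real n}" for x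
        proof -
          obtain n where "\<bar>x\<bar> < real n" using reals_Archimedean2 by blast
          then show ?thesis by (intro exI[of _ n]) auto
        qed
        then show ?thesis by blast
      qed
      ultimately show ?thesis using LIMSEQ_indicator_incseq[of "\<lambda>n. A \<inter> {- real n..<real n}" u] by simp
    qed
    then have "Q (indicator A)"
      by (rule Q_lim[OF bor[OF A(1)] _ A(2) _ A(2)]) (auto simp: indicator_def)
    from Q_cmult[OF this, of c] show ?case by (simp add: mult.commute)
  next
    case (add f g)
    then show ?case by (intro Q_add)
  next
    case (lim f s)
    show ?case by (rule Q_lim[of s f "\<lambda>u. 2 * \<bar>f u\<bar>"]) (use lim in auto)
  qed
  then show ?thesis by (simp add: Q_def)
qed

lemma integrable_density_of_prob:
  assumes L: "prob_space L" "sets L = sets borel" "absolutely_continuous lborel (L :: real measure)"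
  shows "\<exists>h :: real \<Rightarrow> real. integrable lborel h \<and> (\<forall>u. h u \<ge> 0) \<and> L = density lborel h \<and> (\<integral>u. h u \<partial>lborel) = 1"
proof -
  interpret L: prob_space L by fact
  define h where "h x = enn2real (RN_deriv lborel L x)" for x
  have "AE x in lborel. RN_deriv lborel L x \<noteq> \<infinity>"
    using L by (intro sigma_finite_measure.RN_deriv_finite[OF lborel.sigma_finite_measure_axioms] L.sigma_finite_measure_axioms) auto
  then have "AE x in lborel. RN_deriv lborel L x = ennreal (h x)"
    by eventually_elim (simp add: h_def less_top)
  moreover have "h \<in> borel_measurable lborel" unfolding h_def by measurable
  ultimately have h: "h \<in> borel_measurable lborel" "AE x in lborel. RN_deriv lborel L x = ennreal (h x)" "\<And>x. 0 \<le> h x"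
    by (auto simp: h_def)
  have "L = density lborel (RN_deriv lborel L)"
    using sigma_finite_measure.density_RN_deriv[OF lborel.sigma_finite_measure_axioms L(3)] L(2) by simp
  also have "\<dots> = density lborel h" using h by (intro density_cong) auto
  finally have eq: "L = density lborel h" .
  have "(\<integral>\<^sup>+u. ennreal (h u) \<partial>lborel) = emeasure L (space L)"
    using h(1) by (subst (2) eq) (simp add: emeasure_density eq)
  then have nn: "(\<integral>\<^sup>+u. ennreal (h u) \<partial>lborel) = 1" by (simp add: L.emeasure_space_1)
  have int: "integrable lborel h" using h nn by (intro integrableI_nonneg) auto
  have "(\<integral>u. h u \<partial>lborel) = 1" using nn h by (subst integral_eq_nn_integral) auto
  then show ?thesis using int h eq by blast
qed

section \<open>A subadditive length function on matrices\<close>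

definition l1 :: "real^2^2 \<Rightarrow> real" where
  "l1 M = \<bar>M$1$1\<bar> + \<bar>M$1$2\<bar> + \<bar>M$2$1\<bar> + \<bar>M$2$2\<bar>"

lemma l1_mat2 [simp]: "l1 (mat2 a b c d) = \<bar>a\<bar> + \<bar>b\<bar> + \<bar>c\<bar> + \<bar>d\<bar>"
  by (simp add: l1_def)

lemma l1_nonneg: "l1 M \<ge> 0"
  by (simp add: l1_def)

lemma l1_add: "l1 (A + B) \<le> l1 A + l1 B"
  unfolding l1_def by (simp add: abs_triangle_ineq add_mono) argo

lemma l1_mult: "l1 (A ** B) \<le> l1 A * l1 B"
proof -
  have *: "\<bar>x * y + z * w\<bar> \<le> \<bar>x\<bar> * \<bar>y\<bar> + \<bar>z\<bar> * \<bar>w\<bar>" for x y z w :: real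
    by (metis abs_mult abs_triangle_ineq)
  obtain a b c d where A: "A = mat2 a b c d" by (rule mat2_cases)
  obtain a' b' c' d' where B: "B = mat2 a' b' c' d'" by (rule mat2_cases)
  have "l1 (A ** B) \<le> (\<bar>a\<bar> * \<bar>a'\<bar> + \<bar>b\<bar> * \<bar>c'\<bar>) + (\<bar>a\<bar> * \<bar>b'\<bar> + \<bar>b\<bar> * \<bar>d'\<bar>) +
      (\<bar>c\<bar> * \<bar>a'\<bar> + \<bar>d\<bar> * \<bar>c'\<bar>) + (\<bar>c\<bar> * \<bar>b'\<bar> + \<bar>d\<bar> * \<bar>d'\<bar>)"
    unfolding A B mat2_mult l1_mat2 by (intro add_mono *)
  also have "\<dots> \<le> l1 A * l1 B"
  proof -
    have "0 \<le> \<bar>a\<bar> * \<bar>c'\<bar> + \<bar>a\<bar> * \<bar>d'\<bar> + \<bar>b\<bar> * \<bar>a'\<bar> + \<bar>b\<bar> * \<bar>b'\<bar> + \<bar>c\<bar> * \<bar>c'\<bar> + \<bar>c\<bar> * \<bar>d'\<bar> + \<bar>d\<bar> * \<bar>a'\<bar> + \<bar>d\<bar> * \<bar>b'\<bar>"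
      by (intro add_nonneg_nonneg mult_nonneg_nonneg) auto
    then show ?thesis unfolding A B l1_mat2 by (simp add: algebra_simps)
  qed
  finally show ?thesis .
qed

text \<open>The logarithm turns submultiplicativity into subadditivity; no symmetry under inversion
  is claimed, so both \<open>ell h\<close> and \<open>ell (adj2 h)\<close> appear later.\<close>

definition ell :: "real^2^2 \<Rightarrow> real" where
  "ell g = ln (1 + l1 (g - mat 1))"

lemma ell_nonneg: "ell g \<ge> 0"
  using l1_nonneg[of "g - mat 1"] by (simp add: ell_def)

lemma ell_1 [simp]: "ell (mat 1) = 0"
  by (simp add: ell_def l1_def)

text \<open>With \<open>g = 1 + x\<close> and \<open>h = 1 + y\<close> one has
  \<open>g h - 1 = x y + x + y\<close>, so 1 plus its norm is at most the product of the two factors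
  \<open>1 + l1 x\<close> and \<open>1 + l1 y\<close>.\<close>

lemma ell_mult: "ell (g ** h) \<le> ell g + ell h"
proof -
  let ?x = "l1 (g - mat 1)" and ?y = "l1 (h - mat 1)"
  have pos: "?x \<ge> 0" "?y \<ge> 0" by (rule l1_nonneg)+
  have "g ** h - mat 1 = ((g - mat 1) ** (h - mat 1) + (g - mat 1)) + (h - mat 1)"
    by (cases g rule: mat2_cases; cases h rule: mat2_cases)
      (simp add: vec2_eq_iff matrix_matrix_mult_def sum_2 mat_def algebra_simps)
  then have "l1 (g ** h - mat 1) = l1 (((g - mat 1) ** (h - mat 1) + (g - mat 1)) + (h - mat 1))"
    by (rule arg_cong)
  then have "l1 (g ** h - mat 1) \<le> (?x * ?y + ?x) + ?y"
    using l1_add[of "(g - mat 1) ** (h - mat 1) + (g - mat 1)" "h - mat 1"]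
      l1_add[of "(g - mat 1) ** (h - mat 1)" "g - mat 1"] l1_mult[of "g - mat 1" "h - mat 1"] by linarith
  then have "1 + l1 (g ** h - mat 1) \<le> (1 + ?x) * (1 + ?y)" by (simp add: algebra_simps)
  then have "ell (g ** h) \<le> ln ((1 + ?x) * (1 + ?y))"
    unfolding ell_def using l1_nonneg[of "g ** h - mat 1"] by (intro ln_mono) auto
  also have "\<dots> = ell g + ell h" unfolding ell_def using pos by (intro ln_mult_pos) auto
  finally show ?thesis .
qed

lemma tendsto_ell: "(ell \<longlongrightarrow> 0) (nhds (mat 1))"
proof -
  have "(ell \<longlongrightarrow> ln (1 + l1 (mat 1 - mat 1))) (nhds (mat 1))"
    unfolding ell_def l1_def by (intro tendsto_intros filterlim_ident) auto
  then show ?thesis by (simp add: l1_def)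
qed

text \<open>Ensures that \<open>ell\<close> is bounded below away from the identity, which is how
  the penalty in \<open>minorant\<close> localises the infimum.\<close>

lemma norm_le_l1: "\<exists>K>0. \<forall>M. norm M \<le> K * l1 M"
proof -
  define K where "K = 1 + norm (mat2 1 0 0 0) + norm (mat2 0 1 0 0) + norm (mat2 0 0 1 0) + norm (mat2 0 0 0 1)"
  have "norm (mat2 a b c d) \<le> K * l1 (mat2 a b c d)" for a b c d
  proof -
    have *: "norm (x *\<^sub>R E) \<le> K * \<bar>x\<bar>" if "norm E \<le> K" for x and E :: "real^2^2"
      using mult_right_mono[OF that, of "\<bar>x\<bar>"] by (simp add: mult.commute)
    have "norm (mat2 a b c d) \<le> K * \<bar>a\<bar> + K * \<bar>b\<bar> + K * \<bar>c\<bar> + K * \<bar>d\<bar>"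
      by (subst mat2_eq_scaleR)
         (intro norm_triangle_mono *; simp add: K_def)
    then show ?thesis by (simp add: algebra_simps)
  qed
  moreover have "K > 0" by (simp add: K_def add_pos_nonneg)
  ultimately show ?thesis by (metis mat2_cases)
qed

context lattice
begin

lemma adm_diff_const:
  assumes f: "adm B f" and c: "\<bar>c\<bar> \<le> B"
  shows "adm (2 * B) (\<lambda>M. f M - c)"
proof -
  note [measurable] = admD(1)[OF f]
  have "ruc (\<lambda>M. f M - c)" using admD(4)[OF f] by (simp add: ruc_def)
  moreover have "\<bar>f M - c\<bar> \<le> 2 * B" for M using admD(3)[OF f, of M] c by linarith
  ultimately show ?thesis
    unfolding adm_def using invar_compose[OF admD(2)[OF f], of "\<lambda>x. x - c"] by auto
qed

lemma equidistribution_adm: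
  assumes f: "adm B f" and vol: "vol > 0"
    and L: "prob_space L" "sets L = sets borel" "absolutely_continuous lborel L"
  shows "((\<lambda>t. \<integral>u. f (upr u ** geo t) \<partial>L) \<longlongrightarrow> (\<integral>M. f M \<partial>nu) / vol) at_top"
proof -
  define m where "m = (\<integral>M. f M \<partial>nu) / vol"
  note [measurable] = admD(1)[OF f]
  have int: "integrable nu f" using admD(3)[OF f] by (auto intro!: integrable_nu_bounded)
  have "\<bar>\<integral>M. f M \<partial>nu\<bar> \<le> (\<integral>M. \<bar>f M\<bar> \<partial>nu)" by (rule integral_abs_bound)
  also have "\<dots> \<le> (\<integral>M. B \<partial>nu)" using int admD(3)[OF f] by (intro integral_mono) auto
  finally have "\<bar>m\<bar> \<le> B" using vol by (simp add: m_def divide_le_eq mult.commute)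
  from adm_diff_const[OF f this] have adm: "adm (2 * B) (\<lambda>M. f M - m)" .
  have mean: "(\<integral>M. f M - m \<partial>nu) = 0" using int vol by (simp add: m_def)
  obtain h where h: "integrable lborel h" "\<And>u. h u \<ge> 0" "L = density lborel h" "(\<integral>u. h u \<partial>lborel) = 1"
    using integrable_density_of_prob[OF L] by blast
  have "((\<lambda>t. \<integral>u. h u * (f (upr u ** geo t) - m) \<partial>lborel) \<longlongrightarrow> 0) at_top"
    by (rule integral_mult_tendsto_0[OF _ admD(3)[OF adm] horo_tendsto_0[OF _ _ adm mean] h(1)]) auto
  moreover have "(\<integral>u. h u * (f (upr u ** geo t) - m) \<partial>lborel) = (\<integral>u. f (upr u ** geo t) \<partial>L) - m" for t
  proof -
    have [measurable]: "h \<in> borel_measurable borel" using h(1) by auto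
    have i: "integrable lborel (\<lambda>u. h u * f (upr u ** geo t))"
    proof (rule Bochner_Integration.integrable_bound)
      show "integrable lborel (\<lambda>u. B * h u)" using h(1) by simp
      show "AE u in lborel. norm (h u * f (upr u ** geo t)) \<le> norm (B * h u)"
      proof (rule AE_I2)
        fix u
        have "\<bar>f (upr u ** geo t)\<bar> \<le> \<bar>B\<bar>" using admD(3)[OF f, of "upr u ** geo t"] by linarith
        from mult_right_mono[OF this, of "\<bar>h u\<bar>"]
        show "norm (h u * f (upr u ** geo t)) \<le> norm (B * h u)" by (simp only: real_norm_def abs_mult mult.commute)
      qed
    qed measurable
    have "(\<integral>u. f (upr u ** geo t) \<partial>L) = (\<integral>u. h u * f (upr u ** geo t) \<partial>lborel)"
      unfolding h(3) using h(2) by (subst integral_density) auto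
    then show ?thesis using i h(1,4) by (simp add: right_diff_distrib)
  qed
  ultimately have "((\<lambda>t. (\<integral>u. f (upr u ** geo t) \<partial>L) - m) \<longlongrightarrow> 0) at_top" by simp
  then show ?thesis unfolding m_def[symmetric] by (simp add: LIM_zero_iff)
qed

text \<open>Right-uniformly continuous minorants: since \<open>ell\<close> is subadditive, the infimum over right
  translates penalised by \<open>k * ell\<close> oscillates by at most \<open>k * (ell h + ell h\<^sup>-\<^sup>1)\<close> under \<open>h\<close>.\<close>

definition minorant :: "(real^2^2 \<Rightarrow> real) \<Rightarrow> nat \<Rightarrow> real^2^2 \<Rightarrow> real" where
  "minorant f k M = (if det M = 1 then (INF g\<in>{g. det g = 1}. f (M ** g) + real k * ell g) else 0)"

context
  fixes f :: "real^2^2 \<Rightarrow> real" and B :: real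
  assumes inv: "invar f" and bd: "\<And>M. \<bar>f M\<bar> \<le> B" and cont: "continuous_on {M. det M = 1} f"
begin

lemma minorant_bdd: "bdd_below ((\<lambda>g. f (M ** g) + real k * ell g) ` {g. det g = 1})"
proof (rule bdd_belowI2[where m = "- B"])
  fix g show "- B \<le> f (M ** g) + real k * ell g"
    using bd[of "M ** g"] ell_nonneg[of g] mult_nonneg_nonneg[of "real k" "ell g"] by linarith
qed

lemma minorant_le:
  "det M = 1 \<Longrightarrow> det g = 1 \<Longrightarrow> minorant f k M \<le> f (M ** g) + real k * ell g"
  unfolding minorant_def by (simp, intro cINF_lower minorant_bdd) simp

lemma minorant_ge:
  assumes "det M = 1" "\<And>g. det g = 1 \<Longrightarrow> x \<le> f (M ** g) + real k * ell g"
  shows "x \<le> minorant f k M"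
proof -
  have "mat 1 \<in> {g :: real^2^2. det g = 1}" by simp
  then show ?thesis using assms unfolding minorant_def by (auto intro!: cINF_greatest)
qed

lemma minorant_le_self: "det M = 1 \<Longrightarrow> minorant f k M \<le> f M"
  using minorant_le[of M "mat 1" k] by simp

lemma minorant_bound: "\<bar>minorant f k M\<bar> \<le> B"
proof (cases "det M = 1")
  case True
  have "- B \<le> f (M ** g) + real k * ell g" for g
    using bd[of "M ** g"] ell_nonneg[of g] mult_nonneg_nonneg[of "real k" "ell g"] by linarith
  then have "- B \<le> minorant f k M" using True by (intro minorant_ge)
  then show ?thesis using minorant_le_self[OF True, of k] bd[of M] by linarith
next
  case False
  then show ?thesis using bd[of 0] by (simp add: minorant_def)
qed

lemma minorant_right:
  assumes M: "det M = 1" and h: "det h = 1"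
  shows "minorant f k (M ** h) \<le> minorant f k M + real k * ell (adj2 h)"
proof -
  have "minorant f k (M ** h) - real k * ell (adj2 h) \<le> minorant f k M"
  proof (rule minorant_ge[OF M])
    fix g :: "real^2^2" assume g: "det g = 1"
    have "minorant f k (M ** h) \<le> f (M ** h ** (adj2 h ** g)) + real k * ell (adj2 h ** g)"
      using M h g by (intro minorant_le) (auto simp: det_mult_1)
    also have "M ** h ** (adj2 h ** g) = M ** g" using h by (simp add: matrix_mul_assoc[symmetric])
    also have "real k * ell (adj2 h ** g) \<le> real k * (ell (adj2 h) + ell g)"
      by (intro mult_left_mono ell_mult) auto
    finally show "minorant f k (M ** h) - real k * ell (adj2 h) \<le> f (M ** g) + real k * ell g"
      by (simp add: distrib_left)
  qed
  then show ?thesis by simp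
qed

lemma minorant_diff:
  assumes M: "det M = 1" and h: "det h = 1"
  shows "\<bar>minorant f k (M ** h) - minorant f k M\<bar> \<le> real k * (ell h + ell (adj2 h))"
proof -
  have "adj2 (adj2 h) = h" by (cases h rule: mat2_cases) simp
  then have "minorant f k M \<le> minorant f k (M ** h) + real k * ell h"
    using minorant_right[of "M ** h" "adj2 h" k] M h by (simp add: det_mult_1)
  moreover have "0 \<le> real k * ell h" "0 \<le> real k * ell (adj2 h)" by (simp_all add: ell_nonneg)
  ultimately show ?thesis using minorant_right[OF M h, of k] by (simp add: distrib_left abs_le_iff)
qed

lemma minorant_ruc: "ruc (minorant f k)"
  unfolding ruc_def
proof (intro allI impI)
  fix e :: real assume "e > 0"
  have "(adj2 \<longlongrightarrow> adj2 (mat 1)) (nhds (mat 1))"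
    unfolding adj2_def by (intro tendsto_intros filterlim_ident)
  then have "filterlim adj2 (nhds (mat 1)) (nhds (mat 1))" by (simp add: adj2_def mat_1_eq_mat2)
  from filterlim_compose[OF tendsto_ell this]
  have "((\<lambda>h. real k * (ell h + ell (adj2 h))) \<longlongrightarrow> real k * (0 + 0)) (nhds (mat 1))"
    by (intro tendsto_intros tendsto_ell) (simp add: o_def)
  then have "\<forall>\<^sub>F h in nhds (mat 1). real k * (ell h + ell (adj2 h)) < e"
    by (rule order_tendstoD) (use \<open>e > 0\<close> in simp)
  then show "\<forall>\<^sub>F h in nhds (mat 1). det h = 1 \<longrightarrow> (\<forall>M. det M = 1 \<longrightarrow> \<bar>minorant f k (M ** h) - minorant f k M\<bar> < e)"
    by eventually_elim (meson minorant_diff le_less_trans)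
qed

text \<open>Used for the measurability of minorants, which an infimum over an uncountable family
  does not give by itself.\<close>

lemma ruc_continuous:
  assumes "ruc g" shows "continuous_on {M. det M = 1} g"
  unfolding continuous_on_def
proof (intro ballI tendstoI)
  fix M :: "real^2^2" and e :: real assume M: "M \<in> {M. det M = 1}" and "e > 0"
  have "((\<lambda>M'. adj2 M ** M') \<longlongrightarrow> adj2 M ** M) (at M within {M. det M = 1})"
    by (intro tendsto_intros)
  then have lim: "filterlim (\<lambda>M'. adj2 M ** M') (nhds (mat 1)) (at M within {M. det M = 1})"
    using M adj2_mult by simp
  have "\<forall>\<^sub>F h in nhds (mat 1). det h = 1 \<longrightarrow> (\<forall>M. det M = 1 \<longrightarrow> \<bar>g (M ** h) - g M\<bar> < e)"
    using assms \<open>e > 0\<close> by (simp add: ruc_def)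
  from eventually_compose_filterlim[OF this lim]
  have "\<forall>\<^sub>F M' in at M within {M. det M = 1}. det (adj2 M ** M') = 1 \<longrightarrow>
    (\<forall>N. det N = 1 \<longrightarrow> \<bar>g (N ** (adj2 M ** M')) - g N\<bar> < e)" .
  moreover have "\<forall>\<^sub>F M' in at M within {M. det M = 1}. det M' = 1"
    by (auto simp: eventually_at_filter)
  ultimately show "\<forall>\<^sub>F M' in at M within {M. det M = 1}. dist (g M') (g M) < e"
  proof eventually_elim
    case (elim M')
    have "det (adj2 M ** M') = 1" using elim M by (simp add: det_mult_1)
    then have "\<bar>g (M ** (adj2 M ** M')) - g M\<bar> < e" using elim(1) M by blast
    then show ?case using M by (simp add: dist_real_def)
  qed
qed

lemma minorant_adm: "adm B (minorant f k)"
proof -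
  have "invar (minorant f k)"
    unfolding invar_def
  proof (intro ballI allI impI)
    fix A M :: "real^2^2" assume A: "A \<in> Lam" and M: "det M = 1"
    have "f (A ** M ** g) = f (M ** g)" if "det g = 1" for g
      using invarD[OF inv A, of "M ** g"] that M by (simp add: det_mult_1 matrix_mul_assoc)
    then show "minorant f k (A ** M) = minorant f k M"
      using M Lam_det[OF A] by (simp add: minorant_def det_mult_1 cong: INF_cong_simp)
  qed
  moreover have "(\<lambda>M. if M \<in> {M. det M = 1} then minorant f k M else 0) \<in> borel_measurable borel"
    by (intro borel_measurable_continuous_on_if ruc_continuous minorant_ruc continuous_on_const) measurable
  moreover have "(\<lambda>M. if M \<in> {M. det M = 1} then minorant f k M else 0) = minorant f k"
    by (auto simp: minorant_def)
  ultimately show ?thesis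
    unfolding adm_def using minorant_bound minorant_ruc by simp
qed

text \<open>Translates by \<open>g\<close> near the identity change \<open>f M\<close> little by
  continuity; for all others the penalty eventually exceeds the oscillation \<open>2 * B\<close>.
  Convergence at each point suffices, since the minorants share the bound \<open>B\<close>.\<close>

lemma minorant_tendsto:
  assumes M: "det M = 1"
  shows "(\<lambda>k. minorant f k M) \<longlonglongrightarrow> f M"
proof (rule LIMSEQ_I)
  fix e :: real assume "e > 0"
  have "((\<lambda>M'. f M') \<longlongrightarrow> f M) (at M within {M. det M = 1})"
    using cont M by (simp add: continuous_on_def)
  then have "\<forall>\<^sub>F M' in at M within {M. det M = 1}. dist (f M') (f M) < e / 2"
    by (rule tendstoD) (use \<open>e > 0\<close> in simp)
  then have "\<forall>\<^sub>F M' in nhds M. det M' = 1 \<longrightarrow> dist (f M') (f M) < e / 2"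
    unfolding eventually_at_filter using \<open>e > 0\<close> by (auto elim: eventually_mono)
  moreover have "filterlim (\<lambda>g. M ** g) (nhds M) (nhds (mat 1))"
    using tendsto_matrix_mult[OF tendsto_const filterlim_ident, of "M" "mat 1"] by simp
  ultimately have "\<forall>\<^sub>F g in nhds (mat 1). det (M ** g) = 1 \<longrightarrow> dist (f (M ** g)) (f M) < e / 2"
    by (rule eventually_compose_filterlim)
  then obtain r where r: "r > 0" "\<And>g. dist g (mat 1) < r \<Longrightarrow> det (M ** g) = 1 \<Longrightarrow> dist (f (M ** g)) (f M) < e / 2"
    by (auto simp: eventually_nhds_metric)
  obtain K where K: "K > 0" "\<And>N. norm N \<le> K * l1 N" using norm_le_l1 by blast
  \<comment> \<open>A lower bound for \<open>ell\<close> outside the ball of radius \<open>r\<close>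
    about the identity.\<close>
  define b where "b = ln (1 + r / K)"
  have b: "b > 0" using r(1) K(1) unfolding b_def by (intro ln_gt_zero) (simp add: divide_pos_pos)
  obtain k0 where k0: "2 * B / b \<le> real k0" using real_arch_simple by blast
  show "\<exists>k0. \<forall>k\<ge>k0. norm (minorant f k M - f M) < e"
  proof (intro exI allI impI)
    fix k assume "k0 \<le> k"
    then have kb: "2 * B \<le> real k * b" using k0 b by (simp add: divide_le_eq order_trans mult_right_mono)
    have "f M - e / 2 \<le> f (M ** g) + real k * ell g" if g: "det g = 1" for g
    proof (cases "dist g (mat 1) < r")
      case True
      then have "dist (f (M ** g)) (f M) < e / 2" using r(2) g M by (simp add: det_mult_1)
      moreover have "0 \<le> real k * ell g" by (simp add: ell_nonneg)
      ultimately show ?thesis unfolding dist_real_def abs_less_iff by linarith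
    next
      case False
      then have "r \<le> K * l1 (g - mat 1)" using K(2)[of "g - mat 1"] by (simp add: dist_norm)
      then have "r / K \<le> l1 (g - mat 1)" using K(1) by (simp add: divide_le_eq mult.commute)
      then have "b \<le> ell g" unfolding b_def ell_def using r(1) K(1) by (intro ln_mono) (auto intro: add_pos_pos)
      then have "real k * b \<le> real k * ell g" by (intro mult_left_mono) auto
      then show ?thesis using kb bd[of M] bd[of "M ** g"] \<open>e > 0\<close> by simp
    qed
    then have "f M - e / 2 \<le> minorant f k M" using M by (intro minorant_ge)
    moreover have "minorant f k M \<le> f M" using M by (rule minorant_le_self)
    ultimately show "norm (minorant f k M - f M) < e" using \<open>e > 0\<close> by simp
  qed
qed

end

text \<open>Comparison with minorants only yields a lower bound along the curve, but a sharp one: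
  their means tend to the mean of \<open>f\<close> by dominated convergence, so a single minorant,
  chosen before \<open>t\<close>, is enough.\<close>

lemma equidistribution_lower:
  assumes [measurable]: "f \<in> borel_measurable borel" and f: "invar f" "\<And>M. \<bar>f M\<bar> \<le> B" "continuous_on {M. det M = 1} f"
    and vol: "vol > 0"
    and L: "prob_space L" "sets L = sets borel" "absolutely_continuous lborel L" and "e > 0"
  shows "\<forall>\<^sub>F t in at_top. (\<integral>M. f M \<partial>nu) / vol - e < (\<integral>u. f (upr u ** geo t) \<partial>L)"
proof -
  interpret L: prob_space L by fact
  note adm = minorant_adm[OF f]
  have meas: "minorant f k \<in> borel_measurable borel" for k using admD(1)[OF adm] .
  have "(\<lambda>k. \<integral>M. minorant f k M \<partial>nu) \<longlonglongrightarrow> (\<integral>M. f M \<partial>nu)"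
  proof (rule integral_dominated_convergence[where w = "\<lambda>_. B"])
    show "AE M in nu. (\<lambda>k. minorant f k M) \<longlonglongrightarrow> f M"
      using AE_nu_det by eventually_elim (rule minorant_tendsto[OF f])
    show "AE M in nu. norm (minorant f k M) \<le> B" for k
      using minorant_bound[OF f] by simp
  qed (use meas in auto)
  then have "(\<lambda>k. (\<integral>M. minorant f k M \<partial>nu) / vol) \<longlonglongrightarrow> (\<integral>M. f M \<partial>nu) / vol"
    by (intro tendsto_intros) (use vol in auto)
  then have "\<forall>\<^sub>F k in sequentially. (\<integral>M. f M \<partial>nu) / vol - e < (\<integral>M. minorant f k M \<partial>nu) / vol"
    by (rule order_tendstoD(1)) (use \<open>e > 0\<close> in simp)
  then obtain k where k: "(\<integral>M. f M \<partial>nu) / vol - e < (\<integral>M. minorant f k M \<partial>nu) / vol"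
    by (meson eventually_happens' sequentially_bot)
  have "\<forall>\<^sub>F t in at_top. (\<integral>M. f M \<partial>nu) / vol - e < (\<integral>u. minorant f k (upr u ** geo t) \<partial>L)"
    using equidistribution_adm[OF adm vol L] k by (rule order_tendstoD)
  then show ?thesis
  proof eventually_elim
    case (elim t)
    have int: "integrable L (\<lambda>u. g (upr u ** geo t))"
      if [measurable]: "g \<in> borel_measurable borel" and "\<And>M. \<bar>g M\<bar> \<le> B" for g :: "real^2^2 \<Rightarrow> real"
    proof (rule L.integrable_const_bound[where B = B])
      have "(\<lambda>u. g (upr u ** geo t)) \<in> borel_measurable borel" by measurable
      then show "(\<lambda>u. g (upr u ** geo t)) \<in> borel_measurable L"
        using L(2) by (simp cong: measurable_cong_sets)
    qed (use that in auto)
    have "(\<integral>u. minorant f k (upr u ** geo t) \<partial>L) \<le> (\<integral>u. f (upr u ** geo t) \<partial>L)"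
    proof (rule integral_mono)
      show "minorant f k (upr u ** geo t) \<le> f (upr u ** geo t)" for u
        by (intro minorant_le_self[OF f] det_mult_1) auto
    qed (intro int meas minorant_bound[OF f] assms)+
    then show ?case using elim by linarith
  qed
qed

text \<open>The upper bound is the lower bound for \<open>- f\<close>, which is again bounded,
  continuous and invariant.\<close>

theorem equidistribution:
  assumes f: "f \<in> borel_measurable borel" "invar f" "\<And>M. \<bar>f M\<bar> \<le> B" "continuous_on {M. det M = 1} f"
    and vol: "vol > 0"
    and L: "prob_space L" "sets L = sets borel" "absolutely_continuous lborel L"
  shows "((\<lambda>t. \<integral>u. f (upr u ** geo t) \<partial>L) \<longlongrightarrow> (\<integral>M. f M \<partial>nu) / vol) at_top"
proof (rule tendstoI)
  fix e :: real assume "e > 0"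
  have "\<forall>\<^sub>F t in at_top. (\<integral>M. - f M \<partial>nu) / vol - e < (\<integral>u. - f (upr u ** geo t) \<partial>L)"
    by (rule equidistribution_lower[OF _ invar_compose[OF f(2)] _ _ vol L \<open>e > 0\<close>, where B = B])
      (use f in \<open>auto intro!: continuous_intros\<close>)
  with equidistribution_lower[OF f vol L \<open>e > 0\<close>]
  show "\<forall>\<^sub>F t in at_top. dist (\<integral>u. f (upr u ** geo t) \<partial>L) ((\<integral>M. f M \<partial>nu) / vol) < e"
    by eventually_elim (simp add: dist_real_def abs_less_iff)
qed

end

section \<open>A fundamental domain of the theta group\<close>

lemma group_SL2R: "group SL2R"
proof (rule groupI)
  fix M assume "M \<in> carrier SL2R"
  then have "det M = 1" by (simp add: SL2R_def)
  then show "\<exists>N\<in>carrier SL2R. N \<otimes>\<^bsub>SL2R\<^esub> M = \<one>\<^bsub>SL2R\<^esub>"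
    by (intro bexI[of _ "adj2 M"]) (simp_all add: SL2R_def adj2_mult)
qed (auto simp: SL2R_def det_mult_1 matrix_mul_assoc)

lemma inv_SL2R: "det M = 1 \<Longrightarrow> inv\<^bsub>SL2R\<^esub> M = adj2 M"
  using group.inv_equality[OF group_SL2R, of "adj2 M" M] by (simp add: SL2R_def adj2_mult)

lemma Gamma_theta_subgroup: "subgroup Gamma_theta SL2R"
  unfolding Gamma_theta_def by (rule group.generate_is_subgroup[OF group_SL2R]) (simp add: SL2R_def)

lemma Gamma_theta_det: "A \<in> Gamma_theta \<Longrightarrow> det A = 1"
  using subgroup.mem_carrier[OF Gamma_theta_subgroup] by (simp add: SL2R_def)

lemma Gamma_theta_mult: "A \<in> Gamma_theta \<Longrightarrow> B \<in> Gamma_theta \<Longrightarrow> A ** B \<in> Gamma_theta"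
  using subgroup.m_closed[OF Gamma_theta_subgroup] by (simp add: SL2R_def)

lemma Gamma_theta_one: "mat 1 \<in> Gamma_theta"
  using subgroup.one_closed[OF Gamma_theta_subgroup] by (simp add: SL2R_def)

lemma Gamma_theta_adj: "A \<in> Gamma_theta \<Longrightarrow> adj2 A \<in> Gamma_theta"
  using subgroup.m_inv_closed[OF Gamma_theta_subgroup] Gamma_theta_det by (simp add: inv_SL2R)

lemma Gamma_theta_S: "Smat \<in> Gamma_theta"
  unfolding Gamma_theta_def by (rule generate.incl) simp

lemma Gamma_theta_upr: "upr (2 * of_int k) \<in> Gamma_theta"
proof -
  have "upr (2 * of_nat n) \<in> Gamma_theta" for n :: nat
  proof (induction n)
    case 0 then show ?case using Gamma_theta_one by (simp add: mat_1_eq_mat2)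
  next
    case (Suc n)
    have "upr 2 \<in> Gamma_theta" unfolding Gamma_theta_def by (rule generate.incl) simp
    from Gamma_theta_mult[OF Suc this] show ?case by (simp add: algebra_simps)
  qed
  note nat = this
  show ?thesis
  proof (cases "k \<ge> 0")
    case True then show ?thesis using nat[of "nat k"] by simp
  next
    case False
    then show ?thesis using Gamma_theta_adj[OF nat[of "nat (- k)"]] by simp
  qed
qed

text \<open>The matrix is congruent to the identity or to \<open>Smat\<close> modulo 2. In
  particular the entries of each row have opposite parity, which is what \<open>form_gt\<close>
  consumes.\<close>

definition theta_parity :: "int \<Rightarrow> int \<Rightarrow> int \<Rightarrow> int \<Rightarrow> bool" where
  "theta_parity a b c d \<longleftrightarrow> (even a \<longleftrightarrow> even d) \<and> (even b \<longleftrightarrow> even c) \<and> (even a \<longleftrightarrow> odd b)"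

lemma Gamma_theta_parity:
  assumes "A \<in> Gamma_theta"
  shows "\<exists>a b c d. A = mat2 (of_int a) (of_int b) (of_int c) (of_int d) \<and> theta_parity a b c d"
  using assms unfolding Gamma_theta_def
proof (induction rule: generate.induct)
  case one
  then show ?case
    by (intro exI[of _ 1] exI[of _ 0]) (simp add: SL2R_def mat_1_eq_mat2 theta_parity_def)
next
  case (incl h)
  then have "h = mat2 (of_int 0) (of_int (- 1)) (of_int 1) (of_int 0) \<or>
      h = mat2 (of_int 1) (of_int 2) (of_int 0) (of_int 1)" by simp
  moreover have "theta_parity 0 (- 1) 1 0" "theta_parity 1 2 0 1" by (simp_all add: theta_parity_def)
  ultimately show ?case by blast
next
  case (inv h)
  then have "inv\<^bsub>SL2R\<^esub> h = mat2 (of_int 0) (of_int 1) (of_int (- 1)) (of_int 0) \<or>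
    inv\<^bsub>SL2R\<^esub> h = mat2 (of_int 1) (of_int (- 2)) (of_int 0) (of_int 1)"
    by (auto simp: inv_SL2R)
  moreover have "theta_parity 0 1 (- 1) 0" "theta_parity 1 (- 2) 0 1" by (simp_all add: theta_parity_def)
  ultimately show ?case by blast
next
  case (eng h1 h2)
  obtain a b c d where 1: "h1 = mat2 (of_int a) (of_int b) (of_int c) (of_int d)" "theta_parity a b c d"
    using eng.IH by blast
  obtain a' b' c' d' where 2: "h2 = mat2 (of_int a') (of_int b') (of_int c') (of_int d')" "theta_parity a' b' c' d'"
    using eng.IH by blast
  have "h1 \<otimes>\<^bsub>SL2R\<^esub> h2 = mat2 (of_int (a * a' + b * c')) (of_int (a * b' + b * d')) (of_int (c * a' + d * c')) (of_int (c * b' + d * d'))"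
    by (simp add: SL2R_def 1 2)
  moreover have "theta_parity (a * a' + b * c') (a * b' + b * d') (c * a' + d * c') (c * b' + d * d')"
    using 1(2) 2(2) by (auto simp: theta_parity_def)
  ultimately show ?case by blast
qed

lemma Gamma_theta_int: "A \<in> Gamma_theta \<Longrightarrow> A $ i $ j \<in> \<int>"
  using Gamma_theta_parity[of A] exhaust_2[of i] exhaust_2[of j] by auto

text \<open>In terms of the rows \<open>v\<close>, \<open>w\<close> of a matrix \<open>M\<close>, the point \<open>z = M i\<close> has \<open>|z|\<^sup>2 = |v|\<^sup>2/|w|\<^sup>2\<close>,
  \<open>Re z = v \<bullet> w / |w|\<^sup>2\<close> and \<open>Im z = 1 / |w|\<^sup>2\<close>.\<close>

definition theta_dom :: "(real^2^2) set" where
  "theta_dom = {M. det M = 1 \<and>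
     (M$1$1)\<^sup>2 + (M$1$2)\<^sup>2 > (M$2$1)\<^sup>2 + (M$2$2)\<^sup>2 \<and>
     (M$1$1 - 2 * M$2$1)\<^sup>2 + (M$1$2 - 2 * M$2$2)\<^sup>2 > (M$2$1)\<^sup>2 + (M$2$2)\<^sup>2 \<and>
     0 \<le> M$1$1 * M$2$1 + M$1$2 * M$2$2 \<and> M$1$1 * M$2$1 + M$1$2 * M$2$2 < 2 * ((M$2$1)\<^sup>2 + (M$2$2)\<^sup>2) \<and>
     (M$2$1 > 0 \<or> M$2$1 = 0 \<and> M$2$2 > 0)}"

lemma theta_dom_borel [measurable]: "theta_dom \<in> sets borel"
  unfolding theta_dom_def by measurable

text \<open>Opposite parity makes the absolute values of \<open>p\<close> and \<open>q\<close>
  differ. Replacing \<open>V\<close> by \<open>W\<close> and the mixed term by its worst case leaves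
  \<open>W\<close> times the square of that difference, at least \<open>W\<close>; the strict
  inequality comes from \<open>V > W\<close> and \<open>p\<close> nonzero.\<close>

lemma form_gt:
  fixes V W X :: real and p q :: int
  assumes "V > W" "W > 0" "\<bar>X\<bar> \<le> W" "p \<noteq> 0" "even p \<longleftrightarrow> odd q"
  shows "(of_int p)\<^sup>2 * V + 2 * of_int p * of_int q * X + (of_int q)\<^sup>2 * W > W"
proof -
  have ne: "\<bar>p\<bar> \<noteq> \<bar>q\<bar>" using assms(5) by (auto simp: abs_eq_iff)
  have "1 \<le> \<bar>\<bar>p\<bar> - \<bar>q\<bar>\<bar>" using ne by linarith
  then have "1 \<le> (\<bar>p\<bar> - \<bar>q\<bar>)\<^sup>2" using abs_le_square_iff[of 1 "\<bar>p\<bar> - \<bar>q\<bar>"] by simp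
  then have "real_of_int 1 \<le> of_int ((\<bar>p\<bar> - \<bar>q\<bar>)\<^sup>2)" by (simp only: of_int_le_iff)
  then have "1 \<le> ((of_int \<bar>p\<bar> - of_int \<bar>q\<bar>)\<^sup>2 :: real)" by simp
  then have "1 * W \<le> (of_int \<bar>p\<bar> - of_int \<bar>q\<bar>)\<^sup>2 * W" using assms(2) by (intro mult_right_mono) auto
  then have 1: "W \<le> (of_int p)\<^sup>2 * W - 2 * (\<bar>of_int p * of_int q\<bar> * W) + (of_int q)\<^sup>2 * W"
    by (simp add: power2_diff abs_mult algebra_simps)
  have 2: "(of_int p)\<^sup>2 * W < (of_int p)\<^sup>2 * V"
    using assms(1,4) by (intro mult_strict_left_mono) auto
  have "\<bar>of_int p * of_int q * X\<bar> \<le> \<bar>of_int p * of_int q\<bar> * W"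
    unfolding abs_mult[of "of_int p * of_int q" X] using assms(3) by (intro mult_left_mono) auto
  then have 3: "- (\<bar>of_int p * of_int q\<bar> * W) \<le> of_int p * of_int q * X" by linarith
  have "2 * of_int p * of_int q * X = 2 * (of_int p * of_int q * X)" by simp
  then show ?thesis using 1 2 3 by linarith
qed

text \<open>The inverse of the imaginary part of the point \<open>M i\<close>.\<close>

definition lower_sq :: "real^2^2 \<Rightarrow> real" where
  "lower_sq M = (M$2$1)\<^sup>2 + (M$2$2)\<^sup>2"

lemma lower_sq_pos: "det M = 1 \<Longrightarrow> lower_sq M > 0"
  by (cases M rule: mat2_cases) (auto simp: lower_sq_def sum_power2_gt_zero_iff)

text \<open>Moving a point of the domain by a group element that does not fix infinity strictly
  lowers its imaginary part. With rows \<open>v\<close>, \<open>w\<close> of \<open>M\<close> the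
  new value is the squared length of \<open>p v + q w\<close>, a binary form in \<open>p\<close> and
  \<open>q\<close>.\<close>

lemma theta_dom_lower_sq_gt:
  assumes M: "M \<in> theta_dom" and "p \<noteq> 0" "even p \<longleftrightarrow> odd q" and "A = mat2 r s (of_int p) (of_int q)"
  shows "lower_sq (A ** M) > lower_sq M"
proof -
  obtain a b c d where Meq: "M = mat2 a b c d" by (rule mat2_cases)
  define V where "V = a\<^sup>2 + b\<^sup>2"
  define W where "W = c\<^sup>2 + d\<^sup>2"
  define X where "X = a * c + b * d"
  have c: "V > W" "V - 4 * X + 4 * W > W" "0 \<le> X" "X < 2 * W"
    using M by (simp_all add: theta_dom_def Meq V_def W_def X_def power2_diff algebra_simps power2_eq_square)
  have "W > 0" using c by linarith
  have eq: "lower_sq (A ** M) = (of_int p)\<^sup>2 * V + 2 * of_int p * of_int q * X + (of_int q)\<^sup>2 * W"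
    unfolding assms(4) Meq lower_sq_def V_def W_def X_def by (simp add: power2_eq_square algebra_simps)
  show ?thesis
  proof (cases "X \<le> W")
    case True
    then show ?thesis unfolding eq using form_gt[of W V X p q] c assms \<open>W > 0\<close>
      by (simp add: lower_sq_def Meq W_def)
  next
    \<comment> \<open>For real part above 1 use the row \<open>v - 2 w\<close> in place of
      \<open>v\<close>, that is, \<open>z - 2\<close> in place of \<open>z\<close>, and the second
      circle; \<open>q\<close> becomes \<open>q + 2 p\<close>, of the same parity.\<close>
    case False
    have "(of_int p)\<^sup>2 * (V - 4 * X + 4 * W) + 2 * of_int p * of_int (q + 2 * p) * (X - 2 * W) + (of_int (q + 2 * p))\<^sup>2 * W > W"
      using c assms \<open>W > 0\<close> False by (intro form_gt) auto
    also have "(of_int p)\<^sup>2 * (V - 4 * X + 4 * W) + 2 * of_int p * of_int (q + 2 * p) * (X - 2 * W) + (of_int (q + 2 * p))\<^sup>2 * W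
        = lower_sq (A ** M)"
      unfolding eq by (simp add: power2_eq_square algebra_simps)
    finally show ?thesis by (simp add: lower_sq_def Meq W_def)
  qed
qed

text \<open>If \<open>A\<close> did not fix infinity, then both \<open>A\<close> and its inverse
  would strictly lower the imaginary part. Otherwise \<open>A\<close> is up to sign an even
  translation, and the strip has width 2.\<close>

lemma theta_dom_unique:
  assumes A: "A \<in> Gamma_theta" and M: "M \<in> theta_dom" and AM: "A ** M \<in> theta_dom"
  shows "A = mat 1"
proof -
  obtain r s p q where Aeq: "A = mat2 (of_int r) (of_int s) (of_int p) (of_int q)" and par: "theta_parity r s p q"
    using Gamma_theta_parity[OF A] by blast
  have detA: "det A = 1" by (rule Gamma_theta_det[OF A])
  then have "real_of_int (r * q - s * p) = 1" by (simp add: Aeq)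
  then have det: "r * q - s * p = 1" by (metis of_int_eq_1_iff)
  have "p = 0"
  proof (rule ccontr)
    assume "p \<noteq> 0"
    then have "lower_sq (A ** M) > lower_sq M"
      using par by (intro theta_dom_lower_sq_gt[OF M _ _ Aeq]) (auto simp: theta_parity_def)
    moreover have "lower_sq (adj2 A ** (A ** M)) > lower_sq (A ** M)"
      using \<open>p \<noteq> 0\<close> par
      by (intro theta_dom_lower_sq_gt[OF AM, where p = "- p" and q = r]) (auto simp: theta_parity_def Aeq)
    ultimately show False using detA by simp
  qed
  then have rq: "r * q = 1" using det by simp
  obtain a b c d where Meq: "M = mat2 a b c d" by (rule mat2_cases)
  \<comment> \<open>The sign condition on the bottom row in \<open>theta_dom\<close> selects one of
    \<open>M\<close> and \<open>- M\<close>; the negative identity is in the group as the square of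
    \<open>Smat\<close>.\<close>
  have "q = 1"
  proof (rule ccontr)
    assume "q \<noteq> 1"
    then have "q = - 1" using rq by (auto simp: zmult_eq_1_iff)
    then show False using M AM by (auto simp: theta_dom_def Aeq Meq \<open>p = 0\<close>)
  qed
  then have "r = 1" using rq by simp
  have AMeq: "A ** M = mat2 (a + of_int s * c) (b + of_int s * d) c d"
    by (simp add: Aeq Meq \<open>p = 0\<close> \<open>q = 1\<close> \<open>r = 1\<close>)
  define W where "W = c\<^sup>2 + d\<^sup>2"
  define X where "X = a * c + b * d"
  have X: "0 \<le> X" "X < 2 * W" "0 \<le> X + of_int s * W" "X + of_int s * W < 2 * W"
    using M[unfolded Meq] AM[unfolded AMeq]
    by (simp_all add: theta_dom_def W_def X_def algebra_simps power2_eq_square)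
  then have "W > 0" by linarith
  have "even s" using par \<open>r = 1\<close> by (auto simp: theta_parity_def)
  have "real_of_int s * W < 2 * W" "(- 2) * W < real_of_int s * W" using X by linarith+
  then have "real_of_int s < 2" "- 2 < real_of_int s"
    using \<open>W > 0\<close> by (simp_all only: mult_less_cancel_right_pos)
  then have "s < 2" "- 2 < s" by linarith+
  then have "s = 0" using \<open>even s\<close> by presburger
  then show ?thesis by (simp add: Aeq \<open>p = 0\<close> \<open>q = 1\<close> \<open>r = 1\<close> mat_1_eq_mat2)
qed

text \<open>A bound on \<open>lower_sq (A ** M)\<close> bounds the integral bottom row of
  \<open>A\<close>, because \<open>M\<close> is invertible. So only finitely many values lie below
  that of \<open>M\<close>, and the infimum is attained.\<close>

lemma Gamma_theta_lower_sq_min: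
  assumes "det M = 1"
  shows "\<exists>A\<in>Gamma_theta. \<forall>A'\<in>Gamma_theta. lower_sq (A ** M) \<le> lower_sq (A' ** M)"
proof -
  obtain a b c d where Meq: "M = mat2 a b c d" by (rule mat2_cases)
  define R where "R = lower_sq M"
  define G where "G = {A \<in> Gamma_theta. lower_sq (A ** M) \<le> R}"
  define B where "B = \<lceil>(R + 1) * (\<bar>a\<bar> + \<bar>b\<bar> + \<bar>c\<bar> + \<bar>d\<bar>)\<rceil>"
  have R: "R \<ge> 0" by (simp add: R_def lower_sq_def)
  have det: "a * d - b * c = 1" using assms by (simp add: Meq)
  have "(\<lambda>A. lower_sq (A ** M)) ` G \<subseteq>
     (\<lambda>(p, q). (of_int p * a + of_int q * c)\<^sup>2 + (of_int p * b + of_int q * d)\<^sup>2) ` ({- B..B} \<times> {- B..B})"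
  proof (rule image_subsetI)
    fix A assume "A \<in> G"
    then have A: "A \<in> Gamma_theta" "lower_sq (A ** M) \<le> R" by (auto simp: G_def)
    obtain r s p q where Aeq: "A = mat2 (of_int r) (of_int s) (of_int p) (of_int q)"
      using Gamma_theta_parity[OF A(1)] by blast
    define y where "y = of_int p * a + of_int q * c"
    define z where "z = of_int p * b + of_int q * d"
    have eq: "lower_sq (A ** M) = y\<^sup>2 + z\<^sup>2" by (simp add: Aeq Meq lower_sq_def y_def z_def)
    have small: "\<bar>x\<bar> \<le> R + 1" if "x\<^sup>2 \<le> R" for x :: real
    proof -
      have "0 \<le> (\<bar>x\<bar> - 1)\<^sup>2" by simp
      then have "2 * \<bar>x\<bar> \<le> x\<^sup>2 + 1" by (simp add: power2_diff)
      then show ?thesis using that R by linarith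
    qed
    have "y\<^sup>2 \<le> R" "z\<^sup>2 \<le> R" using A(2) eq zero_le_power2[of y] zero_le_power2[of z] by linarith+
    then have yz: "\<bar>y\<bar> \<le> R + 1" "\<bar>z\<bar> \<le> R + 1" by (simp_all add: small)
    have lin: "\<bar>y * k - z * l\<bar> \<le> (R + 1) * (\<bar>k\<bar> + \<bar>l\<bar>)" for k l
    proof -
      have "\<bar>y * k - z * l\<bar> \<le> \<bar>y\<bar> * \<bar>k\<bar> + \<bar>z\<bar> * \<bar>l\<bar>" by (metis abs_mult abs_triangle_ineq4)
      also have "\<dots> \<le> (R + 1) * \<bar>k\<bar> + (R + 1) * \<bar>l\<bar>" using yz by (intro add_mono mult_right_mono) auto
      finally show ?thesis by (simp add: distrib_left)
    qed
    \<comment> \<open>Cramer's rule recovers the bottom row \<open>(p, q)\<close> of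
      \<open>A\<close> from its product \<open>(y, z)\<close> with \<open>M\<close>.\<close>
    have "y * d - z * c = of_int p * (a * d - b * c)" by (simp add: y_def z_def algebra_simps)
    then have p: "of_int p = y * d - z * c" using det by simp
    have "y * (- b) - z * (- a) = of_int q * (a * d - b * c)" by (simp add: y_def z_def algebra_simps)
    then have q: "of_int q = y * (- b) - z * (- a)" using det by simp
    have "(R + 1) * (\<bar>d\<bar> + \<bar>c\<bar>) \<le> (R + 1) * (\<bar>a\<bar> + \<bar>b\<bar> + \<bar>c\<bar> + \<bar>d\<bar>)"
      "(R + 1) * (\<bar>- b\<bar> + \<bar>- a\<bar>) \<le> (R + 1) * (\<bar>a\<bar> + \<bar>b\<bar> + \<bar>c\<bar> + \<bar>d\<bar>)"
      using R by (intro mult_left_mono; simp)+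
    then have "\<bar>real_of_int p\<bar> \<le> (R + 1) * (\<bar>a\<bar> + \<bar>b\<bar> + \<bar>c\<bar> + \<bar>d\<bar>)"
      "\<bar>real_of_int q\<bar> \<le> (R + 1) * (\<bar>a\<bar> + \<bar>b\<bar> + \<bar>c\<bar> + \<bar>d\<bar>)"
      using lin[of d c] lin[of "- b" "- a"] unfolding p q by linarith+
    then have "\<bar>real_of_int p\<bar> \<le> of_int B" "\<bar>real_of_int q\<bar> \<le> of_int B"
      unfolding B_def by (meson le_of_int_ceiling order_trans)+
    then have "\<bar>p\<bar> \<le> B" "\<bar>q\<bar> \<le> B" by (metis of_int_abs of_int_le_iff)+
    then show "lower_sq (A ** M) \<in> (\<lambda>(p, q). (of_int p * a + of_int q * c)\<^sup>2 + (of_int p * b + of_int q * d)\<^sup>2) ` ({- B..B} \<times> {- B..B})"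
      unfolding eq by (intro image_eqI[of _ _ "(p, q)"]) (auto simp: y_def z_def)
  qed
  then have fin: "finite ((\<lambda>A. lower_sq (A ** M)) ` G)" by (rule finite_subset) simp
  have "mat 1 \<in> G" by (simp add: G_def Gamma_theta_one R_def)
  then have ne: "(\<lambda>A. lower_sq (A ** M)) ` G \<noteq> {}" by blast
  obtain A where A: "A \<in> G" "lower_sq (A ** M) = Min ((\<lambda>A. lower_sq (A ** M)) ` G)"
    using Min_in[OF fin ne] by auto
  have "lower_sq (A ** M) \<le> lower_sq (A' ** M)" if "A' \<in> Gamma_theta" for A'
  proof (cases "A' \<in> G")
    case True then show ?thesis unfolding A(2) using fin by (intro Min_le) auto
  next
    case False then show ?thesis using A(1) that by (auto simp: G_def)
  qed
  then show ?thesis using A(1) by (auto simp: G_def)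
qed

text \<open>Take a point of the orbit with maximal imaginary part and translate it into the strip.
  Maximality against inversion in each of the two circles puts it outside or on them; the two
  hypotheses of genericity exclude the circles themselves.\<close>

lemma theta_dom_exists:
  assumes M: "det M = 1"
    and gen: "\<And>A. A \<in> Gamma_theta \<Longrightarrow> lower_sq (Smat ** (A ** M)) \<noteq> lower_sq (A ** M)"
      "\<And>A. A \<in> Gamma_theta \<Longrightarrow> lower_sq (Smat ** (upr (- 2) ** (A ** M))) \<noteq> lower_sq (A ** M)"
  shows "\<exists>A\<in>Gamma_theta. A ** M \<in> theta_dom"
proof -
  obtain A where A: "A \<in> Gamma_theta" "\<And>A'. A' \<in> Gamma_theta \<Longrightarrow> lower_sq (A ** M) \<le> lower_sq (A' ** M)"
    using Gamma_theta_lower_sq_min[OF M] by blast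
  obtain a b c d where Neq: "A ** M = mat2 a b c d" by (rule mat2_cases)
  have det: "a * d - b * c = 1" using det_mult_1[OF Gamma_theta_det[OF A(1)] M] Neq by simp
  define W where "W = c\<^sup>2 + d\<^sup>2"
  have W: "W > 0" using lower_sq_pos[OF det_mult_1[OF Gamma_theta_det[OF A(1)] M]] by (simp add: Neq lower_sq_def W_def)
  \<comment> \<open>The real part is \<open>(a * c + b * d) / W\<close>; adding \<open>2 * k\<close>
    brings it into the interval from 0 to 2.\<close>
  define k where "k = - \<lfloor>(a * c + b * d) / (2 * W)\<rfloor>"
  \<comment> \<open>The sign that makes the bottom row satisfy the last condition of
    \<open>theta_dom\<close>.\<close>
  define \<epsilon> :: real where "\<epsilon> = (if c > 0 \<or> c = 0 \<and> d > 0 then 1 else - 1)"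
  define A1 where "A1 = mat2 \<epsilon> 0 0 \<epsilon> ** (upr (2 * of_int k) ** A)"
  have "Smat ** Smat = mat2 (- 1) 0 0 (- 1)" by simp
  then have "mat2 \<epsilon> 0 0 \<epsilon> \<in> Gamma_theta"
    using Gamma_theta_mult[OF Gamma_theta_S Gamma_theta_S] Gamma_theta_one by (auto simp: \<epsilon>_def mat_1_eq_mat2)
  then have A1: "A1 \<in> Gamma_theta" unfolding A1_def by (intro Gamma_theta_mult Gamma_theta_upr A(1))
  have A1M: "A1 ** M = mat2 (\<epsilon> * (a + 2 * of_int k * c)) (\<epsilon> * (b + 2 * of_int k * d)) (\<epsilon> * c) (\<epsilon> * d)"
    by (simp add: A1_def matrix_mul_assoc[symmetric] Neq)
  have eps: "\<epsilon> * \<epsilon> = 1" "\<epsilon>\<^sup>2 = 1" by (auto simp: \<epsilon>_def)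
  have low: "lower_sq (A1 ** M) = W" "lower_sq (A ** M) = W"
    by (simp_all add: A1M Neq lower_sq_def power_mult_distrib eps W_def)
  define a' where "a' = a + 2 * of_int k * c"
  define b' where "b' = b + 2 * of_int k * d"
  have A1M': "A1 ** M = mat2 (\<epsilon> * a') (\<epsilon> * b') (\<epsilon> * c) (\<epsilon> * d)" by (simp add: A1M a'_def b'_def)
  have "lower_sq (Smat ** (A1 ** M)) = a'\<^sup>2 + b'\<^sup>2"
    by (simp add: A1M' lower_sq_def power_mult_distrib eps)
  moreover have "W \<le> lower_sq ((Smat ** A1) ** M)"
    using A(2)[OF Gamma_theta_mult[OF Gamma_theta_S A1]] low by simp
  ultimately have 1: "a'\<^sup>2 + b'\<^sup>2 > W" using gen(1)[OF A1] low by (simp add: matrix_mul_assoc[symmetric])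
  have "lower_sq (Smat ** (upr (- 2) ** (A1 ** M))) = (\<epsilon> * (a' - 2 * c))\<^sup>2 + (\<epsilon> * (b' - 2 * d))\<^sup>2"
    by (simp add: A1M' lower_sq_def algebra_simps)
  then have eq2: "lower_sq (Smat ** (upr (- 2) ** (A1 ** M))) = (a' - 2 * c)\<^sup>2 + (b' - 2 * d)\<^sup>2"
    by (simp add: power_mult_distrib eps)
  have "upr (- 2) \<in> Gamma_theta" using Gamma_theta_upr[of "- 1"] by simp
  then have "W \<le> lower_sq ((Smat ** (upr (- 2) ** A1)) ** M)"
    using A(2)[of "Smat ** (upr (- 2) ** A1)"] Gamma_theta_mult Gamma_theta_S A1 low by simp
  then have 2: "(a' - 2 * c)\<^sup>2 + (b' - 2 * d)\<^sup>2 > W"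
    using gen(2)[OF A1] eq2 low by (simp add: matrix_mul_assoc[symmetric])
  define x where "x = (a * c + b * d) / (2 * W)"
  have "a' * c + b' * d = (a * c + b * d) + 2 * of_int k * W"
    by (simp add: a'_def b'_def W_def power2_eq_square algebra_simps)
  also have "a * c + b * d = 2 * W * x" using W by (simp add: x_def)
  also have "2 * W * x + 2 * of_int k * W = 2 * W * (x - of_int \<lfloor>x\<rfloor>)"
    unfolding k_def x_def[symmetric] by (simp add: algebra_simps)
  finally have eq3: "a' * c + b' * d = 2 * W * (x - of_int \<lfloor>x\<rfloor>)" .
  have fl: "0 \<le> x - of_int \<lfloor>x\<rfloor>" "x - of_int \<lfloor>x\<rfloor> < 1" by linarith+
  have 3: "0 \<le> a' * c + b' * d" "a' * c + b' * d < 2 * W"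
    unfolding eq3 using W fl mult_strict_left_mono[OF fl(2), of "2 * W"] by simp_all
  have 4: "\<epsilon> * c > 0 \<or> \<epsilon> * c = 0 \<and> \<epsilon> * d > 0"
    using det by (auto simp: \<epsilon>_def not_less le_less)
  have *: "(\<epsilon> * x)\<^sup>2 = x\<^sup>2" "\<epsilon> * x * (\<epsilon> * y) = x * y" for x y
    using eps by (simp_all add: power_mult_distrib)
  have "A1 ** M \<in> theta_dom"
    unfolding theta_dom_def mem_Collect_eq
  proof (intro conjI)
    show "det (A1 ** M) = 1" by (rule det_mult_1[OF Gamma_theta_det[OF A1] M])
    show "(A1 ** M) $ 2 $ 1 > 0 \<or> (A1 ** M) $ 2 $ 1 = 0 \<and> (A1 ** M) $ 2 $ 2 > 0"
      using 4 by (simp add: A1M')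
  qed (use 1 2 3 in \<open>simp_all add: A1M' * W_def right_diff_distrib[symmetric] flip: mult.left_commute[of \<epsilon> 2]\<close>)
  then show ?thesis using A1 by blast
qed

lemma AE_quadratic_neq:
  fixes A B C :: real assumes "A \<noteq> 0"
  shows "AE u in lborel. A * u\<^sup>2 + B * u + C \<noteq> 0"
proof -
  have "finite {u. poly [:C, B, A:] u = 0}" using assms by (intro poly_roots_finite) auto
  then have "{u. poly [:C, B, A:] u = 0} \<in> null_sets lborel"
    by (intro countable_imp_null_set_lborel countable_finite)
  then show ?thesis by (rule AE_I') (auto simp: power2_eq_square algebra_simps)
qed

text \<open>For a fixed bottom row, lying on a boundary circle is a quadratic equation in
  \<open>u\<close> with leading coefficient \<open>c^2 + d^2\<close>, so it has finitely many
  solutions. Since the group is countable, almost every \<open>M\<close> avoids the circles together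
  with its whole orbit.\<close>

lemma theta_dom_fundamental: "AE M in haar. \<exists>A\<in>Gamma_theta. A ** M \<in> theta_dom"
proof -
  have cnt: "countable Gamma_theta"
    using countable_Ints_mat2 by (rule countable_subset[rotated]) (auto intro: Gamma_theta_int)
  have [measurable]: "lower_sq \<in> borel_measurable borel" unfolding lower_sq_def by measurable
  have 1: "AE M in haar. lower_sq (Smat ** M) \<noteq> lower_sq M"
  proof (rule AE_haar_chartI)
    fix c d :: real assume "d \<noteq> 0" "c \<noteq> 0"
    then have "c\<^sup>2 + d\<^sup>2 \<noteq> 0" by simp
    from AE_quadratic_neq[OF this, of "2 * c / d" "1 / d\<^sup>2 - (c\<^sup>2 + d\<^sup>2)"]
    show "AE u in lborel. lower_sq (Smat ** chart (c, d, u)) \<noteq> lower_sq (chart (c, d, u))"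
      by eventually_elim (use \<open>d \<noteq> 0\<close> in \<open>simp add: chart_def lower_sq_def power2_eq_square algebra_simps\<close>)
  qed measurable
  have "AE M in haar. lower_sq (Smat ** (upr (- 2) ** M)) \<noteq> lower_sq (upr (- 2) ** M)"
    by (rule AE_haar_left[OF 1]) simp
  moreover have "lower_sq (upr (- 2) ** M) = lower_sq M" for M
    by (cases M rule: mat2_cases) (simp add: lower_sq_def)
  ultimately have 2: "AE M in haar. lower_sq (Smat ** (upr (- 2) ** M)) \<noteq> lower_sq M" by simp
  have "AE M in haar. \<forall>A\<in>Gamma_theta. lower_sq (Smat ** (A ** M)) \<noteq> lower_sq (A ** M) \<and>
      lower_sq (Smat ** (upr (- 2) ** (A ** M))) \<noteq> lower_sq (A ** M)"
    using AE_haar_left[OF AE_conjI[OF 1 2]] Gamma_theta_det by (subst AE_ball_countable[OF cnt]) blast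
  with AE_haar_det show ?thesis
    by eventually_elim (rule theta_dom_exists; blast)
qed


section \<open>Iwasawa coordinates and the area of the fundamental domain\<close>

lemma nn_integral_substitution_image:
  fixes f :: "real \<Rightarrow> ennreal" and A B :: "nat \<Rightarrow> real"
  assumes [measurable]: "f \<in> borel_measurable borel" "g \<in> borel_measurable borel" "g' \<in> borel_measurable borel"
    and deriv: "\<And>x. x \<in> S \<Longrightarrow> (g has_real_derivative g' x) (at x)"
    and cont: "continuous_on S g'" and nonneg: "\<And>x. x \<in> S \<Longrightarrow> g' x \<ge> 0"
    and AB: "\<And>n. A n < B n" "decseq A" "incseq B"
    and S: "S = (\<Union>n. {A n..B n})"
  shows "(\<integral>\<^sup>+x. f x * indicator (g ` S) x \<partial>lborel) = (\<integral>\<^sup>+x. f (g x) * g' x * indicator S x \<partial>lborel)"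
proof (rule nn_integral_substitution_exhaust[OF assms])
  show "g ` S = (\<Union>n. {g (A n)..g (B n)})"
  proof (intro equalityI subsetI)
    fix y assume "y \<in> g ` S"
    then obtain x n where x: "y = g x" "A n \<le> x" "x \<le> B n" using S by auto
    have "g u \<le> g v" if "u \<le> v" "A n \<le> u" "v \<le> B n" for u v
    proof (rule DERIV_nonneg_imp_nondecreasing[OF that(1)])
      fix z assume "u \<le> z" "z \<le> v"
      then have "z \<in> {A n..B n}" using that by auto
      then have "z \<in> S" using S by blast
      then show "\<exists>w. DERIV g z :> w \<and> w \<ge> 0" using deriv nonneg by blast
    qed
    then show "y \<in> (\<Union>n. {g (A n)..g (B n)})" using x by auto
  next
    fix y assume "y \<in> (\<Union>n. {g (A n)..g (B n)})"
    then obtain n where n: "g (A n) \<le> y" "y \<le> g (B n)" by auto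
    have sub: "{A n..B n} \<subseteq> S" using S by blast
    then have "continuous_on {A n..B n} g"
      using deriv by (intro continuous_at_imp_continuous_on) (auto intro: DERIV_isCont)
    then obtain x where "A n \<le> x" "x \<le> B n" "g x = y"
      using IVT'[of g "A n" y "B n"] n AB(1)[of n] by auto
    then show "y \<in> g ` S" using sub by auto
  qed
qed auto

text \<open>The offset 3 keeps the first interval nondegenerate; with 2 it would shrink to the
  midpoint.\<close>

lemma Un_Icc_Ioo:
  fixes a b :: real assumes "a < b"
  shows "{a<..<b} = (\<Union>n. {a + (b - a) / real (n + 3)..b - (b - a) / real (n + 3)})"
proof (intro equalityI subsetI)
  fix x assume "x \<in> {a<..<b}"
  then have x: "x - a > 0" "b - x > 0" by auto
  obtain n where n: "(b - a) / min (x - a) (b - x) \<le> real n" using real_arch_simple by blast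
  have "b - a \<le> real n * min (x - a) (b - x)" using n x by (simp add: divide_le_eq)
  also have "\<dots> \<le> real (n + 3) * min (x - a) (b - x)" using x by (intro mult_right_mono) auto
  finally have le: "b - a \<le> min (x - a) (b - x) * real (n + 3)" by (simp only: mult.commute)
  have "(b - a) / real (n + 3) \<le> min (x - a) (b - x)"
    by (rule iffD2[OF pos_divide_le_eq le]) simp
  then show "x \<in> (\<Union>n. {a + (b - a) / real (n + 3)..b - (b - a) / real (n + 3)})"
    by (intro UN_I[of n]) auto
next
  fix x assume "x \<in> (\<Union>n. {a + (b - a) / real (n + 3)..b - (b - a) / real (n + 3)})"
  then obtain n where "a + (b - a) / real (n + 3) \<le> x" "x \<le> b - (b - a) / real (n + 3)" by auto
  moreover have "(b - a) / real (n + 3) > 0" using assms by simp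
  ultimately show "x \<in> {a<..<b}" unfolding greaterThanLessThan_iff by linarith
qed

lemma nn_integral_substitution_Ioo:
  fixes f :: "real \<Rightarrow> ennreal"
  assumes "f \<in> borel_measurable borel" "g \<in> borel_measurable borel" "g' \<in> borel_measurable borel"
    and "\<And>x. x \<in> {a<..<b} \<Longrightarrow> (g has_real_derivative g' x) (at x)"
    and "continuous_on {a<..<b} g'" and "\<And>x. x \<in> {a<..<b} \<Longrightarrow> g' x \<ge> 0" and "a < b"
  shows "(\<integral>\<^sup>+x. f x * indicator (g ` {a<..<b}) x \<partial>lborel) = (\<integral>\<^sup>+x. f (g x) * g' x * indicator {a<..<b} x \<partial>lborel)"
proof (rule nn_integral_substitution_image[OF assms(1-6) _ _ _ Un_Icc_Ioo[OF \<open>a < b\<close>]])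
  show "a + (b - a) / real (n + 3) < b - (b - a) / real (n + 3)" for n
  proof -
    define \<delta> where "\<delta> = (b - a) / real (n + 3)"
    have "\<delta> \<le> (b - a) / 3" unfolding \<delta>_def using \<open>a < b\<close> by (intro divide_left_mono) auto
    then show ?thesis unfolding \<delta>_def[symmetric] using \<open>a < b\<close> by (simp add: field_simps)
  qed
  show "decseq (\<lambda>n. a + (b - a) / real (n + 3))" "incseq (\<lambda>n. b - (b - a) / real (n + 3))"
    using \<open>a < b\<close> by (auto simp: decseq_def incseq_def intro!: divide_left_mono)
qed

text \<open>The negative cotangent is the tangent of \<open>\<phi> - pi / 2\<close>; the shift moves
  the interval to that of the Iwasawa angle.\<close>

lemma nn_integral_tan:
  fixes f :: "real \<Rightarrow> ennreal"
  assumes [measurable]: "f \<in> borel_measurable borel"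
  shows "(\<integral>\<^sup>+x. f x \<partial>lborel) = (\<integral>\<^sup>+\<phi>. f (- (cos \<phi> / sin \<phi>)) * ennreal (1 / (sin \<phi>)\<^sup>2) * indicator {0<..<pi} \<phi> \<partial>lborel)"
proof -
  have img: "tan ` {- (pi / 2)<..<pi / 2} = UNIV"
  proof (intro equalityI subsetI UNIV_I)
    fix x :: real show "x \<in> tan ` {- (pi / 2)<..<pi / 2}"
      using arctan_bounded[of x] by (intro image_eqI[of _ _ "arctan x"]) (auto simp: tan_arctan)
  qed
  have cos: "cos x \<noteq> 0" if "x \<in> {- (pi / 2)<..<pi / 2}" for x
    using that cos_gt_zero_pi[of x] by auto
  have [measurable]: "(tan :: real \<Rightarrow> real) \<in> borel_measurable borel"
    unfolding tan_def by measurable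
  have "(\<integral>\<^sup>+x. f x \<partial>lborel) = (\<integral>\<^sup>+x. f x * indicator (tan ` {- (pi / 2)<..<pi / 2}) x \<partial>lborel)"
    by (simp add: img)
  also have "\<dots> = (\<integral>\<^sup>+x. f (tan x) * ennreal (1 / (cos x)\<^sup>2) * indicator {- (pi / 2)<..<pi / 2} x \<partial>lborel)"
  proof (rule nn_integral_substitution_Ioo)
    show "(tan has_real_derivative 1 / (cos x)\<^sup>2) (at x)" if "x \<in> {- (pi / 2)<..<pi / 2}" for x
      using DERIV_tan[OF cos[OF that]] by (simp add: inverse_eq_divide)
    show "continuous_on {- (pi / 2)<..<pi / 2} (\<lambda>x. 1 / (cos x)\<^sup>2)"
      using cos by (intro continuous_intros) auto
  qed auto
  also have "\<dots> = (\<integral>\<^sup>+x. f (tan (x + - (pi / 2))) * ennreal (1 / (cos (x + - (pi / 2)))\<^sup>2) * indicator {- (pi / 2)<..<pi / 2} (x + - (pi / 2)) \<partial>lborel)"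
    by (rule nn_integral_lborel_shift[symmetric]) measurable
  also have "\<dots> = (\<integral>\<^sup>+\<phi>. f (- (cos \<phi> / sin \<phi>)) * ennreal (1 / (sin \<phi>)\<^sup>2) * indicator {0<..<pi} \<phi> \<partial>lborel)"
    by (intro nn_integral_cong) (auto simp: indicator_def tan_def sin_diff cos_diff)
  finally show ?thesis .
qed

text \<open>The map \<open>s / sqrt y\<close> is decreasing in \<open>y\<close>, whereas the
  substitution rule handles increasing maps, hence the detour through the variable
  \<open>- y\<close>.\<close>

lemma nn_integral_inverse_sqrt:
  fixes f :: "real \<Rightarrow> ennreal"
  assumes [measurable]: "f \<in> borel_measurable borel" and s: "s > 0"
  shows "(\<integral>\<^sup>+x. f x * indicator {0<..} x \<partial>lborel) =
    (\<integral>\<^sup>+y. f (s / sqrt y) * ennreal (s / (2 * y * sqrt y)) * indicator {0<..} y \<partial>lborel)"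
proof -
  have img: "(\<lambda>w. s / sqrt (- w)) ` {..<0} = {0<..}"
  proof (intro equalityI subsetI)
    fix x :: real assume "x \<in> {0<..}"
    then show "x \<in> (\<lambda>w. s / sqrt (- w)) ` {..<0}"
      using s by (intro image_eqI[of _ _ "- ((s / x)\<^sup>2)"]) auto
  qed (use s in auto)
  have "(\<integral>\<^sup>+x. f x * indicator {0<..} x \<partial>lborel) = (\<integral>\<^sup>+x. f x * indicator ((\<lambda>w. s / sqrt (- w)) ` {..<0}) x \<partial>lborel)"
    by (simp add: img)
  also have "\<dots> = (\<integral>\<^sup>+w. f (s / sqrt (- w)) * ennreal (s / (2 * (- w) * sqrt (- w))) * indicator {..<0} w \<partial>lborel)"
  proof (rule nn_integral_substitution_image[where A = "\<lambda>n. - real (n + 2)" and B = "\<lambda>n. - (1 / real (n + 2))"])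
    fix w :: real assume "w \<in> {..<0}"
    then have w: "- w > 0" by simp
    show "((\<lambda>w. s / sqrt (- w)) has_real_derivative s / (2 * (- w) * sqrt (- w))) (at w)"
      using w by (auto intro!: derivative_eq_intros simp: field_simps)
    show "0 \<le> s / (2 * (- w) * sqrt (- w))" using w s by (intro divide_nonneg_nonneg mult_nonneg_nonneg) auto
  next
    show "continuous_on {..<0} (\<lambda>w. s / (2 * (- w) * sqrt (- w)))" by (intro continuous_intros) auto
    show "- real (n + 2) < - (1 / real (n + 2))" for n
      unfolding neg_less_iff_less
      using mult_strict_mono[of 1 "real (n + 2)" 1 "real (n + 2)"] by (simp add: divide_less_eq)
    show "decseq (\<lambda>n. - real (n + 2))" "incseq (\<lambda>n. - (1 / real (n + 2)))"
      by (auto simp: decseq_def incseq_def frac_le)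
    have "uminus ` {0<..} = (\<Union>n. uminus ` {1 / real (n + 2)..real (n + 2)})"
      unfolding Un_Icc_inverse_Suc[symmetric] by blast
    then show "{..<0} = (\<Union>n. {- real (n + 2)..- (1 / real (n + 2))})" by simp
  qed auto
  also have "\<dots> = (\<integral>\<^sup>+y. f (s / sqrt y) * ennreal (s / (2 * y * sqrt y)) * indicator {0<..} y \<partial>lborel)"
    by (subst nn_integral_real_affine[where c = "-1" and t = 0])
       (auto simp: indicator_def intro!: nn_integral_cong)
  finally show ?thesis .
qed

lemma iwasawa_eq:
  assumes "y > 0"
  shows "iwasawa (x, y, \<phi>) = upr x ** mat2 (sqrt y * cos \<phi>) (- sqrt y * sin \<phi>) (sin \<phi> / sqrt y) (cos \<phi> / sqrt y)"
  by (simp add: iwasawa_def matrix_mul_assoc[symmetric])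

lemma measurable_iwasawa [measurable (raw)]:
  assumes [measurable]: "f \<in> borel_measurable M" "g \<in> borel_measurable M" "h \<in> borel_measurable M"
  shows "(\<lambda>x. iwasawa (f x, g x, h x)) \<in> borel_measurable M"
  unfolding iwasawa_def prod.case by measurable

text \<open>The bottom row is \<open>(sin \<phi>, cos \<phi>) / sqrt y\<close>, so
  \<open>dc dd\<close> becomes \<open>dy d\<phi> / (2 * y^2)\<close>; this is the origin of the
  factor 1/2. A positive lower left entry corresponds to angles between 0 and
  \<open>pi\<close>.\<close>

lemma nn_integral_haar_iwasawa:
  assumes [measurable]: "f \<in> borel_measurable borel"
  shows "(\<integral>\<^sup>+M. indicator {0<..} (M$2$1) * f M \<partial>haar) =
    (\<integral>\<^sup>+\<phi>. \<integral>\<^sup>+y. \<integral>\<^sup>+x. indicator {0<..<pi} \<phi> * (indicator {0<..} y * (ennreal (1 / (2 * y\<^sup>2)) * f (iwasawa (x, y, \<phi>)))) \<partial>lborel \<partial>lborel \<partial>lborel)"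
proof -
  \<comment> \<open>The matrix with bottom row \<open>(c, d)\<close> and orthogonal rows, so that
    the corresponding point has real part 0 and \<open>x\<close> measures the translation from
    it.\<close>
  define frame where "frame c d = mat2 (d / (c\<^sup>2 + d\<^sup>2)) (- c / (c\<^sup>2 + d\<^sup>2)) c d" for c d
  define g where "g c d = (\<integral>\<^sup>+x. f (upr x ** frame c d) \<partial>lborel)" for c d
  have [measurable]: "(\<lambda>x. frame (h x) (k x)) \<in> borel_measurable M"
    if [measurable]: "h \<in> borel_measurable M" "k \<in> borel_measurable M" for h k and M :: "'z measure"
    unfolding frame_def by measurable
  have g_meas [measurable (raw)]: "(\<lambda>x. g (h x) (k x)) \<in> borel_measurable M"
    if [measurable]: "h \<in> borel_measurable M" "k \<in> borel_measurable M" for h k and M :: "'z measure"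
    unfolding g_def frame_def by measurable
  \<comment> \<open>For a fixed bottom row \<open>u\<close> and \<open>x\<close> differ by a
    constant.\<close>
  have 1: "(\<integral>\<^sup>+u. f (chart (c, d, u)) \<partial>lborel) = g c d" if "d \<noteq> 0" for c d
  proof -
    define W where "W = c\<^sup>2 + d\<^sup>2"
    have W: "W > 0" using that by (simp add: W_def add_nonneg_pos)
    have "d / W + c\<^sup>2 / (d * W) = (d\<^sup>2 + c\<^sup>2) / (d * W)" using that W by (simp add: field_simps power2_eq_square)
    also have "\<dots> = 1 / d" using W by (simp add: W_def add.commute)
    finally have "1 / d = d / W + c\<^sup>2 / (d * W)" by simp
    then have "chart (c, d, u) = upr (u + c / (d * W)) ** frame c d" for u
      using that W unfolding frame_def W_def[symmetric] chart_def
      by (simp add: power2_eq_square algebra_simps)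
    then show ?thesis
      by (simp add: g_def nn_integral_lborel_shift[where f = "\<lambda>x. f (upr x ** frame c d)"] del: mat2_mult)
  qed
  \<comment> \<open>Polar coordinates of the bottom row in two steps: here
    \<open>d = c * cot \<phi>\<close> for fixed \<open>c\<close>, and below
    \<open>c = sin \<phi> / sqrt y\<close> for fixed \<phi>.\<close>
  have 2: "(\<integral>\<^sup>+d. g c d \<partial>lborel) = (\<integral>\<^sup>+\<phi>. ennreal c * (g c (c * (cos \<phi> / sin \<phi>)) * ennreal (1 / (sin \<phi>)\<^sup>2) * indicator {0<..<pi} \<phi>) \<partial>lborel)"
    if "c > 0" for c
  proof -
    have "(\<integral>\<^sup>+d. g c d \<partial>lborel) = \<bar>- c\<bar> * (\<integral>\<^sup>+\<tau>. g c (0 + (- c) * \<tau>) \<partial>lborel)"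
      using that by (intro nn_integral_real_affine) auto
    also have "(\<integral>\<^sup>+\<tau>. g c (0 + (- c) * \<tau>) \<partial>lborel) =
        (\<integral>\<^sup>+\<phi>. g c (0 + (- c) * (- (cos \<phi> / sin \<phi>))) * ennreal (1 / (sin \<phi>)\<^sup>2) * indicator {0<..<pi} \<phi> \<partial>lborel)"
      by (rule nn_integral_tan) measurable
    finally show ?thesis using that by (simp add: nn_integral_cmult)
  qed
  have 3: "(\<integral>\<^sup>+c. ennreal c * (g c (c * (cos \<phi> / sin \<phi>)) * ennreal (1 / (sin \<phi>)\<^sup>2)) * indicator {0<..} c \<partial>lborel) =
      (\<integral>\<^sup>+y. indicator {0<..} y * (ennreal (1 / (2 * y\<^sup>2)) * (\<integral>\<^sup>+x. f (iwasawa (x, y, \<phi>)) \<partial>lborel)) \<partial>lborel)"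
    if "\<phi> \<in> {0<..<pi}" for \<phi>
  proof -
    define s where "s = sin \<phi>"
    have s: "s > 0" using that by (simp add: s_def sin_gt_zero)
    have "(\<integral>\<^sup>+c. ennreal c * (g c (c * (cos \<phi> / s)) * ennreal (1 / s\<^sup>2)) * indicator {0<..} c \<partial>lborel) =
      (\<integral>\<^sup>+y. ennreal (s / sqrt y) * (g (s / sqrt y) (s / sqrt y * (cos \<phi> / s)) * ennreal (1 / s\<^sup>2)) * ennreal (s / (2 * y * sqrt y)) * indicator {0<..} y \<partial>lborel)"
      by (rule nn_integral_inverse_sqrt[OF _ s]) measurable
    also have "\<dots> = (\<integral>\<^sup>+y. indicator {0<..} y * (ennreal (1 / (2 * y\<^sup>2)) * (\<integral>\<^sup>+x. f (iwasawa (x, y, \<phi>)) \<partial>lborel)) \<partial>lborel)"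
    proof (rule nn_integral_cong)
      fix y :: real
      show "ennreal (s / sqrt y) * (g (s / sqrt y) (s / sqrt y * (cos \<phi> / s)) * ennreal (1 / s\<^sup>2)) * ennreal (s / (2 * y * sqrt y)) * indicator {0<..} y
        = indicator {0<..} y * (ennreal (1 / (2 * y\<^sup>2)) * (\<integral>\<^sup>+x. f (iwasawa (x, y, \<phi>)) \<partial>lborel))"
      proof (cases "y > 0")
        case True
        have W: "(s / sqrt y)\<^sup>2 + (cos \<phi> / sqrt y)\<^sup>2 = 1 / y"
          using True by (simp add: power_divide s_def flip: add_divide_distrib)
        have "cos \<phi> / sqrt y / (1 / y) = sqrt y * cos \<phi>" "- (s / sqrt y) / (1 / y) = - sqrt y * s"
          using True by (simp_all add: field_simps)
        then have "iwasawa (x, y, \<phi>) = upr x ** frame (s / sqrt y) (cos \<phi> / sqrt y)" for x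
          unfolding iwasawa_eq[OF True] frame_def W by (simp add: s_def)
        moreover have "s / sqrt y * (cos \<phi> / s) = cos \<phi> / sqrt y" using s by simp
        ultimately have g: "g (s / sqrt y) (s / sqrt y * (cos \<phi> / s)) = (\<integral>\<^sup>+x. f (iwasawa (x, y, \<phi>)) \<partial>lborel)"
          by (simp add: g_def del: mat2_mult)
        have "s / sqrt y * (1 / s\<^sup>2) * (s / (2 * y * sqrt y)) = 1 / (2 * y\<^sup>2)"
          using True s by (simp add: field_simps power2_eq_square)
        then have e: "ennreal (s / sqrt y) * ennreal (1 / s\<^sup>2) * ennreal (s / (2 * y * sqrt y)) = ennreal (1 / (2 * y\<^sup>2))"
          using True s by (simp flip: ennreal_mult)
        have "ennreal (s / sqrt y) * (G * ennreal (1 / s\<^sup>2)) * ennreal (s / (2 * y * sqrt y)) * 1 =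
          (ennreal (s / sqrt y) * ennreal (1 / s\<^sup>2) * ennreal (s / (2 * y * sqrt y))) * G" for G
          by (simp only: mult_ac mult_1)
        then show ?thesis using True unfolding g e by simp
      qed auto
    qed
    finally show ?thesis unfolding s_def .
  qed
  have "(\<integral>\<^sup>+M. indicator {0<..} (M$2$1) * f M \<partial>haar) =
      (\<integral>\<^sup>+c. \<integral>\<^sup>+d. \<integral>\<^sup>+u. indicator {0<..} c * f (chart (c, d, u)) \<partial>lborel \<partial>lborel \<partial>lborel)"
    by (subst nn_integral_haar) (auto simp: chart_def)
  also have "\<dots> = (\<integral>\<^sup>+c. indicator {0<..} c * (\<integral>\<^sup>+d. g c d \<partial>lborel) \<partial>lborel)"
  proof (rule nn_integral_cong)
    fix c :: real
    have "(\<integral>\<^sup>+d. \<integral>\<^sup>+u. indicator {0<..} c * f (chart (c, d, u)) \<partial>lborel \<partial>lborel) =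
        (\<integral>\<^sup>+d. indicator {0<..} c * g c d \<partial>lborel)"
      by (rule nn_integral_cong_AE, rule eventually_mono[OF AE_lborel_singleton[of 0]])
        (simp add: nn_integral_cmult 1)
    then show "(\<integral>\<^sup>+d. \<integral>\<^sup>+u. indicator {0<..} c * f (chart (c, d, u)) \<partial>lborel \<partial>lborel) = indicator {0<..} c * (\<integral>\<^sup>+d. g c d \<partial>lborel)"
      by (simp add: nn_integral_cmult)
  qed
  also have "\<dots> = (\<integral>\<^sup>+c. \<integral>\<^sup>+\<phi>. indicator {0<..} c * (ennreal c * (g c (c * (cos \<phi> / sin \<phi>)) * ennreal (1 / (sin \<phi>)\<^sup>2) * indicator {0<..<pi} \<phi>)) \<partial>lborel \<partial>lborel)"
    by (intro nn_integral_cong) (auto simp: indicator_def 2)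
  also have "\<dots> = (\<integral>\<^sup>+\<phi>. \<integral>\<^sup>+c. indicator {0<..} c * (ennreal c * (g c (c * (cos \<phi> / sin \<phi>)) * ennreal (1 / (sin \<phi>)\<^sup>2) * indicator {0<..<pi} \<phi>)) \<partial>lborel \<partial>lborel)"
    by (rule lborel_pair.Fubini') measurable
  also have "\<dots> = (\<integral>\<^sup>+\<phi>. indicator {0<..<pi} \<phi> * (\<integral>\<^sup>+y. indicator {0<..} y * (ennreal (1 / (2 * y\<^sup>2)) * (\<integral>\<^sup>+x. f (iwasawa (x, y, \<phi>)) \<partial>lborel)) \<partial>lborel) \<partial>lborel)"
  proof (rule nn_integral_cong)
    fix \<phi> :: real
    show "(\<integral>\<^sup>+c. indicator {0<..} c * (ennreal c * (g c (c * (cos \<phi> / sin \<phi>)) * ennreal (1 / (sin \<phi>)\<^sup>2) * indicator {0<..<pi} \<phi>)) \<partial>lborel)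
      = indicator {0<..<pi} \<phi> * (\<integral>\<^sup>+y. indicator {0<..} y * (ennreal (1 / (2 * y\<^sup>2)) * (\<integral>\<^sup>+x. f (iwasawa (x, y, \<phi>)) \<partial>lborel)) \<partial>lborel)"
      using 3[of \<phi>] by (cases "\<phi> \<in> {0<..<pi}") (simp_all add: mult_ac)
  qed
  also have "\<dots> = (\<integral>\<^sup>+\<phi>. \<integral>\<^sup>+y. \<integral>\<^sup>+x. indicator {0<..<pi} \<phi> * (indicator {0<..} y * (ennreal (1 / (2 * y\<^sup>2)) * f (iwasawa (x, y, \<phi>)))) \<partial>lborel \<partial>lborel \<partial>lborel)"
    by (simp add: nn_integral_cmult)
  finally show ?thesis .
qed

section \<open>The fundamental domain in Iwasawa coordinates\<close>

lemma F_theta_iff: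
  "Complex x y \<in> F_theta \<longleftrightarrow> 0 < y \<and> 1 < x\<^sup>2 + y\<^sup>2 \<and> 1 < (x - 2)\<^sup>2 + y\<^sup>2 \<and> 0 \<le> x \<and> x < 2"
  by (auto simp: F_theta_def cmod_def)

definition theta_coords :: "(real \<times> real \<times> real) set" where
  "theta_coords = {(x, y, \<phi>). Complex x y \<in> F_theta \<and> \<phi> \<in> {0..<pi}}"

lemma iwasawa_mat2:
  assumes "y > 0"
  shows "iwasawa (x, y, \<phi>) = mat2 (sqrt y * cos \<phi> + x * sin \<phi> / sqrt y) (- sqrt y * sin \<phi> + x * cos \<phi> / sqrt y)
    (sin \<phi> / sqrt y) (cos \<phi> / sqrt y)"
  unfolding iwasawa_eq[OF assms] by simp

lemma det_iwasawa: "y > 0 \<Longrightarrow> det (iwasawa (x, y, \<phi>)) = 1"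
  by (simp add: iwasawa_def det_mul del: mat2_mult)

text \<open>The rotation fixes \<open>i\<close>, so the quadratic expressions in the rows do not
  depend on \<phi>; the sign condition holds because \<open>sin \<phi>\<close> is positive.\<close>

lemma iwasawa_in_theta_dom:
  assumes y: "y > 0" and \<phi>: "\<phi> \<in> {0<..<pi}"
  shows "iwasawa (x, y, \<phi>) \<in> theta_dom \<longleftrightarrow> Complex x y \<in> F_theta"
proof -
  define r where "r = sqrt y"
  define C where "C = cos \<phi>"
  define S where "S = sin \<phi>"
  have r: "r > 0" "r\<^sup>2 = y" using y by (simp_all add: r_def)
  have CS: "C\<^sup>2 + S\<^sup>2 = 1" by (simp add: C_def S_def)
  have S: "S > 0" using \<phi> by (simp add: S_def sin_gt_zero)
  have M: "iwasawa (x, y, \<phi>) = mat2 (r * C + x * S / r) (- r * S + x * C / r) (S / r) (C / r)"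
    using iwasawa_mat2[OF y, of x \<phi>] by (simp add: r_def C_def S_def)
  have sq: "(r * C + k * S / r)\<^sup>2 + (- r * S + k * C / r)\<^sup>2 = (k\<^sup>2 + y\<^sup>2) / y" for k
  proof -
    have "(r * C + k * S / r)\<^sup>2 + (- r * S + k * C / r)\<^sup>2 = (r\<^sup>2 + k\<^sup>2 / r\<^sup>2) * (C\<^sup>2 + S\<^sup>2)"
      using r(1) by (simp add: field_simps power2_eq_square)
    also have "\<dots> = (k\<^sup>2 + y\<^sup>2) / y" unfolding CS r(2) using y by (simp add: field_simps power2_eq_square)
    finally show ?thesis .
  qed
  have "(r * C + x * S / r) - 2 * (S / r) = r * C + (x - 2) * S / r"
    "(- r * S + x * C / r) - 2 * (C / r) = - r * S + (x - 2) * C / r"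
    by (simp_all add: algebra_simps diff_divide_distrib)
  then have sq2: "((r * C + x * S / r) - 2 * (S / r))\<^sup>2 + ((- r * S + x * C / r) - 2 * (C / r))\<^sup>2 = ((x - 2)\<^sup>2 + y\<^sup>2) / y"
    using sq[of "x - 2"] by (simp only:)
  have W: "(S / r)\<^sup>2 + (C / r)\<^sup>2 = 1 / y"
    using CS by (simp add: power_divide r(2) add.commute flip: add_divide_distrib)
  have X: "(r * C + x * S / r) * (S / r) + (- r * S + x * C / r) * (C / r) = x / y"
  proof -
    have "(r * C + x * S / r) * (S / r) + (- r * S + x * C / r) * (C / r) = x * (C\<^sup>2 + S\<^sup>2) / r\<^sup>2"
      using r(1) by (simp add: field_simps power2_eq_square)
    then show ?thesis unfolding CS r(2) by simp
  qed
  show ?thesis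
    unfolding theta_dom_def mem_Collect_eq F_theta_iff det_iwasawa[OF y] unfolding M mat2_nth sq sq2 W X
    using y S r(1) by (simp add: divide_less_cancel field_simps)
qed

lemma F_theta_measurable [measurable]: "Measurable.pred (borel \<Otimes>\<^sub>M borel) (\<lambda>z. Complex (fst z) (snd z) \<in> F_theta)"
  unfolding F_theta_iff by measurable

lemma theta_coords_borel [measurable]: "theta_coords \<in> sets borel"
proof -
  have "Measurable.pred (borel \<Otimes>\<^sub>M (borel \<Otimes>\<^sub>M borel)) (\<lambda>z. z \<in> theta_coords)"
    unfolding theta_coords_def mem_Collect_eq case_prod_beta F_theta_iff greaterThanLessThan_iff atLeastLessThan_iff
    by measurable
  then show ?thesis by (simp add: pred_def borel_prod)
qed

lemma nn_integral_lborel3_rev: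
  assumes [measurable]: "f \<in> borel_measurable (borel :: (real \<times> real \<times> real) measure)"
  shows "(\<integral>\<^sup>+z. f z \<partial>lborel) = (\<integral>\<^sup>+\<phi>. \<integral>\<^sup>+y. \<integral>\<^sup>+x. f (x, y, \<phi>) \<partial>lborel \<partial>lborel \<partial>lborel)"
proof -
  have [measurable]: "f \<in> borel_measurable (borel \<Otimes>\<^sub>M (borel \<Otimes>\<^sub>M borel))"
    using assms by (simp add: borel_prod)
  have "(\<integral>\<^sup>+z. f z \<partial>lborel) = (\<integral>\<^sup>+x. \<integral>\<^sup>+y. \<integral>\<^sup>+\<phi>. f (x, y, \<phi>) \<partial>lborel \<partial>lborel \<partial>lborel)"
    by (rule nn_integral_lborel3) fact
  also have "\<dots> = (\<integral>\<^sup>+y. \<integral>\<^sup>+x. \<integral>\<^sup>+\<phi>. f (x, y, \<phi>) \<partial>lborel \<partial>lborel \<partial>lborel)"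
    by (rule lborel_pair.Fubini') measurable
  also have "\<dots> = (\<integral>\<^sup>+y. \<integral>\<^sup>+\<phi>. \<integral>\<^sup>+x. f (x, y, \<phi>) \<partial>lborel \<partial>lborel \<partial>lborel)"
    by (intro nn_integral_cong lborel_pair.Fubini') measurable
  also have "\<dots> = (\<integral>\<^sup>+\<phi>. \<integral>\<^sup>+y. \<integral>\<^sup>+x. f (x, y, \<phi>) \<partial>lborel \<partial>lborel \<partial>lborel)"
    by (rule lborel_pair.Fubini') measurable
  finally show ?thesis .
qed

lemma measurable_iwasawa_triple [measurable]: "iwasawa \<in> borel_measurable borel"
proof -
  have "(\<lambda>z. iwasawa (fst z, fst (snd z), snd (snd z))) \<in> borel_measurable (borel \<Otimes>\<^sub>M (borel \<Otimes>\<^sub>M borel))"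
    by measurable
  then show ?thesis by (simp add: borel_prod)
qed

lemma nn_integral_theta_dom:
  assumes [measurable]: "f \<in> borel_measurable borel"
  shows "(\<integral>\<^sup>+M. indicator theta_dom M * f M \<partial>haar) =
    (\<integral>\<^sup>+z. indicator theta_coords z * (ennreal (1 / (2 * (fst (snd z))\<^sup>2)) * f (iwasawa z)) \<partial>lborel)"
proof -
  have [measurable]: "(\<lambda>z. f (iwasawa z)) \<in> borel_measurable (borel :: (real \<times> real \<times> real) measure)" by measurable
  have meas: "(\<lambda>z. indicator theta_coords z * (ennreal (1 / (2 * (fst (snd z))\<^sup>2)) * f (iwasawa z))) \<in> borel_measurable borel"
  proof -
    have "(\<lambda>z :: real \<times> real \<times> real. ennreal (1 / (2 * (fst (snd z))\<^sup>2))) \<in> borel_measurable (borel \<Otimes>\<^sub>M (borel \<Otimes>\<^sub>M borel))"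
      by measurable
    then have [measurable]: "(\<lambda>z :: real \<times> real \<times> real. ennreal (1 / (2 * (fst (snd z))\<^sup>2))) \<in> borel_measurable borel"
      by (simp add: borel_prod)
    show ?thesis by measurable
  qed
  have "(\<integral>\<^sup>+M. indicator theta_dom M * f M \<partial>haar) =
      (\<integral>\<^sup>+M. indicator {0<..} (M$2$1) * (indicator theta_dom M * f M) \<partial>haar)"
    using AE_haar_lower_left
    by (intro nn_integral_cong_AE) (auto simp: indicator_def theta_dom_def elim!: eventually_mono)
  also have "\<dots> = (\<integral>\<^sup>+\<phi>. \<integral>\<^sup>+y. \<integral>\<^sup>+x. indicator {0<..<pi} \<phi> * (indicator {0<..} y *
      (ennreal (1 / (2 * y\<^sup>2)) * (indicator theta_dom (iwasawa (x, y, \<phi>)) * f (iwasawa (x, y, \<phi>))))) \<partial>lborel \<partial>lborel \<partial>lborel)"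
    by (rule nn_integral_haar_iwasawa) measurable
  also have "\<dots> = (\<integral>\<^sup>+\<phi>. \<integral>\<^sup>+y. \<integral>\<^sup>+x. indicator theta_coords (x, y, \<phi>) *
      (ennreal (1 / (2 * y\<^sup>2)) * f (iwasawa (x, y, \<phi>))) \<partial>lborel \<partial>lborel \<partial>lborel)"
  proof (rule nn_integral_cong_AE, rule eventually_mono[OF AE_lborel_singleton[of 0]])
    fix \<phi> :: real assume "\<phi> \<noteq> 0"
    have "indicator {0<..<pi} \<phi> * (indicator {0<..} y * (ennreal (1 / (2 * y\<^sup>2)) * (indicator theta_dom (iwasawa (x, y, \<phi>)) * f (iwasawa (x, y, \<phi>)))))
       = indicator theta_coords (x, y, \<phi>) * (ennreal (1 / (2 * y\<^sup>2)) * f (iwasawa (x, y, \<phi>)))" for x y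
    proof (cases "y > 0 \<and> \<phi> \<in> {0<..<pi}")
      case True
      then show ?thesis using iwasawa_in_theta_dom[of y \<phi> x] by (simp add: indicator_def theta_coords_def)
    next
      case False
      then have "(x, y, \<phi>) \<notin> theta_coords" using \<open>\<phi> \<noteq> 0\<close> by (auto simp: theta_coords_def F_theta_iff)
      then show ?thesis using False by (auto simp: indicator_def)
    qed
    then show "(\<integral>\<^sup>+y. \<integral>\<^sup>+x. indicator {0<..<pi} \<phi> * (indicator {0<..} y * (ennreal (1 / (2 * y\<^sup>2)) * (indicator theta_dom (iwasawa (x, y, \<phi>)) * f (iwasawa (x, y, \<phi>))))) \<partial>lborel \<partial>lborel)
      = (\<integral>\<^sup>+y. \<integral>\<^sup>+x. indicator theta_coords (x, y, \<phi>) * (ennreal (1 / (2 * y\<^sup>2)) * f (iwasawa (x, y, \<phi>))) \<partial>lborel \<partial>lborel)"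
      by simp
  qed
  also have "\<dots> = (\<integral>\<^sup>+z. indicator theta_coords z * (ennreal (1 / (2 * (fst (snd z))\<^sup>2)) * f (iwasawa z)) \<partial>lborel)"
    by (subst nn_integral_lborel3_rev[OF meas]) simp
  finally show ?thesis .
qed

section \<open>Hyperbolic area of the fundamental domain\<close>

lemma nn_integral_inverse_square_tail:
  assumes "s > 0"
  shows "(\<integral>\<^sup>+y. ennreal (1 / y\<^sup>2) * indicator {s<..} y \<partial>lborel) = ennreal (1 / s)"
proof -
  have "(\<integral>\<^sup>+y. ennreal (1 / y\<^sup>2) * indicator {s<..} y \<partial>lborel) = (\<integral>\<^sup>+y. ennreal (1 / y\<^sup>2) * indicator {s..} y \<partial>lborel)"
    by (intro nn_integral_cong_AE eventually_mono[OF AE_lborel_singleton[of s]]) (auto simp: indicator_def)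
  also have "\<dots> = ennreal (0 - (- 1 / s))"
  proof (rule nn_integral_FTC_atLeast)
    show "((\<lambda>y. - 1 / y) has_real_derivative 1 / y\<^sup>2) (at y)" if "s \<le> y" for y
      using that assms by (auto intro!: derivative_eq_intros simp: power2_eq_square)
    show "((\<lambda>y::real. - 1 / y) \<longlongrightarrow> 0) at_top"
      by (rule tendsto_divide_0[OF tendsto_const]) (simp add: filterlim_at_top_imp_at_infinity filterlim_ident)
  qed auto
  finally show ?thesis by simp
qed

lemma nn_integral_arcsin: "(\<integral>\<^sup>+x. ennreal (1 / sqrt (1 - x\<^sup>2)) * indicator {0<..<1} x \<partial>lborel) = ennreal (pi / 2)"
proof -
  have img: "sin ` {0<..<pi / 2} = {0<..<1::real}"
  proof (intro equalityI subsetI)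
    fix x :: real assume x: "x \<in> {0<..<1}"
    have "0 < arcsin x" using arcsin_less_mono[of 0 x] x by simp
    then show "x \<in> sin ` {0<..<pi / 2}"
      using arcsin_lt_bounded[of x] x by (intro image_eqI[of _ _ "arcsin x"]) auto
  next
    fix y :: real assume "y \<in> sin ` {0<..<pi / 2}"
    then obtain x where x: "0 < x" "x < pi / 2" "y = sin x" by auto
    have "sin x < sin (pi / 2)" using x by (intro sin_monotone_2pi) auto
    then show "y \<in> {0<..<1}" using x sin_gt_zero[of x] by simp
  qed
  have "(\<integral>\<^sup>+x. ennreal (1 / sqrt (1 - x\<^sup>2)) * indicator {0<..<1} x \<partial>lborel) =
      (\<integral>\<^sup>+x. ennreal (1 / sqrt (1 - x\<^sup>2)) * indicator (sin ` {0<..<pi / 2}) x \<partial>lborel)"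
    by (simp add: img)
  also have "\<dots> = (\<integral>\<^sup>+x. ennreal (1 / sqrt (1 - (sin x)\<^sup>2)) * ennreal (cos x) * indicator {0<..<pi / 2} x \<partial>lborel)"
  proof (rule nn_integral_substitution_Ioo)
    show "0 \<le> cos x" if "x \<in> {0<..<pi / 2}" for x using that by (intro cos_ge_zero) auto
    show "continuous_on {0<..<pi / 2} (cos :: real \<Rightarrow> real)" by (intro continuous_intros)
  qed (auto intro: DERIV_sin)
  also have "\<dots> = (\<integral>\<^sup>+x. indicator {0<..<pi / 2} x \<partial>lborel)"
  proof (rule nn_integral_cong)
    fix x :: real
    show "ennreal (1 / sqrt (1 - (sin x)\<^sup>2)) * ennreal (cos x) * indicator {0<..<pi / 2} x = indicator {0<..<pi / 2} x"
    proof (cases "x \<in> {0<..<pi / 2}")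
      case True
      then have "cos x > 0" by (intro cos_gt_zero_pi) auto
      moreover have "1 - (sin x)\<^sup>2 = (cos x)\<^sup>2" by (simp add: cos_squared_eq)
      ultimately show ?thesis by (simp flip: ennreal_mult)
    qed simp
  qed
  also have "\<dots> = ennreal (pi / 2)" by simp
  finally show ?thesis .
qed

text \<open>Above a circle the integral of \<open>1 / y^2\<close> is the inverse of the height of
  the arc, and integrating this over a half arc gives \<open>pi / 2\<close> by the arcsine. The two
  halves of the strip are mirror images under \<open>x\<close> to \<open>2 - x\<close>.\<close>

lemma F_theta_area:
  "(\<integral>\<^sup>+x. \<integral>\<^sup>+y. indicator {y. Complex x y \<in> F_theta} y * ennreal (1 / y\<^sup>2) \<partial>lborel \<partial>lborel) = ennreal pi"
proof -
  let ?r = "\<lambda>x::real. ennreal (1 / sqrt (1 - x\<^sup>2)) * indicator {0<..<1} x"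
  have tail: "y > sqrt (1 - k\<^sup>2) \<longleftrightarrow> 0 < y \<and> 1 < k\<^sup>2 + y\<^sup>2" if "\<bar>k\<bar> < 1" for k y :: real
  proof -
    have "k\<^sup>2 < 1" using that abs_square_less_1 by blast
    then have "sqrt (1 - k\<^sup>2) > 0" by simp
    show ?thesis
    proof
      assume "y > sqrt (1 - k\<^sup>2)"
      then show "0 < y \<and> 1 < k\<^sup>2 + y\<^sup>2"
        using less_trans[OF \<open>sqrt (1 - k\<^sup>2) > 0\<close>] \<open>k\<^sup>2 < 1\<close> power_strict_mono[of "sqrt (1 - k\<^sup>2)" y 2] by simp
    next
      assume "0 < y \<and> 1 < k\<^sup>2 + y\<^sup>2"
      then show "y > sqrt (1 - k\<^sup>2)" using real_sqrt_less_mono[of "1 - k\<^sup>2" "y\<^sup>2"] by simp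
    qed
  qed
  \<comment> \<open>At \<open>x = 0\<close> and \<open>x = 1\<close> the right side is 0 because of
    the open indicator, while the left side is not.\<close>
  have inner: "(\<integral>\<^sup>+y. indicator {y. Complex x y \<in> F_theta} y * ennreal (1 / y\<^sup>2) \<partial>lborel) = ?r x + ?r (2 - x)"
    if ne: "x \<noteq> 0" "x \<noteq> 1" for x
  proof -
    consider "x < 0 \<or> x \<ge> 2" | "0 < x" "x < 1" | "1 < x" "x < 2" using ne by linarith
    then show ?thesis
    proof cases
      case 1
      then show ?thesis by (auto simp: F_theta_iff indicator_def)
    next
      case 2
      have "Complex x y \<in> F_theta \<longleftrightarrow> y > sqrt (1 - x\<^sup>2)" for y
        using 2 tail[of x y] by (auto simp: F_theta_iff power2_diff)
      moreover have "x\<^sup>2 < 1" using 2 by (simp add: abs_square_less_1)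
      ultimately show ?thesis using 2 nn_integral_inverse_square_tail[of "sqrt (1 - x\<^sup>2)"]
        by (simp add: indicator_def mult.commute)
    next
      case 3
      have "Complex x y \<in> F_theta \<longleftrightarrow> y > sqrt (1 - (2 - x)\<^sup>2)" for y
        using 3 tail[of "2 - x" y] by (auto simp: F_theta_iff power2_diff)
      moreover have "(2 - x)\<^sup>2 < 1" using 3 by (simp add: abs_square_less_1)
      ultimately show ?thesis using 3 nn_integral_inverse_square_tail[of "sqrt (1 - (2 - x)\<^sup>2)"]
        by (simp add: indicator_def mult.commute)
    qed
  qed
  have "(\<integral>\<^sup>+x. \<integral>\<^sup>+y. indicator {y. Complex x y \<in> F_theta} y * ennreal (1 / y\<^sup>2) \<partial>lborel \<partial>lborel) =
      (\<integral>\<^sup>+x. ?r x + ?r (2 - x) \<partial>lborel)"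
    by (intro nn_integral_cong_AE) (use AE_lborel_singleton[of 0] AE_lborel_singleton[of 1] in eventually_elim, rule inner)
  also have "\<dots> = (\<integral>\<^sup>+x. ?r x \<partial>lborel) + (\<integral>\<^sup>+x. ?r (2 - x) \<partial>lborel)"
    by (rule nn_integral_add) measurable
  also have "(\<integral>\<^sup>+x. ?r (2 - x) \<partial>lborel) = (\<integral>\<^sup>+x. ?r x \<partial>lborel)"
    by (subst (2) nn_integral_real_affine[where c = "-1" and t = 2]) auto
  also have "(\<integral>\<^sup>+x. ?r x \<partial>lborel) + (\<integral>\<^sup>+x. ?r x \<partial>lborel) = ennreal pi"
    unfolding nn_integral_arcsin by (simp flip: ennreal_plus)
  finally show ?thesis .
qed

text \<open>One half from the Haar density \<open>1 / (2 * y^2)\<close>, \<open>pi\<close> from the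
  angle and \<open>pi\<close> from the hyperbolic area.\<close>

lemma emeasure_theta_dom: "emeasure haar theta_dom = ennreal (pi\<^sup>2 / 2)"
proof -
  have [measurable]: "(\<lambda>z :: real \<times> real \<times> real. ennreal (1 / (2 * (fst (snd z))\<^sup>2))) \<in> borel_measurable borel"
  proof -
    have "(\<lambda>z :: real \<times> real \<times> real. ennreal (1 / (2 * (fst (snd z))\<^sup>2))) \<in> borel_measurable (borel \<Otimes>\<^sub>M (borel \<Otimes>\<^sub>M borel))"
      by measurable
    then show ?thesis by (simp add: borel_prod)
  qed
  have [measurable]: "(\<lambda>x. \<integral>\<^sup>+y. indicator {y. Complex x y \<in> F_theta} y * ennreal (1 / y\<^sup>2) \<partial>lborel) \<in> borel_measurable borel"
  proof -
    have "(\<lambda>x. \<integral>\<^sup>+y. indicator {z. Complex (fst z) (snd z) \<in> F_theta} (x, y) * ennreal (1 / y\<^sup>2) \<partial>lborel) \<in> borel_measurable borel"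
      by measurable
    then show ?thesis by (simp add: indicator_def)
  qed
  have "emeasure haar theta_dom = (\<integral>\<^sup>+M. indicator theta_dom M * 1 \<partial>haar)" by simp
  also have "\<dots> = (\<integral>\<^sup>+z. indicator theta_coords z * (ennreal (1 / (2 * (fst (snd z))\<^sup>2)) * 1) \<partial>lborel)"
    by (rule nn_integral_theta_dom) measurable
  also have "\<dots> = (\<integral>\<^sup>+x. \<integral>\<^sup>+y. \<integral>\<^sup>+\<phi>. indicator theta_coords (x, y, \<phi>) * (ennreal (1 / (2 * y\<^sup>2))) \<partial>lborel \<partial>lborel \<partial>lborel)"
    by (subst nn_integral_lborel3) auto
  also have "\<dots> = (\<integral>\<^sup>+x. \<integral>\<^sup>+y. \<integral>\<^sup>+\<phi>. (indicator {y. Complex x y \<in> F_theta} y * ennreal (1 / (2 * y\<^sup>2))) * indicator {0..<pi} \<phi> \<partial>lborel \<partial>lborel \<partial>lborel)"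
    by (intro nn_integral_cong) (auto simp: indicator_def theta_coords_def)
  also have "\<dots> = (\<integral>\<^sup>+x. \<integral>\<^sup>+y. ennreal (pi / 2) * (indicator {y. Complex x y \<in> F_theta} y * ennreal (1 / y\<^sup>2)) \<partial>lborel \<partial>lborel)"
  proof (intro nn_integral_cong)
    fix x y :: real
    have "ennreal (1 / (2 * y\<^sup>2)) * ennreal pi = ennreal (pi / 2) * ennreal (1 / y\<^sup>2)"
      by (simp flip: ennreal_mult)
    then show "(\<integral>\<^sup>+\<phi>. (indicator {y. Complex x y \<in> F_theta} y * ennreal (1 / (2 * y\<^sup>2))) * indicator {0..<pi} \<phi> \<partial>lborel) =
        ennreal (pi / 2) * (indicator {y. Complex x y \<in> F_theta} y * ennreal (1 / y\<^sup>2))"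
      by (simp add: nn_integral_cmult) (auto simp: indicator_def mult.commute)
  qed
  also have "\<dots> = (\<integral>\<^sup>+x. ennreal (pi / 2) * (\<integral>\<^sup>+y. indicator {y. Complex x y \<in> F_theta} y * ennreal (1 / y\<^sup>2) \<partial>lborel) \<partial>lborel)"
  proof (intro nn_integral_cong nn_integral_cmult)
    fix x :: real
    have "(\<lambda>y. indicator {z. Complex (fst z) (snd z) \<in> F_theta} (x, y) * ennreal (1 / y\<^sup>2)) \<in> borel_measurable lborel"
      by measurable
    then show "(\<lambda>y. indicator {y. Complex x y \<in> F_theta} y * ennreal (1 / y\<^sup>2)) \<in> borel_measurable lborel"
      by (simp add: indicator_def)
  qed
  also have "\<dots> = ennreal (pi / 2) * ennreal pi"
    by (subst nn_integral_cmult) (auto simp: F_theta_area)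
  also have "\<dots> = ennreal (pi\<^sup>2 / 2)"
    by (simp flip: ennreal_mult add: power2_eq_square)
  finally show ?thesis .
qed

section \<open>Torsion points and the affine group\<close>

abbreviation int_vecs :: "(real^2) set" where
  "int_vecs \<equiv> {v. \<forall>i. v $ i \<in> \<int>}"

lemma int_vecs_mult:
  assumes "\<And>i j. A $ i $ j \<in> \<int>" "v \<in> int_vecs"
  shows "A *v v \<in> int_vecs"
  using assms by (auto simp: matrix_vector_mult_def intro!: Ints_sum Ints_mult)

lemma int_vecs_add: "v \<in> int_vecs \<Longrightarrow> w \<in> int_vecs \<Longrightarrow> v + w \<in> int_vecs"
  and int_vecs_diff: "v \<in> int_vecs \<Longrightarrow> w \<in> int_vecs \<Longrightarrow> v - w \<in> int_vecs"
  and int_vecs_uminus: "v \<in> int_vecs \<Longrightarrow> - v \<in> int_vecs"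
  by auto

lemma group_ASL2R: "group ASL2R"
proof (rule groupI)
  fix g assume g: "g \<in> carrier ASL2R"
  obtain M \<xi> where "g = (M, \<xi>)" by (cases g)
  then show "\<exists>h\<in>carrier ASL2R. h \<otimes>\<^bsub>ASL2R\<^esub> g = \<one>\<^bsub>ASL2R\<^esub>"
    using g by (intro bexI[of _ "(adj2 M, - (adj2 M *v \<xi>))"]) (simp_all add: ASL2R_def adj2_mult)
qed (auto simp: ASL2R_def det_mult_1 matrix_mul_assoc matrix_vector_mul_assoc matrix_vector_right_distrib)

lemma Gamma_lat_mem: "(A, w) \<in> Gamma_lat \<longleftrightarrow> A \<in> Gamma_theta \<and> w \<in> int_vecs"
  by (simp add: Gamma_lat_def)

lemma Gamma_lat_subgroup: "subgroup Gamma_lat ASL2R"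
proof (rule group.subgroupI[OF group_ASL2R])
  show "Gamma_lat \<subseteq> carrier ASL2R" using Gamma_theta_det by (auto simp: Gamma_lat_def ASL2R_def)
  have "(mat 1, 0) \<in> Gamma_lat" by (simp add: Gamma_lat_mem Gamma_theta_one)
  then show "Gamma_lat \<noteq> {}" by blast
next
  fix g assume g: "g \<in> Gamma_lat"
  obtain A w where gA: "g = (A, w)" by (cases g)
  have A: "A \<in> Gamma_theta" "w \<in> int_vecs" using g gA by (auto simp: Gamma_lat_mem)
  have "inv\<^bsub>ASL2R\<^esub> g = (adj2 A, - (adj2 A *v w))"
    using group.inv_equality[OF group_ASL2R, of "(adj2 A, - (adj2 A *v w))" g] Gamma_theta_det[OF A(1)]
    by (simp add: gA ASL2R_def adj2_mult)
  moreover have "- (adj2 A *v w) \<in> int_vecs"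
    using A Gamma_theta_adj Gamma_theta_int by (intro int_vecs_uminus int_vecs_mult) auto
  ultimately show "inv\<^bsub>ASL2R\<^esub> g \<in> Gamma_lat" using A Gamma_theta_adj by (simp add: Gamma_lat_mem)
next
  fix g h assume gh: "g \<in> Gamma_lat" "h \<in> Gamma_lat"
  obtain A w where gA: "g = (A, w)" by (cases g)
  obtain B v where hB: "h = (B, v)" by (cases h)
  have "w + A *v v \<in> int_vecs"
    using gh Gamma_theta_int unfolding gA hB Gamma_lat_mem by (intro int_vecs_add int_vecs_mult) auto
  then show "g \<otimes>\<^bsub>ASL2R\<^esub> h \<in> Gamma_lat"
    using gh Gamma_theta_mult unfolding gA hB by (simp add: Gamma_lat_mem ASL2R_def)
qed

text \<open>The lattice element \<open>(A, p' - A p)\<close> carries \<open>(M, p)\<close> to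
  \<open>(A M, p')\<close>.\<close>

lemma coset_left_eq:
  assumes A: "A \<in> Gamma_theta" and M: "det M = 1" and p: "p' - A *v p \<in> int_vecs"
  shows "Gamma_lat #>\<^bsub>ASL2R\<^esub> (A ** M, p') = Gamma_lat #>\<^bsub>ASL2R\<^esub> (M, p)"
proof -
  let ?g = "(A, p' - A *v p)"
  have g: "?g \<in> Gamma_lat" using A p by (simp add: Gamma_lat_mem)
  then have gc: "?g \<in> carrier ASL2R" using subgroup.subset[OF Gamma_lat_subgroup] by blast
  have "?g \<otimes>\<^bsub>ASL2R\<^esub> (M, p) = (A ** M, p')" by (simp add: ASL2R_def)
  then have "Gamma_lat #>\<^bsub>ASL2R\<^esub> (A ** M, p') = (Gamma_lat #>\<^bsub>ASL2R\<^esub> ?g) #>\<^bsub>ASL2R\<^esub> (M, p)"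
    using group.coset_mult_assoc[OF group_ASL2R subgroup.subset[OF Gamma_lat_subgroup] gc, of "(M, p)"] M
    by (simp add: ASL2R_def)
  also have "Gamma_lat #>\<^bsub>ASL2R\<^esub> ?g = Gamma_lat"
    by (rule group.coset_join2[OF group_ASL2R gc Gamma_lat_subgroup g])
  finally show ?thesis .
qed

lemma torus_rep_diff: "torus_rep \<xi> - \<xi> \<in> int_vecs"
  by (simp add: torus_rep_def)

lemma torus_rep_eq_iff: "torus_rep \<xi> = torus_rep \<eta> \<longleftrightarrow> \<xi> - \<eta> \<in> int_vecs"
proof
  assume "torus_rep \<xi> = torus_rep \<eta>"
  then have eq: "\<xi> - \<eta> = (torus_rep \<eta> - \<eta>) - (torus_rep \<xi> - \<xi>)" by simp
  show "\<xi> - \<eta> \<in> int_vecs" by (subst eq) (rule int_vecs_diff[OF torus_rep_diff torus_rep_diff])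
next
  assume "\<xi> - \<eta> \<in> int_vecs"
  then have *: "\<xi> $ i - \<eta> $ i \<in> \<int>" for i by auto
  have "\<xi> $ i - of_int \<lfloor>\<xi> $ i + 1 / 2\<rfloor> = \<eta> $ i - of_int \<lfloor>\<eta> $ i + 1 / 2\<rfloor>" for i
  proof -
    obtain n where "\<xi> $ i - \<eta> $ i = of_int n" using *[of i] by (auto elim: Ints_cases)
    then have "\<xi> $ i = \<eta> $ i + of_int n" by simp
    moreover have "\<lfloor>\<eta> $ i + of_int n + 1 / 2\<rfloor> = \<lfloor>\<eta> $ i + 1 / 2\<rfloor> + n"
      by (metis add.assoc add.commute floor_add_int)
    ultimately show ?thesis by simp
  qed
  then show "torus_rep \<xi> = torus_rep \<eta>" by (simp add: torus_rep_def vec_eq_iff)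
qed

lemma torus_rep_idem: "torus_rep (torus_rep \<xi>) = torus_rep \<xi>"
  using torus_rep_diff[of \<xi>] by (simp only: torus_rep_eq_iff)

text \<open>Integer translations act trivially on the torus, so only the linear parts contribute to
  the orbit.\<close>

lemma torus_orbit_eq:
  "torus_orbit \<alpha> \<beta> = (\<lambda>A. torus_rep (A *v torus_rep (vector [\<alpha>, \<beta>]))) ` Gamma_theta"
proof -
  define p where "p = torus_rep (vector [\<alpha>, \<beta>])"
  have "torus_act (A, w) p = torus_rep (A *v p)" if "w \<in> int_vecs" for A w
    using that by (simp add: torus_act_def torus_rep_eq_iff)
  moreover have "0 \<in> int_vecs" by simp
  ultimately show ?thesis
    unfolding torus_orbit_def orbit_def p_def[symmetric] Gamma_lat_def
    by (auto simp: image_iff) (metis (no_types, lifting) mem_Collect_eq zero_index Ints_0)+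
qed

section \<open>The stabiliser of a torsion point as a lattice\<close>

locale torsion_point =
  fixes p0 :: "real^2" and q :: nat
  assumes q: "q > 0" and torsion: "real q *\<^sub>R p0 \<in> int_vecs" and rep: "torus_rep p0 = p0"
begin

definition orb :: "(real^2) set" where
  "orb = (\<lambda>A. torus_rep (A *v p0)) ` Gamma_theta"

definition stab :: "(real^2^2) set" where
  "stab = {A \<in> Gamma_theta. A *v p0 - p0 \<in> int_vecs}"

definition gam :: "real^2 \<Rightarrow> real^2^2" where
  "gam p = (SOME A. A \<in> Gamma_theta \<and> torus_rep (A *v p0) = p)"

text \<open>The theta group is the disjoint union of the cosets \<open>gam p * stab\<close>, so the
  translates of \<open>theta_dom\<close> by the inverses of the \<open>gam p\<close> make up a
  fundamental domain for \<open>stab\<close>.\<close>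

definition dom :: "(real^2^2) set" where
  "dom = (\<Union>p\<in>orb. {M. gam p ** M \<in> theta_dom})"

lemma gam:
  assumes "p \<in> orb"
  shows "gam p \<in> Gamma_theta" "torus_rep (gam p *v p0) = p"
proof -
  have "\<exists>A. A \<in> Gamma_theta \<and> torus_rep (A *v p0) = p" using assms by (auto simp: orb_def)
  from someI_ex[OF this] show "gam p \<in> Gamma_theta" "torus_rep (gam p *v p0) = p" by (auto simp: gam_def)
qed

lemma gam_diff: "p \<in> orb \<Longrightarrow> p - gam p *v p0 \<in> int_vecs"
  using torus_rep_diff[of "gam p *v p0"] gam(2) by simp

text \<open>Integral matrices preserve the property that \<open>q\<close> times the vector is
  integral, and \<open>torus_rep\<close> keeps the vectors bounded.\<close>

lemma finite_orb: "finite orb"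
proof -
  let ?I = "{- int q..int q}"
  have "orb \<subseteq> (\<lambda>(a, b). vector [of_int a / real q, of_int b / real q]) ` (?I \<times> ?I)"
  proof
    fix p assume p: "p \<in> orb"
    have eq: "real q *\<^sub>R p = real q *\<^sub>R (p - gam p *v p0) + gam p *v (real q *\<^sub>R p0)"
      by (simp add: scaleR_diff_right matrix_vector_mult_scaleR)
    have a: "real q *\<^sub>R (p - gam p *v p0) \<in> int_vecs"
      using gam_diff[OF p] by (auto intro!: Ints_mult)
    have b: "gam p *v (real q *\<^sub>R p0) \<in> int_vecs"
      using Gamma_theta_int[OF gam(1)[OF p]] torsion by (rule int_vecs_mult)
    have "real q *\<^sub>R p \<in> int_vecs" by (subst eq) (rule int_vecs_add[OF a b])
    then have "real q * p $ i \<in> \<int>" for i by simp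
    then have "\<exists>n. real q * p $ i = of_int n" for i by (meson Ints_cases)
    then obtain n where n: "\<And>i. real q * p $ i = of_int (n i)" by metis
    have bound: "\<bar>x - of_int \<lfloor>x + 1 / 2\<rfloor>\<bar> \<le> 1" for x :: real by linarith
    have "p = torus_rep (gam p *v p0)" using gam(2)[OF p] by simp
    moreover have "\<bar>torus_rep \<xi> $ i\<bar> \<le> 1" for \<xi> i unfolding torus_rep_def vec_lambda_beta by (rule bound)
    ultimately have "\<bar>p $ i\<bar> \<le> 1" for i by (metis (no_types))
    then have "real q * \<bar>p $ i\<bar> \<le> real q * 1" for i by (intro mult_left_mono) auto
    then have "\<bar>real_of_int (n i)\<bar> \<le> real q" for i unfolding n[symmetric] by (simp add: abs_mult)
    then have "real_of_int \<bar>n i\<bar> \<le> real_of_int (int q)" for i by simp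
    then have "\<bar>n i\<bar> \<le> int q" for i by (simp only: of_int_le_iff)
    then have nI: "n i \<in> ?I" for i by (simp add: abs_le_iff minus_le_iff)
    have "p $ i = of_int (n i) / real q" for i using n[of i] q by (simp add: field_simps)
    then have "p = vector [of_int (n 1) / real q, of_int (n 2) / real q]"
      by (simp add: vec2_eq_iff vector_2)
    then show "p \<in> (\<lambda>(a, b). vector [of_int a / real q, of_int b / real q]) ` (?I \<times> ?I)"
      using nI by (intro image_eqI[of _ _ "(n 1, n 2)"]) auto
  qed
  then show ?thesis by (rule finite_subset) simp
qed

lemma p0_in_orb: "p0 \<in> orb"
  unfolding orb_def using Gamma_theta_one rep by (intro image_eqI[of _ _ "mat 1"]) auto

lemma gam_eq_iff:
  assumes "p \<in> orb" "p' \<in> orb" "A \<in> stab" "A' \<in> stab" "gam p ** A = gam p' ** A'"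
  shows "p = p' \<and> A = A'"
proof -
  have *: "torus_rep (gam p ** A *v p0) = p" if "p \<in> orb" "A \<in> stab" for p A
  proof -
    have "gam p *v (A *v p0 - p0) \<in> int_vecs"
      using that Gamma_theta_int[OF gam(1)[OF that(1)]] by (intro int_vecs_mult) (auto simp: stab_def)
    then have "torus_rep (gam p ** A *v p0) = torus_rep (gam p *v p0)"
      by (simp add: torus_rep_eq_iff matrix_vector_mul_assoc[symmetric] matrix_vector_mult_diff_distrib)
    then show ?thesis using gam(2)[OF that(1)] by simp
  qed
  have p: "p = p'" using *[OF assms(1,3)] *[OF assms(2,4)] assms(5) by simp
  have "A = adj2 (gam p) ** (gam p ** A)" "A' = adj2 (gam p) ** (gam p ** A')"
    using Gamma_theta_det[OF gam(1)[OF assms(1)]] by simp_all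
  then show ?thesis using assms(5) p by metis
qed

lemma stab_one: "mat 1 \<in> stab"
  by (simp add: stab_def Gamma_theta_one)

text \<open>Both products belong to the theta group and carry \<open>M\<close> into
  \<open>theta_dom\<close>, so they coincide; \<open>gam_eq_iff\<close> then recovers the orbit
  point and the stabiliser part.\<close>

lemma gam_dom_unique:
  assumes "p \<in> orb" "p' \<in> orb" "A \<in> stab" "A' \<in> stab"
    and "gam p ** A ** M \<in> theta_dom" "gam p' ** A' ** M \<in> theta_dom"
  shows "p = p' \<and> A = A'"
proof (rule gam_eq_iff[OF assms(1-4)])
  have G: "gam p ** A \<in> Gamma_theta" "gam p' ** A' \<in> Gamma_theta"
    using assms gam by (auto simp: stab_def intro!: Gamma_theta_mult)
  have det: "det (gam p ** A) = 1" by (rule Gamma_theta_det[OF G(1)])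
  define X where "X = gam p' ** A' ** adj2 (gam p ** A)"
  have "X ** (gam p ** A ** M) = gam p' ** A' ** (adj2 (gam p ** A) ** ((gam p ** A) ** M))"
    by (simp only: X_def matrix_mul_assoc)
  also have "\<dots> = gam p' ** A' ** M" by (simp only: adj2_cancel(1)[OF det])
  finally have "X ** (gam p ** A ** M) = gam p' ** A' ** M" .
  moreover have "X \<in> Gamma_theta" unfolding X_def by (rule Gamma_theta_mult[OF G(2) Gamma_theta_adj[OF G(1)]])
  ultimately have "X = mat 1" using assms(5,6) by (intro theta_dom_unique) auto
  then have "X ** (gam p ** A) = gam p ** A" by simp
  then show "gam p ** A = gam p' ** A'" unfolding X_def using Gamma_theta_det[OF G(1)] by simp
qed

lemma dom_disjoint: "disjoint_family_on (\<lambda>p. {M. gam p ** M \<in> theta_dom}) orb"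
proof -
  have "p = p'" if "p \<in> orb" "p' \<in> orb" "gam p ** M \<in> theta_dom" "gam p' ** M \<in> theta_dom" for p p' M
    using gam_dom_unique[OF that(1,2) stab_one stab_one] that by simp
  then show ?thesis by (auto simp: disjoint_family_on_def)
qed

lemma dom_borel [measurable]: "dom \<in> sets borel"
  unfolding dom_def by (intro sets.finite_UN finite_orb) measurable

lemma nn_integral_dom:
  assumes [measurable]: "f \<in> borel_measurable borel"
  shows "(\<integral>\<^sup>+M. indicator dom M * f M \<partial>haar) = (\<Sum>p\<in>orb. \<integral>\<^sup>+M. indicator theta_dom M * f (adj2 (gam p) ** M) \<partial>haar)"
proof -
  have "(\<integral>\<^sup>+M. indicator dom M * f M \<partial>haar) = (\<integral>\<^sup>+M. (\<Sum>p\<in>orb. indicator {M. gam p ** M \<in> theta_dom} M * f M) \<partial>haar)"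
    unfolding dom_def indicator_UN_disjoint[OF finite_orb dom_disjoint] sum_distrib_right ..
  also have "\<dots> = (\<Sum>p\<in>orb. \<integral>\<^sup>+M. indicator {M. gam p ** M \<in> theta_dom} M * f M \<partial>haar)"
    by (rule nn_integral_sum) measurable
  also have "\<dots> = (\<Sum>p\<in>orb. \<integral>\<^sup>+M. indicator theta_dom M * f (adj2 (gam p) ** M) \<partial>haar)"
  proof (rule sum.cong[OF refl])
    fix p assume p: "p \<in> orb"
    have det: "det (gam p) = 1" by (rule Gamma_theta_det[OF gam(1)[OF p]])
    have "(\<integral>\<^sup>+M. indicator theta_dom M * f (adj2 (gam p) ** M) \<partial>haar) =
        (\<integral>\<^sup>+M. indicator theta_dom (gam p ** M) * f (adj2 (gam p) ** (gam p ** M)) \<partial>haar)"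
      by (rule haar_left[OF det, symmetric]) measurable
    then show "(\<integral>\<^sup>+M. indicator {M. gam p ** M \<in> theta_dom} M * f M \<partial>haar) =
        (\<integral>\<^sup>+M. indicator theta_dom M * f (adj2 (gam p) ** M) \<partial>haar)"
      using det by (simp add: indicator_def)
  qed
  finally show ?thesis .
qed

lemma emeasure_dom: "emeasure haar dom = ennreal (card orb * pi\<^sup>2 / 2)"
proof -
  have "emeasure haar dom = (\<integral>\<^sup>+M. indicator dom M * 1 \<partial>haar)" by simp
  also have "\<dots> = (\<Sum>p\<in>orb. \<integral>\<^sup>+M. indicator theta_dom M * 1 \<partial>haar)"
    by (rule nn_integral_dom) measurable
  also have "\<dots> = of_nat (card orb) * ennreal (pi\<^sup>2 / 2)" by (simp add: emeasure_theta_dom)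
  also have "\<dots> = ennreal (card orb * pi\<^sup>2 / 2)"
    by (simp add: ennreal_of_nat_eq_real_of_nat flip: ennreal_mult)
  finally show ?thesis .
qed

sublocale lattice stab dom
proof
  fix A B assume A: "A \<in> stab"
  then have AG: "A \<in> Gamma_theta" "A *v p0 - p0 \<in> int_vecs" by (auto simp: stab_def)
  show "det A = 1" by (rule Gamma_theta_det[OF AG(1)])
  show "A $ i $ j \<in> \<int>" for i j by (rule Gamma_theta_int[OF AG(1)])
  have "- (adj2 A *v (A *v p0 - p0)) \<in> int_vecs"
    using AG Gamma_theta_int[OF Gamma_theta_adj[OF AG(1)]] by (intro int_vecs_uminus int_vecs_mult)
  moreover have "- (adj2 A *v (A *v p0 - p0)) = adj2 A *v p0 - p0"
    using adj2_mult(1)[OF \<open>det A = 1\<close>] by (simp add: matrix_vector_mult_diff_distrib matrix_vector_mul_assoc)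
  ultimately show "adj2 A \<in> stab" using Gamma_theta_adj[OF AG(1)] by (simp add: stab_def)
  assume "B \<in> stab"
  then have BG: "B \<in> Gamma_theta" "B *v p0 - p0 \<in> int_vecs" by (auto simp: stab_def)
  have "A *v (B *v p0 - p0) + (A *v p0 - p0) \<in> int_vecs"
    using AG BG Gamma_theta_int[OF AG(1)] by (intro int_vecs_add int_vecs_mult)
  then show "A ** B \<in> stab"
    using Gamma_theta_mult[OF AG(1) BG(1)]
    by (simp add: stab_def matrix_vector_mult_diff_distrib matrix_vector_mul_assoc)
next
  show "dom \<in> sets borel" by (rule dom_borel)
  show "det M = 1" if M: "M \<in> dom" for M
  proof -
    obtain p where p: "p \<in> orb" "gam p ** M \<in> theta_dom" using M by (auto simp: dom_def)
    have "det (gam p ** M) = 1" using p(2) by (simp add: theta_dom_def)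
    then show ?thesis using Gamma_theta_det[OF gam(1)[OF p(1)]] by (simp add: det_mul)
  qed
  show "emeasure haar dom \<noteq> \<infinity>" by (simp add: emeasure_dom)
  show "AE M in haar. \<exists>!A. A \<in> stab \<and> A ** M \<in> dom"
    using theta_dom_fundamental
  proof eventually_elim
    case (elim M)
    then obtain A where A: "A \<in> Gamma_theta" "A ** M \<in> theta_dom" by blast
    \<comment> \<open>An \<open>A\<close> carrying \<open>M\<close> into \<open>theta_dom\<close>
      factors as \<open>gam p\<close> times an element of \<open>stab\<close>, with \<open>p\<close>
      the point to which \<open>A\<close> sends \<open>p0\<close>; that second factor carries
      \<open>M\<close> into \<open>dom\<close>.\<close>
    define p where "p = torus_rep (A *v p0)"
    have p: "p \<in> orb" using A(1) by (auto simp: p_def orb_def)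
    note g = gam(1)[OF p]
    have detg: "det (gam p) = 1" by (rule Gamma_theta_det[OF g])
    have "torus_rep (A *v p0) = torus_rep (gam p *v p0)" using gam(2)[OF p] by (simp add: p_def)
    then have "adj2 (gam p) *v (A *v p0 - gam p *v p0) \<in> int_vecs"
      using Gamma_theta_int[OF Gamma_theta_adj[OF g]] by (intro int_vecs_mult) (simp_all only: torus_rep_eq_iff)
    then have "(adj2 (gam p) ** A) *v p0 - p0 \<in> int_vecs"
      using adj2_mult(1)[OF detg] by (simp add: matrix_vector_mult_diff_distrib matrix_vector_mul_assoc)
    then have st: "adj2 (gam p) ** A \<in> stab"
      using g A(1) by (simp add: stab_def Gamma_theta_mult Gamma_theta_adj)
    have "gam p ** (adj2 (gam p) ** A ** M) = A ** M"
      using detg by (simp add: matrix_mul_assoc[symmetric])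
    then have "adj2 (gam p) ** A ** M \<in> dom"
      unfolding dom_def using A(2) by (intro UN_I[OF p]) (simp only: mem_Collect_eq)
    moreover have "B = B'" if "B \<in> stab" "B ** M \<in> dom" "B' \<in> stab" "B' ** M \<in> dom" for B B'
      using that gam_dom_unique[where M = M] unfolding dom_def by (auto simp: matrix_mul_assoc)
    ultimately show ?case using st by blast
  qed
qed

lemma vol_eq: "vol = card orb * pi\<^sup>2 / 2"
proof -
  have "emeasure nu UNIV = emeasure haar dom" by (simp add: nu_def emeasure_density)
  then show ?thesis by (simp add: measure_def emeasure_dom)
qed

lemma card_orb_pos: "card orb > 0"
  using finite_orb p0_in_orb card_gt_0_iff by blast

lemma vol_pos: "vol > 0"
  using card_orb_pos by (simp add: vol_eq)

end

section \<open>Continuous functions on the quotient and their fibres\<close>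

lemma topspace_quot_top: "topspace quot_top = rcosets\<^bsub>ASL2R\<^esub> Gamma_lat"
proof (rule antisym)
  show "topspace quot_top \<subseteq> rcosets\<^bsub>ASL2R\<^esub> Gamma_lat"
    using openin_topspace[of quot_top, unfolded openin_quot_top] by blast
  have "{g \<in> carrier ASL2R. Gamma_lat #>\<^bsub>ASL2R\<^esub> g \<in> rcosets\<^bsub>ASL2R\<^esub> Gamma_lat} = carrier ASL2R"
    by (auto simp: RCOSETS_def)
  then have "openin quot_top (rcosets\<^bsub>ASL2R\<^esub> Gamma_lat)" by (simp add: openin_quot_top)
  then show "rcosets\<^bsub>ASL2R\<^esub> Gamma_lat \<subseteq> topspace quot_top" by (rule openin_subset)
qed

lemma coset_in_topspace: "det M = 1 \<Longrightarrow> Gamma_lat #>\<^bsub>ASL2R\<^esub> (M, p) \<in> topspace quot_top"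
  by (auto simp: topspace_quot_top RCOSETS_def ASL2R_def)

lemma continuous_map_coset:
  "continuous_map (top_of_set {M. det M = 1}) quot_top (\<lambda>M. Gamma_lat #>\<^bsub>ASL2R\<^esub> (M, p))"
proof -
  have 1: "continuous_map (top_of_set {M :: real^2^2. det M = 1}) (top_of_set (carrier ASL2R)) (\<lambda>M. (M, p))"
    by (auto simp: ASL2R_def intro!: continuous_intros)
  have 2: "continuous_map (top_of_set (carrier ASL2R)) quot_top (\<lambda>g. Gamma_lat #>\<^bsub>ASL2R\<^esub> g)"
    unfolding continuous_map_def
  proof (intro conjI allI impI)
    show "(\<lambda>g. Gamma_lat #>\<^bsub>ASL2R\<^esub> g) \<in> topspace (top_of_set (carrier ASL2R)) \<rightarrow> topspace quot_top"
      by (auto simp: topspace_quot_top RCOSETS_def)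
    fix U assume "openin quot_top U"
    then show "openin (top_of_set (carrier ASL2R)) {x \<in> topspace (top_of_set (carrier ASL2R)). Gamma_lat #>\<^bsub>ASL2R\<^esub> x \<in> U}"
      by (simp add: openin_quot_top)
  qed
  show ?thesis using continuous_map_compose[OF 1 2] by (simp add: o_def)
qed

text \<open>The pullback to the slice of \<open>G\<close> with translation part \<open>p\<close>.
  The default 0 off \<open>SL(2)\<close> makes it Borel on all matrices, since the slice is
  closed.\<close>

definition fibre :: "(aff set \<Rightarrow> real) \<Rightarrow> real^2 \<Rightarrow> real^2^2 \<Rightarrow> real" where
  "fibre \<phi> p M = (if M \<in> {M. det M = 1} then \<phi> (Gamma_lat #>\<^bsub>ASL2R\<^esub> (M, p)) else 0)"

lemma fibre_continuous:
  assumes "continuous_map quot_top euclidean \<phi>"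
  shows "continuous_on {M. det M = 1} (\<lambda>M. \<phi> (Gamma_lat #>\<^bsub>ASL2R\<^esub> (M, p)))"
  using continuous_map_compose[OF continuous_map_coset assms] by (simp add: o_def)

lemma fibre_borel:
  assumes "continuous_map quot_top euclidean \<phi>"
  shows "fibre \<phi> p \<in> borel_measurable borel"
  unfolding fibre_def using SL2_in_borel
  by (intro borel_measurable_continuous_on_if fibre_continuous assms continuous_on_const) auto

abbreviation quot_borel :: "aff set measure" where
  "quot_borel \<equiv> sigma (topspace quot_top) {U. openin quot_top U}"

lemma opens_Pow: "{U. openin quot_top U} \<subseteq> Pow (topspace quot_top)"
  using openin_subset by auto

lemma continuous_map_quot_borel:
  fixes \<phi> :: "aff set \<Rightarrow> 'a :: topological_space"
  assumes "continuous_map quot_top euclidean \<phi>"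
  shows "\<phi> \<in> borel_measurable quot_borel"
proof (rule borel_measurableI)
  fix S :: "'a set" assume "open S"
  then have "openin quot_top {x \<in> topspace quot_top. \<phi> x \<in> S}"
    using openin_continuous_map_preimage[OF assms, of S] by simp
  moreover have "\<phi> -` S \<inter> space quot_borel = {x \<in> topspace quot_top. \<phi> x \<in> S}"
    by (auto simp: space_measure_of[OF opens_Pow])
  ultimately show "\<phi> -` S \<inter> space quot_borel \<in> sets quot_borel"
    by (simp add: sets_measure_of[OF opens_Pow] sigma_sets.Basic)
qed

lemma theta_coords_pos: "(x, y, \<phi>) \<in> theta_coords \<Longrightarrow> y > 0"
  by (simp add: theta_coords_def F_theta_iff)

lemma theta_coords_det: "z \<in> theta_coords \<Longrightarrow> det (iwasawa z) = 1"
  by (cases z) (simp add: det_iwasawa theta_coords_pos)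

section \<open>The limit measure and the equidistribution statement\<close>

context torsion_point
begin

definition coords_measure :: "((real \<times> real \<times> real) \<times> (real^2)) measure" where
  "coords_measure = density (restrict_space lborel theta_coords)
     (\<lambda>(x, y, \<phi>). ennreal (1 / (pi\<^sup>2 * real (card orb) * y\<^sup>2))) \<Otimes>\<^sub>M count_space orb"

definition quot_measure :: "aff set measure" where
  "quot_measure = distr coords_measure quot_borel (\<lambda>(c, p). Gamma_lat #>\<^bsub>ASL2R\<^esub> (iwasawa c, p))"

lemma space_coords_measure: "space coords_measure = theta_coords \<times> orb"
  by (simp add: coords_measure_def space_pair_measure space_restrict_space)

lemma measurable_density_weight [measurable]:
  "(\<lambda>(x, y, \<phi>). ennreal (1 / (k * y\<^sup>2))) \<in> borel_measurable (borel :: (real \<times> real \<times> real) measure)"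
proof -
  have "(\<lambda>(x :: real, y, \<phi> :: real). ennreal (1 / (k * y\<^sup>2))) \<in> borel_measurable (borel \<Otimes>\<^sub>M (borel \<Otimes>\<^sub>M (borel :: real measure)))"
    by measurable
  then show ?thesis by (simp add: borel_prod)
qed

text \<open>It suffices to look at preimages of open sets, and these split into finitely many
  slices, one for each point of the orbit.\<close>

lemma measurable_coset_map:
  "(\<lambda>(c, p). Gamma_lat #>\<^bsub>ASL2R\<^esub> (iwasawa c, p)) \<in> measurable coords_measure quot_borel"
proof (rule measurable_measure_of[OF opens_Pow])
  show "(\<lambda>(c, p). Gamma_lat #>\<^bsub>ASL2R\<^esub> (iwasawa c, p)) \<in> space coords_measure \<rightarrow> topspace quot_top"
    unfolding space_coords_measure using coset_in_topspace theta_coords_det by auto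
  fix U assume "U \<in> {U. openin quot_top U}"
  then have U: "openin quot_top U" by simp
  define V where "V p = {M. det M = 1 \<and> Gamma_lat #>\<^bsub>ASL2R\<^esub> (M, p) \<in> U}" for p
  have V: "V p \<in> sets borel" for p
  proof -
    have "openin (top_of_set {M. det M = 1}) {M \<in> {M. det M = 1}. Gamma_lat #>\<^bsub>ASL2R\<^esub> (M, p) \<in> U}"
      using openin_continuous_map_preimage[OF continuous_map_coset U] by simp
    then obtain T where "open T" "{M \<in> {M. det M = 1}. Gamma_lat #>\<^bsub>ASL2R\<^esub> (M, p) \<in> U} = {M. det M = 1} \<inter> T"
      by (auto simp: openin_open)
    then have "V p = {M. det M = 1} \<inter> T" by (auto simp: V_def)
    then show ?thesis using SL2_in_borel \<open>open T\<close> by auto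
  qed
  have "(\<lambda>(c, p). Gamma_lat #>\<^bsub>ASL2R\<^esub> (iwasawa c, p)) -` U \<inter> space coords_measure =
      (\<Union>p\<in>orb. (iwasawa -` V p \<inter> theta_coords) \<times> {p})"
    unfolding space_coords_measure V_def using theta_coords_det by auto
  also have "\<dots> \<in> sets coords_measure"
  proof (intro sets.finite_UN finite_orb)
    fix p assume "p \<in> orb"
    have "iwasawa -` V p \<in> sets borel" using measurable_sets[OF measurable_iwasawa_triple V] by simp
    then have "iwasawa -` V p \<inter> theta_coords \<in> sets (restrict_space lborel theta_coords)"
      by (auto simp: sets_restrict_space)
    then show "(iwasawa -` V p \<inter> theta_coords) \<times> {p} \<in> sets coords_measure"
      unfolding coords_measure_def using \<open>p \<in> orb\<close> by (intro pair_measureI) auto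
  qed
  finally show "(\<lambda>(c, p). Gamma_lat #>\<^bsub>ASL2R\<^esub> (iwasawa c, p)) -` U \<inter> space coords_measure \<in> sets coords_measure" .
qed

text \<open>Since \<open>gam p\<close> sends \<open>p0\<close> to \<open>p\<close> modulo integer
  vectors, all slices reduce to the one at \<open>p0\<close>, which contains the curve.\<close>

lemma fibre_gam:
  assumes p: "p \<in> orb" and M: "det M = 1"
  shows "fibre \<phi> p M = fibre \<phi> p0 (adj2 (gam p) ** M)"
proof -
  have det: "det (gam p) = 1" by (rule Gamma_theta_det[OF gam(1)[OF p]])
  have "Gamma_lat #>\<^bsub>ASL2R\<^esub> (gam p ** (adj2 (gam p) ** M), p) = Gamma_lat #>\<^bsub>ASL2R\<^esub> (adj2 (gam p) ** M, p0)"
    using det M by (intro coset_left_eq gam gam_diff p det_mult_1) auto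
  then show ?thesis using det M by (simp add: fibre_def det_mult_1)
qed

lemma fibre_invar: "invar (fibre \<phi> p0)"
  unfolding invar_def
proof (intro ballI allI impI)
  fix A M :: "real^2^2" assume A: "A \<in> stab" and M: "det M = 1"
  have "p0 - A *v p0 \<in> int_vecs" using A int_vecs_uminus[of "A *v p0 - p0"] by (simp add: stab_def)
  then have "Gamma_lat #>\<^bsub>ASL2R\<^esub> (A ** M, p0) = Gamma_lat #>\<^bsub>ASL2R\<^esub> (M, p0)"
    using A M by (intro coset_left_eq) (auto simp: stab_def)
  then show "fibre \<phi> p0 (A ** M) = fibre \<phi> p0 M"
    using M Lam_det[OF A] by (simp add: fibre_def det_mult_1)
qed

text \<open>The sum over the orbit of integrals over \<open>theta_dom\<close>, moved to the slice at
  \<open>p0\<close>, assembles to the integral over \<open>dom\<close>. The normalisation comes out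
  as \<open>1 / vol\<close>, so the limit measure is the normalised \<open>nu\<close>.\<close>

lemma nn_integral_quot_measure:
  assumes \<phi>: "continuous_map quot_top euclidean \<phi>"
  shows "(\<integral>\<^sup>+z. ennreal (\<phi> z) \<partial>quot_measure) = ennreal (1 / vol) * (\<integral>\<^sup>+M. ennreal (fibre \<phi> p0 M) \<partial>nu)"
proof -
  note [measurable] = fibre_borel[OF \<phi>] continuous_map_quot_borel[OF \<phi>]
  define k where "k = (\<lambda>(x :: real, y, \<phi> :: real). ennreal (1 / (pi\<^sup>2 * real (card orb) * y\<^sup>2)))"
  \<comment> \<open>The ratio of the prescribed weight \<open>1 / (pi^2 * card orb * y^2)\<close> to
    the Haar density \<open>1 / (2 * y^2)\<close>.\<close>
  define C where "C = 2 / (pi\<^sup>2 * real (card orb))"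
  have k_meas [measurable]: "k \<in> borel_measurable borel" unfolding k_def by measurable
  let ?R = "density (restrict_space lborel theta_coords) k"
  interpret cs: sigma_finite_measure "count_space orb"
    by (rule sigma_finite_measure_count_space_finite[OF finite_orb])
  have fm: "(\<lambda>z. fibre \<phi> p (iwasawa z)) \<in> borel_measurable (borel :: (real \<times> real \<times> real) measure)" for p
    by measurable
  have meas_pair: "(\<lambda>(c, p). ennreal (\<phi> (Gamma_lat #>\<^bsub>ASL2R\<^esub> (iwasawa c, p)))) \<in> borel_measurable coords_measure"
    using measurable_compose[OF measurable_coset_map, of "\<lambda>z. ennreal (\<phi> z)" borel] by (simp add: case_prod_beta')
  have "(\<integral>\<^sup>+z. ennreal (\<phi> z) \<partial>quot_measure) =
      (\<integral>\<^sup>+z. (case z of (c, p) \<Rightarrow> ennreal (\<phi> (Gamma_lat #>\<^bsub>ASL2R\<^esub> (iwasawa c, p)))) \<partial>coords_measure)"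
    unfolding quot_measure_def
    by (subst nn_integral_distr[OF measurable_coset_map]) (auto intro!: nn_integral_cong)
  also have "\<dots> = (\<integral>\<^sup>+c. \<integral>\<^sup>+p. ennreal (\<phi> (Gamma_lat #>\<^bsub>ASL2R\<^esub> (iwasawa c, p))) \<partial>count_space orb \<partial>?R)"
    using cs.nn_integral_fst[OF meas_pair[unfolded coords_measure_def k_def[symmetric]]]
    by (simp add: coords_measure_def k_def)
  also have "\<dots> = (\<integral>\<^sup>+c. (\<Sum>p\<in>orb. ennreal (fibre \<phi> p (iwasawa c))) \<partial>?R)"
  proof (rule nn_integral_cong)
    fix c assume "c \<in> space ?R"
    then have "det (iwasawa c) = 1" using theta_coords_det by (simp add: space_restrict_space)
    then show "(\<integral>\<^sup>+p. ennreal (\<phi> (Gamma_lat #>\<^bsub>ASL2R\<^esub> (iwasawa c, p))) \<partial>count_space orb) =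
        (\<Sum>p\<in>orb. ennreal (fibre \<phi> p (iwasawa c)))"
      by (simp add: nn_integral_count_space_finite[OF finite_orb] fibre_def)
  qed
  also have "\<dots> = (\<Sum>p\<in>orb. \<integral>\<^sup>+c. ennreal (fibre \<phi> p (iwasawa c)) \<partial>?R)"
    by (rule nn_integral_sum) (use fm in \<open>auto intro!: measurable_restrict_space1\<close>)
  also have "\<dots> = (\<Sum>p\<in>orb. ennreal C * (\<integral>\<^sup>+M. indicator theta_dom M * ennreal (fibre \<phi> p M) \<partial>haar))"
  proof (rule sum.cong[OF refl])
    fix p assume "p \<in> orb"
    have "(\<integral>\<^sup>+c. ennreal (fibre \<phi> p (iwasawa c)) \<partial>?R) = (\<integral>\<^sup>+c. k c * ennreal (fibre \<phi> p (iwasawa c)) \<partial>restrict_space lborel theta_coords)"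
      by (rule nn_integral_density) (use fm k_meas in \<open>auto intro!: measurable_restrict_space1\<close>)
    also have "\<dots> = (\<integral>\<^sup>+c. k c * ennreal (fibre \<phi> p (iwasawa c)) * indicator theta_coords c \<partial>lborel)"
      by (rule nn_integral_restrict_space) simp
    also have "\<dots> = (\<integral>\<^sup>+c. ennreal C * (indicator theta_coords c * (ennreal (1 / (2 * (fst (snd c))\<^sup>2)) * ennreal (fibre \<phi> p (iwasawa c)))) \<partial>lborel)"
    proof (rule nn_integral_cong)
      fix c :: "real \<times> real \<times> real"
      have "k c = ennreal C * ennreal (1 / (2 * (fst (snd c))\<^sup>2))"
        by (cases c) (simp add: k_def C_def flip: ennreal_mult)
      then show "k c * ennreal (fibre \<phi> p (iwasawa c)) * indicator theta_coords c =
          ennreal C * (indicator theta_coords c * (ennreal (1 / (2 * (fst (snd c))\<^sup>2)) * ennreal (fibre \<phi> p (iwasawa c))))"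
        by (simp add: mult_ac)
    qed
    also have "\<dots> = ennreal C * (\<integral>\<^sup>+c. indicator theta_coords c * (ennreal (1 / (2 * (fst (snd c))\<^sup>2)) * ennreal (fibre \<phi> p (iwasawa c))) \<partial>lborel)"
    proof (rule nn_integral_cmult)
      have [measurable]: "(\<lambda>c :: real \<times> real \<times> real. ennreal (1 / (2 * (fst (snd c))\<^sup>2))) \<in> borel_measurable borel"
        using measurable_density_weight[of 2] by (simp add: case_prod_beta')
      show "(\<lambda>c. indicator theta_coords c * (ennreal (1 / (2 * (fst (snd c))\<^sup>2)) * ennreal (fibre \<phi> p (iwasawa c)))) \<in> borel_measurable lborel"
        using fm by measurable
    qed
    also have "(\<integral>\<^sup>+c. indicator theta_coords c * (ennreal (1 / (2 * (fst (snd c))\<^sup>2)) * ennreal (fibre \<phi> p (iwasawa c))) \<partial>lborel) =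
        (\<integral>\<^sup>+M. indicator theta_dom M * ennreal (fibre \<phi> p M) \<partial>haar)"
      by (rule nn_integral_theta_dom[symmetric]) measurable
    finally show "(\<integral>\<^sup>+c. ennreal (fibre \<phi> p (iwasawa c)) \<partial>?R) = ennreal C * (\<integral>\<^sup>+M. indicator theta_dom M * ennreal (fibre \<phi> p M) \<partial>haar)" .
  qed
  also have "\<dots> = ennreal C * (\<Sum>p\<in>orb. \<integral>\<^sup>+M. indicator theta_dom M * ennreal (fibre \<phi> p0 (adj2 (gam p) ** M)) \<partial>haar)"
  proof -
    have "(\<integral>\<^sup>+M. indicator theta_dom M * ennreal (fibre \<phi> p M) \<partial>haar) =
        (\<integral>\<^sup>+M. indicator theta_dom M * ennreal (fibre \<phi> p0 (adj2 (gam p) ** M)) \<partial>haar)" if "p \<in> orb" for p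
      using fibre_gam[OF that] by (intro nn_integral_cong) (auto simp: indicator_def theta_dom_def)
    then show ?thesis by (simp add: sum_distrib_left)
  qed
  also have "(\<Sum>p\<in>orb. \<integral>\<^sup>+M. indicator theta_dom M * ennreal (fibre \<phi> p0 (adj2 (gam p) ** M)) \<partial>haar) =
      (\<integral>\<^sup>+M. indicator dom M * ennreal (fibre \<phi> p0 M) \<partial>haar)"
    by (rule nn_integral_dom[symmetric]) measurable
  also have "\<dots> = (\<integral>\<^sup>+M. ennreal (fibre \<phi> p0 M) \<partial>nu)"
    by (rule nn_integral_nu[symmetric]) measurable
  also have "C = 1 / vol" by (simp add: C_def vol_eq mult.commute)
  finally show ?thesis .
qed

lemma sets_quot_measure [simp, measurable_cong]: "sets quot_measure = sets quot_borel"
  and space_quot_measure [simp]: "space quot_measure = topspace quot_top"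
  by (simp_all add: quot_measure_def space_measure_of[OF opens_Pow])

lemma prob_quot_measure: "prob_space quot_measure"
proof
  have "continuous_map quot_top euclidean (\<lambda>_. 1 :: real)" by simp
  from nn_integral_quot_measure[OF this]
  have "emeasure quot_measure (topspace quot_top) = ennreal (1 / vol) * (\<integral>\<^sup>+M. ennreal (fibre (\<lambda>_. 1) p0 M) \<partial>nu)"
    by (simp flip: space_quot_measure)
  also have "(\<integral>\<^sup>+M. ennreal (fibre (\<lambda>_. 1) p0 M) \<partial>nu) = (\<integral>\<^sup>+M. 1 \<partial>nu)"
    using AE_nu_det by (intro nn_integral_cong_AE) (auto simp: fibre_def elim!: eventually_mono)
  also have "\<dots> = ennreal vol" by (simp add: nu.emeasure_eq_measure)
  also have "ennreal (1 / vol) * ennreal vol = 1" using vol_pos by (simp flip: ennreal_mult)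
  finally show "emeasure quot_measure (space quot_measure) = 1" by simp
qed

lemma fibre_bounded:
  assumes "\<And>z. z \<in> topspace quot_top \<Longrightarrow> \<bar>\<phi> z\<bar> \<le> B" "B \<ge> 0"
  shows "\<bar>fibre \<phi> p M\<bar> \<le> B"
  using assms coset_in_topspace by (simp add: fibre_def)

lemma integral_quot_measure:
  fixes \<phi> :: "aff set \<Rightarrow> real"
  assumes \<phi>: "continuous_map quot_top euclidean \<phi>" and B: "\<And>z. z \<in> topspace quot_top \<Longrightarrow> \<bar>\<phi> z\<bar> \<le> B" "B \<ge> 0"
  shows "(\<integral>z. \<phi> z \<partial>quot_measure) = (\<integral>M. fibre \<phi> p0 M \<partial>nu) / vol"
proof -
  interpret Q: prob_space quot_measure by (rule prob_quot_measure)
  note [measurable] = fibre_borel[OF \<phi>] continuous_map_quot_borel[OF \<phi>]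
  have int: "integrable quot_measure \<phi>"
    using B by (intro Q.integrable_const_bound[where B = B]) auto
  have intf: "integrable nu (fibre \<phi> p0)"
    using fibre_bounded[of \<phi> B p0] B by (intro integrable_nu_bounded[where B = B]) auto
  \<comment> \<open>Adding the bound makes the function nonnegative, so that the nonnegative
    integrals can be compared; the constant cancels because both sides are probability
    averages.\<close>
  have \<phi>B: "continuous_map quot_top euclidean (\<lambda>z. \<phi> z + B)"
    using continuous_map_add[OF \<phi>, of "\<lambda>_. B"] by simp
  have "(\<integral>z. \<phi> z + B \<partial>quot_measure) = enn2real (\<integral>\<^sup>+z. ennreal (\<phi> z + B) \<partial>quot_measure)"
  proof (rule integral_eq_nn_integral)
    show "AE z in quot_measure. 0 \<le> \<phi> z + B"
    proof (rule AE_I2)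
      fix z assume "z \<in> space quot_measure"
      then show "0 \<le> \<phi> z + B" using B(1)[of z] by simp
    qed
  qed measurable
  also have "(\<integral>\<^sup>+z. ennreal (\<phi> z + B) \<partial>quot_measure) = ennreal (1 / vol) * (\<integral>\<^sup>+M. ennreal (fibre (\<lambda>z. \<phi> z + B) p0 M) \<partial>nu)"
    by (rule nn_integral_quot_measure[OF \<phi>B])
  also have "(\<integral>\<^sup>+M. ennreal (fibre (\<lambda>z. \<phi> z + B) p0 M) \<partial>nu) = (\<integral>\<^sup>+M. ennreal (fibre \<phi> p0 M + B) \<partial>nu)"
    by (rule nn_integral_cong_AE, rule eventually_mono[OF AE_nu_det]) (simp add: fibre_def)
  also have "\<dots> = ennreal (\<integral>M. fibre \<phi> p0 M + B \<partial>nu)"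
  proof (rule nn_integral_eq_integral)
    show "AE M in nu. 0 \<le> fibre \<phi> p0 M + B"
    proof (rule AE_I2)
      fix M show "0 \<le> fibre \<phi> p0 M + B" using fibre_bounded[of \<phi> B p0 M] B by simp
    qed
  qed (use intf in auto)
  also have "enn2real (ennreal (1 / vol) * \<dots>) = (\<integral>M. fibre \<phi> p0 M + B \<partial>nu) / vol"
  proof -
    have "0 \<le> (\<integral>M. fibre \<phi> p0 M + B \<partial>nu)"
    proof (rule integral_nonneg_AE, rule AE_I2)
      fix M show "0 \<le> fibre \<phi> p0 M + B" using fibre_bounded[of \<phi> B p0 M] B by simp
    qed
    then show ?thesis using vol_pos by (simp flip: ennreal_mult)
  qed
  also have "\<dots> = (\<integral>M. fibre \<phi> p0 M \<partial>nu) / vol + B"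
    using intf vol_pos by (simp add: add_divide_distrib)
  finally show ?thesis using int Q.prob_space by simp
qed

lemma equidistribution_real:
  fixes \<phi> :: "aff set \<Rightarrow> real"
  assumes \<phi>: "continuous_map quot_top euclidean \<phi>" and B: "\<And>z. z \<in> topspace quot_top \<Longrightarrow> \<bar>\<phi> z\<bar> \<le> B" "B \<ge> 0"
    and L: "prob_space L" "sets L = sets borel" "absolutely_continuous lborel L"
  shows "((\<lambda>t. \<integral>u. \<phi> (Gamma_lat #>\<^bsub>ASL2R\<^esub> (upr u ** geo t, p0)) \<partial>L) \<longlongrightarrow> (\<integral>z. \<phi> z \<partial>quot_measure)) at_top"
proof -
  have cont: "continuous_on {M. det M = 1} (fibre \<phi> p0)"
    using fibre_continuous[OF \<phi>, of p0] by (rule continuous_on_eq) (simp add: fibre_def)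
  have eq: "fibre \<phi> p0 (upr u ** geo t) = \<phi> (Gamma_lat #>\<^bsub>ASL2R\<^esub> (upr u ** geo t, p0))" for u t
    using det_mult_1[of "upr u" "geo t"] by (simp add: fibre_def)
  have bd: "\<bar>fibre \<phi> p0 M\<bar> \<le> B" for M using B by (rule fibre_bounded)
  have "(\<integral>z. \<phi> z \<partial>quot_measure) = (\<integral>M. fibre \<phi> p0 M \<partial>nu) / vol"
    using \<phi> B by (rule integral_quot_measure)
  then show ?thesis
    using equidistribution[OF fibre_borel[OF \<phi>] fibre_invar bd cont vol_pos L] by (simp only: eq)
qed

end

theorem theorem4p1p1:
  fixes \<alpha> \<beta> :: real and a b q :: nat
    and L :: "real measure"
    and F :: "aff set \<Rightarrow> complex"
  assumes "\<alpha> \<in> \<rat>" and "\<beta> \<in> \<rat>"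
    and "q \<ge> 1"
    and "frac \<alpha> = real a / real q" and "frac \<beta> = real b / real q"
    and "Gcd {a, b, q} = 1"
    and "prob_space L" and "sets L = sets borel" and "absolutely_continuous lborel L"
    and "continuous_map quot_top euclidean F"
    and "bounded (F ` (rcosets\<^bsub>ASL2R\<^esub> Gamma_lat))"
  shows "((\<lambda>t. \<integral>u. F (Gamma_lat #>\<^bsub>ASL2R\<^esub>
              ((mat 1, vector [\<alpha>, \<beta>]) \<otimes>\<^bsub>ASL2R\<^esub> Psi u \<otimes>\<^bsub>ASL2R\<^esub> Phi t)) \<partial>L)
          \<longlongrightarrow> (\<integral>z. F z \<partial>mu_quot \<alpha> \<beta>)) at_top"
proof -
  define \<xi> :: "real^2" where "\<xi> = vector [\<alpha>, \<beta>]"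
  define p0 where "p0 = torus_rep \<xi>"
  have q\<xi>: "real q *\<^sub>R \<xi> \<in> int_vecs"
  proof -
    \<comment> \<open>The common denominator \<open>q\<close> of the fractional parts also clears
      \<alpha> and \<beta>, whose integral parts do no harm.\<close>
    have "real q * \<alpha> = real a + real q * of_int \<lfloor>\<alpha>\<rfloor>" "real q * \<beta> = real b + real q * of_int \<lfloor>\<beta>\<rfloor>"
      using assms(3-5) by (simp_all add: frac_def field_simps)
    then have "real q * \<alpha> \<in> \<int>" "real q * \<beta> \<in> \<int>" by simp_all
    then show ?thesis by (simp add: \<xi>_def forall_2 vector_2)
  qed
  interpret T: torsion_point p0 q
  proof
    show "q > 0" using assms(3) by simp
    have eq: "real q *\<^sub>R p0 = real q *\<^sub>R (p0 - \<xi>) + real q *\<^sub>R \<xi>" by (simp add: scaleR_diff_right)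
    have "real q *\<^sub>R (p0 - \<xi>) \<in> int_vecs"
      using torus_rep_diff[of \<xi>] by (auto simp: p0_def intro!: Ints_mult)
    then show "real q *\<^sub>R p0 \<in> int_vecs" by (subst eq) (rule int_vecs_add[OF _ q\<xi>])
    show "torus_rep p0 = p0" by (simp add: p0_def torus_rep_idem)
  qed
  have orb: "torus_orbit \<alpha> \<beta> = T.orb"
    by (simp only: torus_orbit_eq T.orb_def) (simp only: p0_def \<xi>_def)
  have mu: "mu_quot \<alpha> \<beta> = T.quot_measure"
    unfolding mu_quot_def T.quot_measure_def T.coords_measure_def orb theta_coords_def ..
  have pt: "Gamma_lat #>\<^bsub>ASL2R\<^esub> ((mat 1, vector [\<alpha>, \<beta>]) \<otimes>\<^bsub>ASL2R\<^esub> Psi u \<otimes>\<^bsub>ASL2R\<^esub> Phi t) =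
      Gamma_lat #>\<^bsub>ASL2R\<^esub> (upr u ** geo t, p0)" for u t
  proof -
    have "(mat 1, vector [\<alpha>, \<beta>]) \<otimes>\<^bsub>ASL2R\<^esub> Psi u \<otimes>\<^bsub>ASL2R\<^esub> Phi t = (upr u ** geo t, \<xi>)"
      by (simp add: ASL2R_def Psi_def Phi_def geo_def \<xi>_def)
    \<comment> \<open>Replacing the vector by its representative is left multiplication by an
      integer translation, an element of \<Gamma>.\<close>
    moreover have "Gamma_lat #>\<^bsub>ASL2R\<^esub> (mat 1 ** (upr u ** geo t), p0) = Gamma_lat #>\<^bsub>ASL2R\<^esub> (upr u ** geo t, \<xi>)"
      using torus_rep_diff[of \<xi>]
      by (intro coset_left_eq Gamma_theta_one det_mult_1) (simp_all add: p0_def)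
    ultimately show ?thesis by simp
  qed
  obtain B where B: "\<And>z. z \<in> topspace quot_top \<Longrightarrow> norm (F z) \<le> B" "B \<ge> 0"
  proof -
    obtain B where "\<forall>x\<in>F ` (rcosets\<^bsub>ASL2R\<^esub> Gamma_lat). norm x \<le> B"
      using assms(11) by (auto simp: bounded_iff)
    then have "norm (F z) \<le> max B 0" if "z \<in> topspace quot_top" for z
      using that unfolding topspace_quot_top by (auto simp: le_max_iff_disj)
    then show ?thesis using that[of "max B 0"] by simp
  qed
  note L = assms(7-9)
  interpret L: prob_space L by (rule L(1))
  interpret Q: prob_space T.quot_measure by (rule T.prob_quot_measure)
  \<comment> \<open>\<open>F\<close> is complex, whereas minorants need the order of the reals, so
    real and imaginary parts are treated separately.\<close>
  have cont: "continuous_map quot_top euclidean (\<lambda>z. Re (F z))" "continuous_map quot_top euclidean (\<lambda>z. Im (F z))"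
    using continuous_map_compose[OF assms(10), of euclidean Re] continuous_map_compose[OF assms(10), of euclidean Im]
    by (simp_all add: o_def continuous_on_Re continuous_on_Im)
  have bd: "\<bar>Re (F z)\<bar> \<le> B" "\<bar>Im (F z)\<bar> \<le> B" if "z \<in> topspace quot_top" for z
    using B(1)[OF that] abs_Re_le_cmod[of "F z"] abs_Im_le_cmod[of "F z"] by linarith+
  have intQ: "integrable T.quot_measure F"
    using B continuous_map_quot_borel[OF assms(10)]
    by (intro Q.integrable_const_bound[where B = B]) auto
  have intL: "integrable L (\<lambda>u. F (Gamma_lat #>\<^bsub>ASL2R\<^esub> (upr u ** geo t, p0)))" for t
  proof (rule L.integrable_const_bound[where B = B])
    show "AE u in L. norm (F (Gamma_lat #>\<^bsub>ASL2R\<^esub> (upr u ** geo t, p0))) \<le> B"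
      by (intro AE_I2 B coset_in_topspace det_mult_1) simp_all
    have "continuous_on UNIV (\<lambda>u. F (Gamma_lat #>\<^bsub>ASL2R\<^esub> (upr u ** geo t, p0)))"
    proof (rule continuous_on_compose2[where f = "\<lambda>u. upr u ** geo t"])
      show "continuous_on {M. det M = 1} (\<lambda>M. F (Gamma_lat #>\<^bsub>ASL2R\<^esub> (M, p0)))"
        using continuous_map_compose[OF continuous_map_coset assms(10)] by (simp add: o_def)
      show "(\<lambda>u. upr u ** geo t) ` UNIV \<subseteq> {M. det M = 1}" by (auto intro!: det_mult_1)
    qed (intro continuous_intros)
    then show "(\<lambda>u. F (Gamma_lat #>\<^bsub>ASL2R\<^esub> (upr u ** geo t, p0))) \<in> borel_measurable L"
      using borel_measurable_continuous_onI measurable_cong_sets[OF L(2) refl] by blast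
  qed
  show ?thesis
    unfolding pt mu tendsto_complex_iff
    using T.equidistribution_real[OF cont(1) bd(1) B(2) L] T.equidistribution_real[OF cont(2) bd(2) B(2) L]
    by (simp only: integral_Re[OF intL] integral_Im[OF intL] integral_Re[OF intQ] integral_Im[OF intQ])
qed

end
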